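(* Let $(H,p)$ and $(H',p')$ be quasitriangular Hopf algebras over a field $K$, with $p=p_i\otimes p^i\in H\otimes H$ and $p'=p'_j\otimes p'^j\in H'\otimes H'$, and let $r=r_k\otimes r^k\in H\otimes H'$ be a weak $\mathfrak R$-matrix of $(H,H')$, with $R=r^{-1}=R_n\otimes R^n$. Set $$[p,p']=r_kp_i\otimes p'_jR^n\otimes p^iR_n\otimes r^kp'^j\in(H\otimes H')\otimes(H\otimes H').$$ Let $\bar S$ be the antipode of the bicrossed coproduct Hopf algebra $H\bowtie^rH'$ (so that $(H\bowtie^r H',[p,p'])$ is a quasitriangular Hopf algebra). Then $(H\otimes H',[p,p'],\mathrm{id}_{H\otimes H'},\bar S^{-2})$ is an oriented quantum algebra, and it is equal to the oriented quantum algebra $(H\otimes H',[p,p'],\mathrm{id}_{H\otimes H'},S_H^{-2}\otimes S_{H'}^{-2})$.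
   Context: All algebraic systems are over a field $K$; $\otimes=\otimes_K$; algebras are associative and unital. $S_H$ denotes the antipode of a Hopf algebra $H$; $\Delta(h)=h_1\otimes h_2$ is Sweedler notation. Summation convention: an element $r=\sum r_i\otimes r^i$ of a tensor product is written formally as $r=r_i\otimes r^i=r_j\otimes r^j=\cdots$, different indices denoting independent copies of the sum. Oriented quantum algebra (OQA): a quadruple $(A,r,D,U)$ where $A$ is an algebra, $r=r_i\otimes r^i\in A\otimes A$ is invertible with inverse $R_l\otimes R^l$, and $D,U$ are commuting algebra automorphisms of $A$, such that (1) $D(R_l)r_i\otimes U(r^i)R^l=1\otimes1=r_iD(R_l)\otimes R^lU(r^i)$; (2) $(D\otimes D)(r)=r=(U\otimes U)(r)$; (3) $r_{12}r_{13}r_{23}=r_{23}r_{13}r_{12}$. Quasitriangular Hopf algebra: a pair $(H,r)$, $H$ a Hopf algebra and $r=r_i\otimes r^i\in H\otimes H$ with $(\Delta\otimes \mathrm{id})(r)=r_j\otimes r_i\otimes r^jr^i$, $(\mathrm{id}\otimes\Delta)(r)=r_jr_i\otimes r^i\otimes r^j$, $\Delta^{cop}(h)r=r\Delta(h)$ for all $h\in H$ (where $\Delta^{cop}(h)=h_2\otimes h_1$), and $\varepsilon(r_i)r^i=r_i\varepsilon(r^i)=1$. In this case $r$ is invertible and the antipode $S_H$ is bijective. Weak $\mathfrak R$-matrix of $(H,H')$, for bialgebras $H,H'$: an invertible element $r=r_i\otimes r^i\in H\otimes H'$ with $(\Delta\otimes \mathrm{id})(r)=r_i\otimes r_j\otimes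 r^ir^j$ and $(\mathrm{id}\otimes\Delta)(r)=r_ir_j\otimes r^j\otimes r^i$. Bicrossed coproduct Hopf algebra $H\bowtie^rH'$ (for Hopf algebras $H,H'$ and a weak $\mathfrak R$-matrix $r$ of $(H,H')$ with $r^{-1}=R_l\otimes R^l$): it equals $H\otimes H'$ as an algebra, with coproduct $\bar\Delta(h\otimes h')=h_1\otimes r^ih'_1R^l\otimes r_ih_2R_l\otimes h'_2$ and antipode $\bar S(h\otimes h')=r^{-1}(S_H(h)\otimes S_{H'}(h'))r$. Known facts (Chen): $H\bowtie^rH'$ is a Hopf algebra, and if $(H,p)$, $(H',p')$ are quasitriangular then $(H\bowtie^rH',[p,p'])$ is quasitriangular. *)

theory Defs
  imports "HOL-Algebra.Module"
begin

section \<open>Algebras over a field\<close>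

text \<open>The library locale \<^locale>\<open>algebra\<close> demands commutativity, so the associative unital algebras
  used here are introduced separately.\<close>

locale kalgebra = K?: field K + A?: module K A + A?: ring A
  for K (structure) and A (structure) +
  assumes smult_mult_left:
      "\<lbrakk>k \<in> carrier K; x \<in> carrier A; y \<in> carrier A\<rbrakk>
        \<Longrightarrow> (k \<odot>\<^bsub>A\<^esub> x) \<otimes>\<^bsub>A\<^esub> y = k \<odot>\<^bsub>A\<^esub> (x \<otimes>\<^bsub>A\<^esub> y)"
    and smult_mult_right:
      "\<lbrakk>k \<in> carrier K; x \<in> carrier A; y \<in> carrier A\<rbrakk>
        \<Longrightarrow> x \<otimes>\<^bsub>A\<^esub> (k \<odot>\<^bsub>A\<^esub> y) = k \<odot>\<^bsub>A\<^esub> (x \<otimes>\<^bsub>A\<^esub> y)"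

definition linear_maps ::
  "('k, 'c) ring_scheme \<Rightarrow> ('k, 'a, 'm) module_scheme \<Rightarrow> ('k, 'b, 'n) module_scheme \<Rightarrow> ('a \<Rightarrow> 'b) set"
  where "linear_maps K A B = {f \<in> carrier A \<rightarrow> carrier B.
    (\<forall>x\<in>carrier A. \<forall>y\<in>carrier A. f (x \<oplus>\<^bsub>A\<^esub> y) = f x \<oplus>\<^bsub>B\<^esub> f y) \<and>
    (\<forall>k\<in>carrier K. \<forall>x\<in>carrier A. f (k \<odot>\<^bsub>A\<^esub> x) = k \<odot>\<^bsub>B\<^esub> f x)}"

definition algebra_homs ::
  "('k, 'c) ring_scheme \<Rightarrow> ('k, 'a, 'm) module_scheme \<Rightarrow> ('k, 'b, 'n) module_scheme \<Rightarrow> ('a \<Rightarrow> 'b) set"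
  where "algebra_homs K A B = ring_hom A B \<inter> linear_maps K A B"

definition algebra_auts ::
  "('k, 'c) ring_scheme \<Rightarrow> ('k, 'a, 'm) module_scheme \<Rightarrow> ('a \<Rightarrow> 'a) set"
  where "algebra_auts K A = {f \<in> algebra_homs K A A. bij_betw f (carrier A) (carrier A)}"


section \<open>Tensor products\<close>

text \<open>A formal sum of pure tensors is a list of pairs. The tensor product of \<open>A\<close> and \<open>B\<close> over \<open>K\<close>
  consists of the classes of such lists modulo the congruence (for concatenation) generated by
  commutativity of the sum, biadditivity and \<open>K\<close>-balancedness. Scalar coefficients need not be part
  of a formal sum, since they are absorbed by the tensor factors; additive inverses are the classes
  of the lists of pairs \<open>(-a, b)\<close>.\<close>

inductive tensor_eq ::
  "('k, 'c) ring_scheme \<Rightarrow> ('k, 'a, 'm) module_scheme \<Rightarrow> ('k, 'b, 'n) module_scheme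
    \<Rightarrow> ('a \<times> 'b) list \<Rightarrow> ('a \<times> 'b) list \<Rightarrow> bool"
  for K and A and B where
  refl: "set xs \<subseteq> carrier A \<times> carrier B \<Longrightarrow> tensor_eq K A B xs xs"
| sym: "tensor_eq K A B xs ys \<Longrightarrow> tensor_eq K A B ys xs"
| trans: "tensor_eq K A B xs ys \<Longrightarrow> tensor_eq K A B ys zs \<Longrightarrow> tensor_eq K A B xs zs"
| append: "tensor_eq K A B xs xs' \<Longrightarrow> tensor_eq K A B ys ys'
    \<Longrightarrow> tensor_eq K A B (xs @ ys) (xs' @ ys')"
| comm: "set xs \<subseteq> carrier A \<times> carrier B \<Longrightarrow> set ys \<subseteq> carrier A \<times> carrier B
    \<Longrightarrow> tensor_eq K A B (xs @ ys) (ys @ xs)"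
| add_left: "a \<in> carrier A \<Longrightarrow> a' \<in> carrier A \<Longrightarrow> b \<in> carrier B
    \<Longrightarrow> tensor_eq K A B [(a \<oplus>\<^bsub>A\<^esub> a', b)] [(a, b), (a', b)]"
| add_right: "a \<in> carrier A \<Longrightarrow> b \<in> carrier B \<Longrightarrow> b' \<in> carrier B
    \<Longrightarrow> tensor_eq K A B [(a, b \<oplus>\<^bsub>B\<^esub> b')] [(a, b), (a, b')]"
| zero_left: "b \<in> carrier B \<Longrightarrow> tensor_eq K A B [(\<zero>\<^bsub>A\<^esub>, b)] []"
| zero_right: "a \<in> carrier A \<Longrightarrow> tensor_eq K A B [(a, \<zero>\<^bsub>B\<^esub>)] []"
| balanced: "k \<in> carrier K \<Longrightarrow> a \<in> carrier A \<Longrightarrow> b \<in> carrier B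
    \<Longrightarrow> tensor_eq K A B [(k \<odot>\<^bsub>A\<^esub> a, b)] [(a, k \<odot>\<^bsub>B\<^esub> b)]"

type_synonym ('a, 'b) tensor = "('a \<times> 'b) list set"

definition tensor_class ::
  "('k, 'c) ring_scheme \<Rightarrow> ('k, 'a, 'm) module_scheme \<Rightarrow> ('k, 'b, 'n) module_scheme
    \<Rightarrow> ('a \<times> 'b) list \<Rightarrow> ('a, 'b) tensor"
  where "tensor_class K A B xs = {ys. tensor_eq K A B xs ys}"

definition pure_tensor ::
  "('k, 'c) ring_scheme \<Rightarrow> ('k, 'a, 'm) module_scheme \<Rightarrow> ('k, 'b, 'n) module_scheme
    \<Rightarrow> 'a \<Rightarrow> 'b \<Rightarrow> ('a, 'b) tensor"
  where "pure_tensor K A B a b = tensor_class K A B [(a, b)]"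

definition tensor_rep :: "('a, 'b) tensor \<Rightarrow> ('a \<times> 'b) list"
  where "tensor_rep x = (SOME xs. xs \<in> x)"

definition tensor_algebra ::
  "('k, 'c) ring_scheme \<Rightarrow> ('k, 'a, 'm) module_scheme \<Rightarrow> ('k, 'b, 'n) module_scheme
    \<Rightarrow> ('k, ('a, 'b) tensor) module"
  where "tensor_algebra K A B =
   \<lparr>carrier = {tensor_class K A B xs | xs. set xs \<subseteq> carrier A \<times> carrier B},
    mult = (\<lambda>x y. tensor_class K A B
      [(a \<otimes>\<^bsub>A\<^esub> a', b \<otimes>\<^bsub>B\<^esub> b'). (a, b) \<leftarrow> tensor_rep x, (a', b') \<leftarrow> tensor_rep y]),
    one = pure_tensor K A B \<one>\<^bsub>A\<^esub> \<one>\<^bsub>B\<^esub>,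
    zero = tensor_class K A B [],
    add = (\<lambda>x y. tensor_class K A B (tensor_rep x @ tensor_rep y)),
    smult = (\<lambda>k x. tensor_class K A B [(k \<odot>\<^bsub>A\<^esub> a, b). (a, b) \<leftarrow> tensor_rep x])\<rparr>"

text \<open>The value at \<open>x = \<Sum> a\<^sub>i \<otimes> b\<^sub>i\<close> of the linear map induced by a bilinear map \<open>f\<close> into \<open>M\<close>, that is
  \<open>\<Sum> f a\<^sub>i b\<^sub>i\<close>. This is how the Sweedler-type summation convention is rendered. By
  \<open>tensor_sum_tensor_class\<close> below the chosen representative of \<open>x\<close> is irrelevant.\<close>

definition tensor_sum ::
  "('d, 'm) ring_scheme \<Rightarrow> ('a, 'b) tensor \<Rightarrow> ('a \<Rightarrow> 'b \<Rightarrow> 'd) \<Rightarrow> 'd"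
  where "tensor_sum M x f = foldr (\<lambda>(a, b) s. f a b \<oplus>\<^bsub>M\<^esub> s) (tensor_rep x) \<zero>\<^bsub>M\<^esub>"

text \<open>The map \<open>f \<otimes> g\<close> from \<open>A \<otimes> B\<close> to \<open>A' \<otimes> B'\<close>. It is made \<^term>\<open>undefined\<close> outside the
  carrier, so that equality of such functions is equality on \<open>A \<otimes> B\<close>.\<close>

definition tensor_map ::
  "('k, 'c) ring_scheme \<Rightarrow> ('k, 'a, 'm) module_scheme \<Rightarrow> ('k, 'b, 'n) module_scheme
    \<Rightarrow> ('k, 'd, 'p) module_scheme \<Rightarrow> ('k, 'e, 'q) module_scheme
    \<Rightarrow> ('a \<Rightarrow> 'd) \<Rightarrow> ('b \<Rightarrow> 'e) \<Rightarrow> ('a, 'b) tensor \<Rightarrow> ('d, 'e) tensor"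
  where "tensor_map K A B A' B' f g =
    (\<lambda>x\<in>carrier (tensor_algebra K A B).
      tensor_sum (tensor_algebra K A' B') x (\<lambda>a b. pure_tensor K A' B' (f a) (g b)))"

text \<open>Threefold tensor products are bracketed to the right.\<close>

abbreviation tensor_algebra3 ::
  "('k, 'c) ring_scheme \<Rightarrow> ('k, 'a, 'm) module_scheme \<Rightarrow> ('k, 'b, 'n) module_scheme
    \<Rightarrow> ('k, 'd, 'p) module_scheme \<Rightarrow> ('k, ('a, ('b, 'd) tensor) tensor) module"
  where "tensor_algebra3 K A B C \<equiv> tensor_algebra K A (tensor_algebra K B C)"

abbreviation pure_tensor3 ::
  "('k, 'c) ring_scheme \<Rightarrow> ('k, 'a, 'm) module_scheme \<Rightarrow> ('k, 'b, 'n) module_scheme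
    \<Rightarrow> ('k, 'd, 'p) module_scheme \<Rightarrow> 'a \<Rightarrow> 'b \<Rightarrow> 'd \<Rightarrow> ('a, ('b, 'd) tensor) tensor"
  where "pure_tensor3 K A B C a b c \<equiv>
    pure_tensor K A (tensor_algebra K B C) a (pure_tensor K B C b c)"

lemma tensor_eq_set:
  assumes "module K A" "module K B" "tensor_eq K A B xs ys"
  shows "set xs \<subseteq> carrier A \<times> carrier B \<and> set ys \<subseteq> carrier A \<times> carrier B"
proof -
  interpret A: module K A by fact
  interpret B: module K B by fact
  show ?thesis using assms(3) by induction auto
qed

lemma tensor_sum_tensor_class:
  assumes A: "module K A" and B: "module K B" and M: "abelian_group M"
    and xs: "set xs \<subseteq> carrier A \<times> carrier B"
    and closed: "\<And>a b. \<lbrakk>a \<in> carrier A; b \<in> carrier B\<rbrakk> \<Longrightarrow> f a b \<in> carrier M"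
    and add_l: "\<And>a a' b. \<lbrakk>a \<in> carrier A; a' \<in> carrier A; b \<in> carrier B\<rbrakk>
      \<Longrightarrow> f (a \<oplus>\<^bsub>A\<^esub> a') b = f a b \<oplus>\<^bsub>M\<^esub> f a' b"
    and add_r: "\<And>a b b'. \<lbrakk>a \<in> carrier A; b \<in> carrier B; b' \<in> carrier B\<rbrakk>
      \<Longrightarrow> f a (b \<oplus>\<^bsub>B\<^esub> b') = f a b \<oplus>\<^bsub>M\<^esub> f a b'"
    and bal: "\<And>k a b. \<lbrakk>k \<in> carrier K; a \<in> carrier A; b \<in> carrier B\<rbrakk>
      \<Longrightarrow> f (k \<odot>\<^bsub>A\<^esub> a) b = f a (k \<odot>\<^bsub>B\<^esub> b)"
  shows "tensor_sum M (tensor_class K A B xs) f = foldr (\<lambda>(a, b) s. f a b \<oplus>\<^bsub>M\<^esub> s) xs \<zero>\<^bsub>M\<^esub>"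
proof -
  interpret A: module K A by fact
  interpret B: module K B by fact
  interpret M: abelian_group M by fact
  let ?s = "\<lambda>xs. foldr (\<lambda>(a, b) s. f a b \<oplus>\<^bsub>M\<^esub> s) xs \<zero>\<^bsub>M\<^esub>"
  have cl: "?s xs \<in> carrier M" if "set xs \<subseteq> carrier A \<times> carrier B" for xs
    using that by (induction xs) (auto intro: closed)
  have app: "?s (xs @ ys) = ?s xs \<oplus>\<^bsub>M\<^esub> ?s ys"
    if "set xs \<subseteq> carrier A \<times> carrier B" "set ys \<subseteq> carrier A \<times> carrier B" for xs ys
    using that
  proof (induction xs)
    case Nil
    then show ?case using cl by simp
  next
    case (Cons p xs)
    then show ?case using cl[of xs] cl[of ys] closed by (cases p) (auto simp: M.a_assoc)
  qed
  have zl: "f \<zero>\<^bsub>A\<^esub> b = \<zero>\<^bsub>M\<^esub>" if "b \<in> carrier B" for b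
    using add_l[of "\<zero>\<^bsub>A\<^esub>" "\<zero>\<^bsub>A\<^esub>" b] that closed[of "\<zero>\<^bsub>A\<^esub>" b] by simp
  have zr: "f a \<zero>\<^bsub>B\<^esub> = \<zero>\<^bsub>M\<^esub>" if "a \<in> carrier A" for a
    using add_r[of a "\<zero>\<^bsub>B\<^esub>" "\<zero>\<^bsub>B\<^esub>"] that closed[of a "\<zero>\<^bsub>B\<^esub>"] by simp
  have inv: "?s xs = ?s ys" if "tensor_eq K A B xs ys" for xs ys
    using that
  proof induction
    case (append xs xs' ys ys')
    then show ?case
      using tensor_eq_set[OF A B append.hyps(1)] tensor_eq_set[OF A B append.hyps(2)]
      by (simp only: app)
  next
    case (comm xs ys)
    then show ?case using cl[of xs] cl[of ys] app[of xs ys] app[of ys xs] M.a_comm by metis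
  qed (simp_all add: closed add_l add_r bal zl zr)
  have "tensor_eq K A B xs (tensor_rep (tensor_class K A B xs))"
    using someI[of "\<lambda>ys. tensor_eq K A B xs ys" xs] tensor_eq.refl[OF xs, of K]
    by (simp add: tensor_rep_def tensor_class_def)
  from inv[OF this] show ?thesis by (simp add: tensor_sum_def)
qed


section \<open>Hopf algebras\<close>

record ('k, 'a) bialg = "('k, 'a) module" +
  comult :: "'a \<Rightarrow> ('a, 'a) tensor"
  counit :: "'a \<Rightarrow> 'k"

record ('k, 'a) hopf = "('k, 'a) bialg" +
  antipode :: "'a \<Rightarrow> 'a"

locale bialgebra = kalgebra K H
  for K :: "('k, 'c) ring_scheme" and H :: "('k, 'a, 'm) bialg_scheme" +
  assumes comult_hom: "comult H \<in> algebra_homs K H (tensor_algebra K H H)"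
    and counit_hom: "counit H \<in> ring_hom H K"
    and counit_smult:
      "\<lbrakk>k \<in> carrier K; h \<in> carrier H\<rbrakk> \<Longrightarrow> counit H (k \<odot>\<^bsub>H\<^esub> h) = k \<otimes>\<^bsub>K\<^esub> counit H h"
    and coassoc: "h \<in> carrier H \<Longrightarrow>
      tensor_sum (tensor_algebra3 K H H H) (comult H h) (\<lambda>h1 h2.
        tensor_sum (tensor_algebra3 K H H H) (comult H h1) (\<lambda>x y. pure_tensor3 K H H H x y h2)) =
      tensor_sum (tensor_algebra3 K H H H) (comult H h) (\<lambda>h1 h2.
        tensor_sum (tensor_algebra3 K H H H) (comult H h2) (\<lambda>x y. pure_tensor3 K H H H h1 x y))"
    and counit_left: "h \<in> carrier H \<Longrightarrow>
      tensor_sum H (comult H h) (\<lambda>h1 h2. counit H h1 \<odot>\<^bsub>H\<^esub> h2) = h"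
    and counit_right: "h \<in> carrier H \<Longrightarrow>
      tensor_sum H (comult H h) (\<lambda>h1 h2. counit H h2 \<odot>\<^bsub>H\<^esub> h1) = h"

locale hopf_algebra = bialgebra K H
  for K :: "('k, 'c) ring_scheme" and H :: "('k, 'a, 'm) hopf_scheme" +
  assumes antipode_linear: "antipode H \<in> linear_maps K H H"
    and antipode_left: "h \<in> carrier H \<Longrightarrow>
      tensor_sum H (comult H h) (\<lambda>h1 h2. antipode H h1 \<otimes>\<^bsub>H\<^esub> h2) = counit H h \<odot>\<^bsub>H\<^esub> \<one>\<^bsub>H\<^esub>"
    and antipode_right: "h \<in> carrier H \<Longrightarrow>
      tensor_sum H (comult H h) (\<lambda>h1 h2. h1 \<otimes>\<^bsub>H\<^esub> antipode H h2) = counit H h \<odot>\<^bsub>H\<^esub> \<one>\<^bsub>H\<^esub>"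

locale quasitriangular_hopf_algebra = hopf_algebra K H
  for K :: "('k, 'c) ring_scheme" and H :: "('k, 'a, 'm) hopf_scheme" +
  fixes r :: "('a, 'a) tensor"
  assumes r_closed: "r \<in> carrier (tensor_algebra K H H)"
    and comult_left:
      "tensor_sum (tensor_algebra3 K H H H) r (\<lambda>a b.
        tensor_sum (tensor_algebra3 K H H H) (comult H a) (\<lambda>a1 a2. pure_tensor3 K H H H a1 a2 b)) =
       tensor_sum (tensor_algebra3 K H H H) r (\<lambda>rj rj'.
        tensor_sum (tensor_algebra3 K H H H) r (\<lambda>ri ri'.
          pure_tensor3 K H H H rj ri (rj' \<otimes>\<^bsub>H\<^esub> ri')))"
    and comult_right:
      "tensor_sum (tensor_algebra3 K H H H) r (\<lambda>a b.
        tensor_sum (tensor_algebra3 K H H H) (comult H b) (\<lambda>b1 b2. pure_tensor3 K H H H a b1 b2)) =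
       tensor_sum (tensor_algebra3 K H H H) r (\<lambda>rj rj'.
        tensor_sum (tensor_algebra3 K H H H) r (\<lambda>ri ri'.
          pure_tensor3 K H H H (rj \<otimes>\<^bsub>H\<^esub> ri) ri' rj'))"
    and almost_cocommutative: "h \<in> carrier H \<Longrightarrow>
      tensor_sum (tensor_algebra K H H) (comult H h) (\<lambda>h1 h2. pure_tensor K H H h2 h1)
        \<otimes>\<^bsub>tensor_algebra K H H\<^esub> r
      = r \<otimes>\<^bsub>tensor_algebra K H H\<^esub> comult H h"
    and counit_r_left: "tensor_sum H r (\<lambda>ri ri'. counit H ri \<odot>\<^bsub>H\<^esub> ri') = \<one>\<^bsub>H\<^esub>"
    and counit_r_right: "tensor_sum H r (\<lambda>ri ri'. counit H ri' \<odot>\<^bsub>H\<^esub> ri) = \<one>\<^bsub>H\<^esub>"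

locale weak_R_matrix = H: bialgebra K H + H': bialgebra K H'
  for K :: "('k, 'c) ring_scheme"
    and H :: "('k, 'a, 'm) bialg_scheme" and H' :: "('k, 'b, 'n) bialg_scheme" +
  fixes r :: "('a, 'b) tensor"
  assumes r_unit: "r \<in> Units (tensor_algebra K H H')"
    and comult_left:
      "tensor_sum (tensor_algebra3 K H H H') r (\<lambda>a b.
        tensor_sum (tensor_algebra3 K H H H') (comult H a) (\<lambda>a1 a2.
          pure_tensor3 K H H H' a1 a2 b)) =
       tensor_sum (tensor_algebra3 K H H H') r (\<lambda>ri ri'.
        tensor_sum (tensor_algebra3 K H H H') r (\<lambda>rj rj'.
          pure_tensor3 K H H H' ri rj (ri' \<otimes>\<^bsub>H'\<^esub> rj')))"
    and comult_right:
      "tensor_sum (tensor_algebra3 K H H' H') r (\<lambda>a b.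
        tensor_sum (tensor_algebra3 K H H' H') (comult H' b) (\<lambda>b1 b2.
          pure_tensor3 K H H' H' a b1 b2)) =
       tensor_sum (tensor_algebra3 K H H' H') r (\<lambda>ri ri'.
        tensor_sum (tensor_algebra3 K H H' H') r (\<lambda>rj rj'.
          pure_tensor3 K H H' H' (ri \<otimes>\<^bsub>H\<^esub> rj) rj' ri'))"

definition bicrossed_coproduct ::
  "('k, 'c) ring_scheme \<Rightarrow> ('k, 'a, 'm) hopf_scheme \<Rightarrow> ('k, 'b, 'n) hopf_scheme
    \<Rightarrow> ('a, 'b) tensor \<Rightarrow> ('k, ('a, 'b) tensor) hopf"
  where "bicrossed_coproduct K H H' r =
   (let T = tensor_algebra K H H'; TT = tensor_algebra K T T; R = inv\<^bsub>T\<^esub> r in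
    \<lparr>carrier = carrier T, mult = mult T, one = one T, zero = zero T, add = add T, smult = smult T,
     comult = (\<lambda>x. tensor_sum TT x (\<lambda>h h'.
       tensor_sum TT (comult H h) (\<lambda>h1 h2. tensor_sum TT (comult H' h') (\<lambda>h1' h2'.
       tensor_sum TT r (\<lambda>ri ri'. tensor_sum TT R (\<lambda>Rl Rl'.
         pure_tensor K T T
           (pure_tensor K H H' h1 (ri' \<otimes>\<^bsub>H'\<^esub> h1' \<otimes>\<^bsub>H'\<^esub> Rl'))
           (pure_tensor K H H' (ri \<otimes>\<^bsub>H\<^esub> h2 \<otimes>\<^bsub>H\<^esub> Rl) h2'))))))),
     counit = (\<lambda>x. tensor_sum K x (\<lambda>h h'. counit H h \<otimes>\<^bsub>K\<^esub> counit H' h')),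
     antipode = (\<lambda>x. R \<otimes>\<^bsub>T\<^esub> tensor_map K H H' H H' (antipode H) (antipode H') x \<otimes>\<^bsub>T\<^esub> r)\<rparr>)"

text \<open>The element written \<open>[p, p']\<close>.\<close>

definition bicrossed_R_matrix ::
  "('k, 'c) ring_scheme \<Rightarrow> ('k, 'a, 'm) hopf_scheme \<Rightarrow> ('k, 'b, 'n) hopf_scheme
    \<Rightarrow> ('a, 'b) tensor \<Rightarrow> ('a, 'a) tensor \<Rightarrow> ('b, 'b) tensor
    \<Rightarrow> (('a, 'b) tensor, ('a, 'b) tensor) tensor"
  where "bicrossed_R_matrix K H H' r p p' =
   (let T = tensor_algebra K H H'; TT = tensor_algebra K T T; R = inv\<^bsub>T\<^esub> r in
    tensor_sum TT r (\<lambda>rk rk'. tensor_sum TT p (\<lambda>pi pi'.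
    tensor_sum TT p' (\<lambda>qj qj'. tensor_sum TT R (\<lambda>Rn Rn'.
      pure_tensor K T T
        (pure_tensor K H H' (rk \<otimes>\<^bsub>H\<^esub> pi) (qj \<otimes>\<^bsub>H'\<^esub> Rn'))
        (pure_tensor K H H' (pi' \<otimes>\<^bsub>H\<^esub> Rn) (rk' \<otimes>\<^bsub>H'\<^esub> qj')))))))"

text \<open>The map \<open>S\<^sup>-\<^sup>2\<close> on the carrier of \<open>A\<close>, for a bijection \<open>S\<close> of that carrier.\<close>

definition inverse_square :: "('a, 'm) partial_object_scheme \<Rightarrow> ('a \<Rightarrow> 'a) \<Rightarrow> 'a \<Rightarrow> 'a"
  where "inverse_square A S =
    (\<lambda>x\<in>carrier A. inv_into (carrier A) S (inv_into (carrier A) S x))"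


section \<open>Oriented quantum algebras\<close>

locale oriented_quantum_algebra = kalgebra K A
  for K :: "('k, 'c) ring_scheme" and A :: "('k, 'a, 'm) module_scheme" +
  fixes r :: "('a, 'a) tensor" and D U :: "'a \<Rightarrow> 'a"
  assumes r_unit: "r \<in> Units (tensor_algebra K A A)"
    and D_aut: "D \<in> algebra_auts K A"
    and U_aut: "U \<in> algebra_auts K A"
    and D_U_commute: "x \<in> carrier A \<Longrightarrow> D (U x) = U (D x)"
    and inverse_left:
      "tensor_sum (tensor_algebra K A A) (inv\<^bsub>tensor_algebra K A A\<^esub> r) (\<lambda>Rl Rl'.
        tensor_sum (tensor_algebra K A A) r (\<lambda>ri ri'.
          pure_tensor K A A (D Rl \<otimes>\<^bsub>A\<^esub> ri) (U ri' \<otimes>\<^bsub>A\<^esub> Rl'))) =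
       pure_tensor K A A \<one>\<^bsub>A\<^esub> \<one>\<^bsub>A\<^esub>"
    and inverse_right:
      "tensor_sum (tensor_algebra K A A) (inv\<^bsub>tensor_algebra K A A\<^esub> r) (\<lambda>Rl Rl'.
        tensor_sum (tensor_algebra K A A) r (\<lambda>ri ri'.
          pure_tensor K A A (ri \<otimes>\<^bsub>A\<^esub> D Rl) (Rl' \<otimes>\<^bsub>A\<^esub> U ri'))) =
       pure_tensor K A A \<one>\<^bsub>A\<^esub> \<one>\<^bsub>A\<^esub>"
    and D_invariant: "tensor_map K A A A A D D r = r"
    and U_invariant: "tensor_map K A A A A U U r = r"
    and yang_baxter:
      "(let T3 = tensor_algebra3 K A A A;
            r12 = tensor_sum T3 r (\<lambda>ri ri'. pure_tensor3 K A A A ri ri' \<one>\<^bsub>A\<^esub>);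
            r13 = tensor_sum T3 r (\<lambda>ri ri'. pure_tensor3 K A A A ri \<one>\<^bsub>A\<^esub> ri');
            r23 = tensor_sum T3 r (\<lambda>ri ri'. pure_tensor3 K A A A \<one>\<^bsub>A\<^esub> ri ri')
        in r12 \<otimes>\<^bsub>T3\<^esub> r13 \<otimes>\<^bsub>T3\<^esub> r23 = r23 \<otimes>\<^bsub>T3\<^esub> r13 \<otimes>\<^bsub>T3\<^esub> r12)"

end

theory Submission
  imports Defs
begin

text \<open>Write \<open>T = H \<otimes> H'\<close> and number the tensor factors of \<open>T \<otimes> T = H \<otimes> H' \<otimes> H \<otimes> H'\<close>, so that
  \<open>[p, p'] = r\<^sub>1\<^sub>4 p\<^sub>1\<^sub>3 p'\<^sub>2\<^sub>4 R\<^sub>3\<^sub>2\<close>. The Hopf algebra structure of the bicrossed coproduct is not needed.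
  Both \<open>p\<close> and \<open>r\<close> satisfy \<open>(S \<otimes> id)(r) = r\<^sup>-\<^sup>1\<close> and \<open>(id \<otimes> S)(r\<^sup>-\<^sup>1) = r\<close>, hence \<open>(S \<otimes> S)(r) = r\<close>; this
  gives the square of the antipode of the bicrossed coproduct as \<open>S\<^sup>2 \<otimes> S\<^sup>2\<close>, and the antipodes are bijective
  because \<open>S\<^sup>2\<close> is conjugation by the Drinfeld element. Almost cocommutativity yields mixed Yang--Baxter
  equations for triples of strands with two strands in \<open>H\<close> or two in \<open>H'\<close>, and the Yang--Baxter equation
  for \<open>[p, p']\<close> follows by sliding the crossings in the three layers past one another. Finally, the inversion
  axiom (1) with \<open>D = id\<close> says that \<open>(id \<otimes> U)[p, p']\<close> is the inverse of \<open>[p, p']\<^sup>-\<^sup>1\<close> in \<open>T \<otimes> T\<^sup>o\<^sup>p\<close>, where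
  both elements are products of four factors that are inverse to each other one by one.\<close>

section \<open>Linear and bilinear maps\<close>

text \<open>Elements of a tensor product are classes of lists, so working in four- or sixfold
  products of H and H' would mean constant rebracketing. Instead a tensor x enters an arbitrary
  algebra M as \<open>legs M f g x\<close>, its image under a pair of linear maps f, g. If f and g
  are commuting algebra maps, this is the algebra map they induce, and it carries identities from
  two tensor factors into M. The same statements then serve in T \<otimes> T, in T \<otimes> (T
  \<otimes> T) and in T \<otimes> T^op.

  The exponent -2 comes from T \<otimes> T^op. Take r with its right leg in the opposite factor,
  where it reverses products. One S^-1 makes this leg multiplicative and gives an algebra map
  \<theta> on H \<otimes> H'. The untwisted leg sends r^-1 to \<theta>(r), while the leg twisted by
  S^-2 sends r to \<theta>(r^-1). Thus two powers of S^-1 make the two elements mutually inverse.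

  The formula r^-1 = (S \<otimes> id)(r) rests on (\<epsilon> \<otimes> id)(r) = 1. For p and p'
  this is an axiom; for the weak R-matrix it is obtained by cancelling the invertible r.\<close>

lemma linear_mapsI:
  assumes "\<And>x. x \<in> carrier A \<Longrightarrow> f x \<in> carrier B"
    and "\<And>x y. x \<in> carrier A \<Longrightarrow> y \<in> carrier A \<Longrightarrow> f (x \<oplus>\<^bsub>A\<^esub> y) = f x \<oplus>\<^bsub>B\<^esub> f y"
    and "\<And>k x. k \<in> carrier K \<Longrightarrow> x \<in> carrier A \<Longrightarrow> f (k \<odot>\<^bsub>A\<^esub> x) = k \<odot>\<^bsub>B\<^esub> f x"
  shows "f \<in> linear_maps K A B"
  using assms by (auto simp: linear_maps_def)

lemma linear_mapsD:
  assumes "f \<in> linear_maps K A B"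
  shows "x \<in> carrier A \<Longrightarrow> f x \<in> carrier B"
    and "x \<in> carrier A \<Longrightarrow> y \<in> carrier A \<Longrightarrow> f (x \<oplus>\<^bsub>A\<^esub> y) = f x \<oplus>\<^bsub>B\<^esub> f y"
    and "k \<in> carrier K \<Longrightarrow> x \<in> carrier A \<Longrightarrow> f (k \<odot>\<^bsub>A\<^esub> x) = k \<odot>\<^bsub>B\<^esub> f x"
  using assms by (auto simp: linear_maps_def)

definition bilinear_maps ::
  "('k, 'c) ring_scheme \<Rightarrow> ('k, 'a, 'm) module_scheme \<Rightarrow> ('k, 'b, 'n) module_scheme
    \<Rightarrow> ('k, 'd, 'p) module_scheme \<Rightarrow> ('a \<Rightarrow> 'b \<Rightarrow> 'd) set"
  where "bilinear_maps K A B M = {f.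
    (\<forall>a\<in>carrier A. (\<lambda>b. f a b) \<in> linear_maps K B M) \<and>
    (\<forall>b\<in>carrier B. (\<lambda>a. f a b) \<in> linear_maps K A M)}"

lemma bilinear_mapsI:
  assumes "\<And>a. a \<in> carrier A \<Longrightarrow> (\<lambda>b. f a b) \<in> linear_maps K B M"
    and "\<And>b. b \<in> carrier B \<Longrightarrow> (\<lambda>a. f a b) \<in> linear_maps K A M"
  shows "f \<in> bilinear_maps K A B M"
  using assms by (auto simp: bilinear_maps_def)

lemma bilinear_mapsD:
  assumes "f \<in> bilinear_maps K A B M"
  shows "a \<in> carrier A \<Longrightarrow> (\<lambda>b. f a b) \<in> linear_maps K B M"
    and "b \<in> carrier B \<Longrightarrow> (\<lambda>a. f a b) \<in> linear_maps K A M"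
  using assms by (auto simp: bilinear_maps_def)

section \<open>The tensor product of modules\<close>

locale module_pair = A: module K A + B: module K B
  for K :: "('k, 'c) ring_scheme"
    and A :: "('k, 'a, 'm) module_scheme" and B :: "('k, 'b, 'n) module_scheme"
begin

abbreviation "T \<equiv> tensor_algebra K A B"
abbreviation "pairs \<equiv> carrier A \<times> carrier B"
abbreviation "cls \<equiv> tensor_class K A B"
abbreviation "pure \<equiv> pure_tensor K A B"

lemma tensor_class_eq_iff:
  assumes "set xs \<subseteq> pairs"
  shows "cls xs = cls ys \<longleftrightarrow> tensor_eq K A B xs ys"
proof
  assume "cls xs = cls ys"
  then have "xs \<in> cls ys"
    using tensor_eq.refl[OF assms, of K] by (auto simp: tensor_class_def)
  then show "tensor_eq K A B xs ys" by (auto simp: tensor_class_def intro: tensor_eq.sym)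
next
  assume "tensor_eq K A B xs ys"
  then show "cls xs = cls ys"
    by (auto simp: tensor_class_def intro: tensor_eq.sym tensor_eq.trans)
qed

lemma tensor_eq_tensor_rep:
  assumes "set xs \<subseteq> pairs"
  shows "tensor_eq K A B xs (tensor_rep (cls xs))"
  using someI[of "\<lambda>ys. tensor_eq K A B xs ys" xs] tensor_eq.refl[OF assms, of K]
  by (simp add: tensor_rep_def tensor_class_def)

lemma tensor_class_closed [intro]: "set xs \<subseteq> pairs \<Longrightarrow> cls xs \<in> carrier T"
  by (auto simp: tensor_algebra_def)

lemma
  assumes "x \<in> carrier T"
  shows tensor_rep_pairs: "set (tensor_rep x) \<subseteq> pairs"
    and tensor_class_tensor_rep: "cls (tensor_rep x) = x"
proof -
  obtain xs where x: "x = cls xs" "set xs \<subseteq> pairs"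
    using assms by (auto simp: tensor_algebra_def)
  show "set (tensor_rep x) \<subseteq> pairs"
    using tensor_eq_tensor_rep[OF x(2)] tensor_eq_set[OF A.module_axioms B.module_axioms] x(1)
    by blast
  show "cls (tensor_rep x) = x"
    using tensor_eq_tensor_rep[OF x(2)] x tensor_class_eq_iff by blast
qed

lemma tensor_zero: "\<zero>\<^bsub>T\<^esub> = cls []"
  by (simp add: tensor_algebra_def)

lemma tensor_class_append:
  assumes "set xs \<subseteq> pairs" "set ys \<subseteq> pairs"
  shows "cls (xs @ ys) = cls xs \<oplus>\<^bsub>T\<^esub> cls ys"
proof -
  have "tensor_eq K A B (xs @ ys) (tensor_rep (cls xs) @ tensor_rep (cls ys))"
    using assms by (intro tensor_eq.append tensor_eq_tensor_rep)
  then show ?thesis using assms by (simp add: tensor_algebra_def tensor_class_eq_iff)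
qed

lemma tensor_class_Cons:
  "a \<in> carrier A \<Longrightarrow> b \<in> carrier B \<Longrightarrow> set xs \<subseteq> pairs
    \<Longrightarrow> cls ((a, b) # xs) = pure a b \<oplus>\<^bsub>T\<^esub> cls xs"
  using tensor_class_append[of "[(a, b)]" xs] by (simp add: pure_tensor_def)

lemma tensor_cases:
  assumes "x \<in> carrier T"
  obtains xs where "set xs \<subseteq> pairs" "x = cls xs"
  using assms by (auto simp: tensor_algebra_def)

lemma pure_tensor_closed [simp, intro]:
  "a \<in> carrier A \<Longrightarrow> b \<in> carrier B \<Longrightarrow> pure a b \<in> carrier T"
  by (auto simp: pure_tensor_def)

lemma tensor_class_eqI: "set xs \<subseteq> pairs \<Longrightarrow> tensor_eq K A B xs ys \<Longrightarrow> cls xs = cls ys"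
  by (simp add: tensor_class_eq_iff)

lemma pure_tensor_add_left:
  "a \<in> carrier A \<Longrightarrow> a' \<in> carrier A \<Longrightarrow> b \<in> carrier B \<Longrightarrow>
    pure (a \<oplus>\<^bsub>A\<^esub> a') b = pure a b \<oplus>\<^bsub>T\<^esub> pure a' b"
  using tensor_class_eqI[OF _ tensor_eq.add_left, of a a' b] tensor_class_append[of "[(a, b)]"
    "[(a', b)]"]
  by (simp add: pure_tensor_def)

lemma pure_tensor_add_right:
  "a \<in> carrier A \<Longrightarrow> b \<in> carrier B \<Longrightarrow> b' \<in> carrier B \<Longrightarrow>
    pure a (b \<oplus>\<^bsub>B\<^esub> b') = pure a b \<oplus>\<^bsub>T\<^esub> pure a b'"
  using tensor_class_eqI[OF _ tensor_eq.add_right, of a b b'] tensor_class_append[of "[(a, b)]"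
    "[(a, b')]"]
  by (simp add: pure_tensor_def)

lemma pure_tensor_zero_left: "b \<in> carrier B \<Longrightarrow> pure \<zero>\<^bsub>A\<^esub> b = \<zero>\<^bsub>T\<^esub>"
  using tensor_class_eqI[OF _ tensor_eq.zero_left, of b]
  by (simp add: pure_tensor_def tensor_zero)

lemma pure_tensor_balanced:
  "k \<in> carrier K \<Longrightarrow> a \<in> carrier A \<Longrightarrow> b \<in> carrier B \<Longrightarrow>
    pure (k \<odot>\<^bsub>A\<^esub> a) b = pure a (k \<odot>\<^bsub>B\<^esub> b)"
  using tensor_class_eqI[OF _ tensor_eq.balanced, of k a b] by (simp add: pure_tensor_def)

lemma tensor_abelian_group: "abelian_group T"
proof (rule abelian_groupI)
  fix x y z assume x: "x \<in> carrier T" and y: "y \<in> carrier T" and z: "z \<in> carrier T"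
  obtain xs where xs: "set xs \<subseteq> pairs" "x = cls xs" using x by (rule tensor_cases)
  obtain ys where ys: "set ys \<subseteq> pairs" "y = cls ys" using y by (rule tensor_cases)
  obtain zs where zs: "set zs \<subseteq> pairs" "z = cls zs" using z by (rule tensor_cases)
  have "set (xs @ ys) \<subseteq> pairs" using xs ys by auto
  then show "x \<oplus>\<^bsub>T\<^esub> y \<in> carrier T"
    using tensor_class_append[OF xs(1) ys(1)] xs ys by (metis tensor_class_closed)
  show "x \<oplus>\<^bsub>T\<^esub> y \<oplus>\<^bsub>T\<^esub> z = x \<oplus>\<^bsub>T\<^esub> (y \<oplus>\<^bsub>T\<^esub> z)"
    using tensor_class_append[of "xs @ ys" zs] tensor_class_append[of xs "ys @ zs"] xs ys zs
    by (simp add: tensor_class_append)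
  show "x \<oplus>\<^bsub>T\<^esub> y = y \<oplus>\<^bsub>T\<^esub> x"
    using tensor_class_eqI[OF _ tensor_eq.comm, of xs ys] xs ys
    by (simp add: tensor_class_append)
  show "\<zero>\<^bsub>T\<^esub> \<oplus>\<^bsub>T\<^esub> x = x"
    using tensor_class_append[of "[]" xs] xs by (simp add: tensor_zero)
next
  show "\<zero>\<^bsub>T\<^esub> \<in> carrier T" by (auto simp: tensor_zero)
next
  fix x assume "x \<in> carrier T"
  then obtain xs where xs: "set xs \<subseteq> pairs" "x = cls xs" by (rule tensor_cases)
  \<comment> \<open>The negatives are collected in reverse order, so that each (-a, b) stands
    directly before its partner (a, b) in the middle of the list and cancels there.\<close>
  have "\<exists>ys. set ys \<subseteq> pairs \<and> cls (ys @ xs) = \<zero>\<^bsub>T\<^esub>"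
    using xs(1)
  proof (induction xs)
    case Nil
    then show ?case by (intro exI[of _ "[]"]) (simp add: tensor_zero)
  next
    case (Cons q xs)
    obtain a b where q: "q = (a, b)" "a \<in> carrier A" "b \<in> carrier B"
      using Cons.prems by (cases q) auto
    from Cons obtain ys where ys: "set ys \<subseteq> pairs" "cls (ys @ xs) = \<zero>\<^bsub>T\<^esub>" by auto
    have "cls [(\<ominus>\<^bsub>A\<^esub> a, b), (a, b)] = cls []"
      using q pure_tensor_add_left[of "\<ominus>\<^bsub>A\<^esub> a" a b] pure_tensor_zero_left[of b]
        tensor_class_append[of "[(\<ominus>\<^bsub>A\<^esub> a, b)]" "[(a, b)]"]
      by (simp add: pure_tensor_def tensor_zero A.l_neg)
    then have 1: "tensor_eq K A B [(\<ominus>\<^bsub>A\<^esub> a, b), (a, b)] []"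
      using q by (subst (asm) tensor_class_eq_iff) auto
    have 2: "tensor_eq K A B (ys @ xs) []"
      using ys Cons.prems by (subst (asm) tensor_zero, subst (asm) tensor_class_eq_iff) auto
    have "tensor_eq K A B (ys @ [(\<ominus>\<^bsub>A\<^esub> a, b), (a, b)] @ xs) (ys @ [] @ xs)"
      using ys Cons.prems by (intro tensor_eq.append 1) (auto intro: tensor_eq.refl)
    then have "tensor_eq K A B (ys @ [(\<ominus>\<^bsub>A\<^esub> a, b), (a, b)] @ xs) []"
      using 2 by (auto intro: tensor_eq.trans)
    then show ?case
      using q ys Cons.prems
      by (intro exI[of _ "ys @ [(\<ominus>\<^bsub>A\<^esub> a, b)]"]) (auto simp: tensor_zero tensor_class_eq_iff)
  qed
  then show "\<exists>y\<in>carrier T. y \<oplus>\<^bsub>T\<^esub> x = \<zero>\<^bsub>T\<^esub>"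
    using xs tensor_class_append by (metis tensor_class_closed)
qed

sublocale T: abelian_group T by (rule tensor_abelian_group)

lemma tensor_induct [consumes 1, case_names zero pure_tensor add]:
  assumes x: "x \<in> carrier T"
    and zero: "Q \<zero>\<^bsub>T\<^esub>"
    and pure_tensor: "\<And>a b. a \<in> carrier A \<Longrightarrow> b \<in> carrier B \<Longrightarrow> Q (pure a b)"
    and add: "\<And>x y. x \<in> carrier T \<Longrightarrow> y \<in> carrier T \<Longrightarrow> Q x \<Longrightarrow> Q y \<Longrightarrow> Q (x \<oplus>\<^bsub>T\<^esub> y)"
  shows "Q x"
proof -
  have "Q (cls xs)" if "set xs \<subseteq> pairs" for xs
    using that
  proof (induction xs)
    case Nil
    then show ?case using zero by (simp add: tensor_zero)
  next
    case (Cons q xs)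
    then show ?case by (cases q) (auto simp: tensor_class_Cons intro!: add pure_tensor)
  qed
  then show ?thesis using x by (metis tensor_cases)
qed

text \<open>Since \<open>tensor_sum\<close> evaluates one fixed representative, this lemma and the
  next ones hold for arbitrary \<open>f\<close>. Bilinearity enters only when the tensor itself
  varies, where the choice of representative matters.\<close>

lemma tensor_sum_closed:
  assumes "abelian_group M" "x \<in> carrier T"
    and "\<And>a b. a \<in> carrier A \<Longrightarrow> b \<in> carrier B \<Longrightarrow> f a b \<in> carrier M"
  shows "tensor_sum M x f \<in> carrier M"
proof -
  interpret M: abelian_group M by fact
  have "foldr (\<lambda>(a, b) s. f a b \<oplus>\<^bsub>M\<^esub> s) xs \<zero>\<^bsub>M\<^esub> \<in> carrier M" if "set xs \<subseteq> pairs" for xs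
    using that by (induction xs) (auto intro: assms(3))
  then show ?thesis using tensor_rep_pairs[OF assms(2)] by (simp add: tensor_sum_def)
qed

lemma tensor_sum_cong:
  assumes "x \<in> carrier T"
    and "\<And>a b. a \<in> carrier A \<Longrightarrow> b \<in> carrier B \<Longrightarrow> f a b = g a b"
  shows "tensor_sum M x f = tensor_sum M x g"
proof -
  have "foldr (\<lambda>(a, b) s. f a b \<oplus>\<^bsub>M\<^esub> s) xs \<zero>\<^bsub>M\<^esub> = foldr (\<lambda>(a, b) s. g a b \<oplus>\<^bsub>M\<^esub> s) xs \<zero>\<^bsub>M\<^esub>"
    if "set xs \<subseteq> pairs" for xs
    using that by (induction xs) (auto simp: assms(2))
  then show ?thesis using tensor_rep_pairs[OF assms(1)] by (simp add: tensor_sum_def)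
qed

lemma additive_tensor_sum:
  assumes "abelian_group M" "abelian_group N" "x \<in> carrier T"
    and f: "\<And>a b. a \<in> carrier A \<Longrightarrow> b \<in> carrier B \<Longrightarrow> f a b \<in> carrier M"
    and cl: "\<And>x. x \<in> carrier M \<Longrightarrow> \<phi> x \<in> carrier N"
    and add: "\<And>x y. x \<in> carrier M \<Longrightarrow> y \<in> carrier M \<Longrightarrow> \<phi> (x \<oplus>\<^bsub>M\<^esub> y) = \<phi> x \<oplus>\<^bsub>N\<^esub> \<phi> y"
  shows "\<phi> (tensor_sum M x f) = tensor_sum N x (\<lambda>a b. \<phi> (f a b))"
proof -
  interpret M: abelian_group M by fact
  interpret N: abelian_group N by fact
  have z: "\<phi> \<zero>\<^bsub>M\<^esub> = \<zero>\<^bsub>N\<^esub>"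
    using add[of "\<zero>\<^bsub>M\<^esub>" "\<zero>\<^bsub>M\<^esub>"] cl[of "\<zero>\<^bsub>M\<^esub>"] by simp
  have "foldr (\<lambda>(a, b) s. f a b \<oplus>\<^bsub>M\<^esub> s) xs \<zero>\<^bsub>M\<^esub> \<in> carrier M \<and>
      \<phi> (foldr (\<lambda>(a, b) s. f a b \<oplus>\<^bsub>M\<^esub> s) xs \<zero>\<^bsub>M\<^esub>) =
      foldr (\<lambda>(a, b) s. \<phi> (f a b) \<oplus>\<^bsub>N\<^esub> s) xs \<zero>\<^bsub>N\<^esub>" if "set xs \<subseteq> pairs" for xs
    using that by (induction xs) (auto simp: z add f)
  then show ?thesis using tensor_rep_pairs[OF assms(3)] by (simp add: tensor_sum_def)
qed

lemma tensor_sum_zero_fun: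
  assumes "abelian_group M" shows "tensor_sum M x (\<lambda>a b. \<zero>\<^bsub>M\<^esub>) = \<zero>\<^bsub>M\<^esub>"
proof -
  interpret M: abelian_group M by fact
  have "foldr (\<lambda>(a, b) s. \<zero>\<^bsub>M\<^esub> \<oplus>\<^bsub>M\<^esub> s) xs \<zero>\<^bsub>M\<^esub> = \<zero>\<^bsub>M\<^esub>" for xs :: "('p \<times> 'q) list"
    by (induction xs) auto
  then show ?thesis by (simp add: tensor_sum_def)
qed

lemma tensor_sum_add_fun:
  assumes "abelian_group M" "x \<in> carrier T"
    and f: "\<And>a b. a \<in> carrier A \<Longrightarrow> b \<in> carrier B \<Longrightarrow> f a b \<in> carrier M"
    and g: "\<And>a b. a \<in> carrier A \<Longrightarrow> b \<in> carrier B \<Longrightarrow> g a b \<in> carrier M"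
  shows "tensor_sum M x (\<lambda>a b. f a b \<oplus>\<^bsub>M\<^esub> g a b) = tensor_sum M x f \<oplus>\<^bsub>M\<^esub> tensor_sum M x g"
proof -
  interpret M: abelian_group M by fact
  let ?s = "\<lambda>f xs. foldr (\<lambda>(a, b) s. f a b \<oplus>\<^bsub>M\<^esub> s) xs \<zero>\<^bsub>M\<^esub>"
  have "?s f xs \<in> carrier M \<and> ?s g xs \<in> carrier M \<and>
    ?s (\<lambda>a b. f a b \<oplus>\<^bsub>M\<^esub> g a b) xs = ?s f xs \<oplus>\<^bsub>M\<^esub> ?s g xs" if "set xs \<subseteq> pairs" for xs
    using that by (induction xs) (auto simp: f g M.a_ac)
  then show ?thesis using tensor_rep_pairs[OF assms(2)] by (simp add: tensor_sum_def)
qed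

lemma bilinear_closed:
  "f \<in> bilinear_maps K A B M \<Longrightarrow> a \<in> carrier A \<Longrightarrow> b \<in> carrier B \<Longrightarrow> f a b \<in> carrier M"
  by (auto dest: bilinear_mapsD linear_mapsD)

context
  fixes M :: "('k, 'd, 'p) module_scheme" (structure) and f
  assumes M: "module K M" and f: "f \<in> bilinear_maps K A B M"
begin

lemma tensor_sum_list:
  assumes "set xs \<subseteq> pairs"
  shows "tensor_sum M (cls xs) f = foldr (\<lambda>(a, b) s. f a b \<oplus>\<^bsub>M\<^esub> s) xs \<zero>\<^bsub>M\<^esub>"
  using f
  by (intro tensor_sum_tensor_class[OF A.module_axioms B.module_axioms module.axioms(2)[OF M] assms])
    (auto simp: bilinear_maps_def linear_maps_def)

lemma tensor_sum_zero: "tensor_sum M \<zero>\<^bsub>T\<^esub> f = \<zero>\<^bsub>M\<^esub>"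
  using tensor_sum_list[of "[]"] by (simp add: tensor_zero)

lemma tensor_sum_pure:
  assumes "a \<in> carrier A" "b \<in> carrier B"
  shows "tensor_sum M (pure a b) f = f a b"
proof -
  interpret M: module K M by (rule M)
  show ?thesis
    using tensor_sum_list[of "[(a, b)]"] assms bilinear_closed[OF f]
    by (simp add: pure_tensor_def)
qed

lemma tensor_sum_add:
  assumes x: "x \<in> carrier T" and y: "y \<in> carrier T"
  shows "tensor_sum M (x \<oplus>\<^bsub>T\<^esub> y) f = tensor_sum M x f \<oplus>\<^bsub>M\<^esub> tensor_sum M y f"
proof -
  interpret M: module K M by (rule M)
  obtain xs where xs: "set xs \<subseteq> pairs" "x = cls xs" using x by (rule tensor_cases)
  obtain ys where ys: "set ys \<subseteq> pairs" "y = cls ys" using y by (rule tensor_cases)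
  let ?s = "\<lambda>xs. foldr (\<lambda>(a, b) s. f a b \<oplus>\<^bsub>M\<^esub> s) xs \<zero>\<^bsub>M\<^esub>"
  have cl: "?s xs \<in> carrier M" if "set xs \<subseteq> pairs" for xs
    using that by (induction xs) (auto intro: bilinear_closed[OF f])
  have "?s (xs @ ys) = ?s xs \<oplus>\<^bsub>M\<^esub> ?s ys"
    using xs(1)
  proof (induction xs)
    case Nil
    then show ?case using cl ys by simp
  next
    case (Cons q xs)
    then show ?case
      using cl[of xs] cl[of ys] ys bilinear_closed[OF f] by (cases q) (auto simp: M.a_assoc)
  qed
  then show ?thesis
    using xs ys tensor_sum_list[of "xs @ ys"] by (simp add: tensor_class_append tensor_sum_list)
qed

end

text \<open>Translates between the operations of \<open>tensor_algebra\<close>, which are given on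
  lists of pairs, and sums in T, where linearity arguments apply.\<close>

lemma foldr_tensor_class:
  assumes "set xs \<subseteq> C" and "\<And>q. q \<in> C \<Longrightarrow> set (g q) \<subseteq> pairs"
  shows "foldr (\<lambda>q s. cls (g q) \<oplus>\<^bsub>T\<^esub> s) xs \<zero>\<^bsub>T\<^esub> = cls (concat (map g xs))"
  using assms(1)
proof (induction xs)
  case Nil
  then show ?case by (simp add: tensor_zero)
next
  case (Cons q xs)
  have "set (concat (map g xs)) \<subseteq> pairs" using Cons.prems assms(2) by fastforce
  then show ?case using Cons assms(2)[of q] by (simp add: tensor_class_append)
qed

lemma tensor_sum_pure_tensor: "x \<in> carrier T \<Longrightarrow> tensor_sum T x (pure) = x"
  using foldr_tensor_class[of "tensor_rep x" pairs "\<lambda>q. [q]"] tensor_rep_pairs[of x]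
    tensor_class_tensor_rep[of x]
  by (simp add: tensor_sum_def pure_tensor_def split_def cong: foldr_cong)

lemma tensor_smult:
  assumes "k \<in> carrier K" "x \<in> carrier T"
  shows "k \<odot>\<^bsub>T\<^esub> x = tensor_sum T x (\<lambda>a b. pure (k \<odot>\<^bsub>A\<^esub> a) b)"
  using foldr_tensor_class[of "tensor_rep x" pairs "\<lambda>(a, b). [(k \<odot>\<^bsub>A\<^esub> a, b)]"]
    tensor_rep_pairs[OF assms(2)] assms(1)
  by (auto simp: tensor_sum_def pure_tensor_def split_def tensor_algebra_def cong: foldr_cong)

end

section \<open>The scalar action and the universal property for bilinear maps\<close>

context module_pair
begin

lemma tensor_smult_class:
  assumes k: "k \<in> carrier K" and xs: "set xs \<subseteq> pairs"
  shows "k \<odot>\<^bsub>T\<^esub> cls xs = cls (map (\<lambda>(a, b). (k \<odot>\<^bsub>A\<^esub> a, b)) xs)"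
proof -
  have "k \<odot>\<^bsub>T\<^esub> cls xs = tensor_sum T (cls xs) (\<lambda>a b. pure (k \<odot>\<^bsub>A\<^esub> a) b)"
    using k xs by (simp add: tensor_smult tensor_class_closed)
  \<comment> \<open>The map sending (a, b) to k a \<otimes> b is bilinear and balanced, as scalars
    move across the tensor sign and K is commutative; so the chosen representative may be replaced
    by \<open>xs\<close>.\<close>
  also have "\<dots> = foldr (\<lambda>(a, b) s. pure (k \<odot>\<^bsub>A\<^esub> a) b \<oplus>\<^bsub>T\<^esub> s) xs \<zero>\<^bsub>T\<^esub>"
    using k xs
    by (intro tensor_sum_tensor_class[OF A.module_axioms B.module_axioms T.abelian_group_axioms])
      (auto simp: A.smult_r_distr pure_tensor_add_left pure_tensor_add_right
        pure_tensor_balanced[symmetric] A.smult_assoc1[symmetric] A.R.m_comm)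
  also have "\<dots> = cls (map (\<lambda>(a, b). (k \<odot>\<^bsub>A\<^esub> a, b)) xs)"
    using k xs
  proof (induction xs)
    case Nil
    then show ?case by (simp add: tensor_zero)
  next
    case (Cons q xs)
    have "set (map (\<lambda>(a, b). (k \<odot>\<^bsub>A\<^esub> a, b)) xs) \<subseteq> pairs"
      using Cons.prems by (auto dest!: subsetD)
    with Cons show ?case by (cases q) (simp add: tensor_class_Cons)
  qed
  finally show ?thesis .
qed

lemma tensor_smult_closed: "k \<in> carrier K \<Longrightarrow> x \<in> carrier T \<Longrightarrow> k \<odot>\<^bsub>T\<^esub> x \<in> carrier T"
  by (auto simp: tensor_smult intro!: tensor_sum_closed tensor_abelian_group)

lemma tensor_smult_pure [simp]:
  "k \<in> carrier K \<Longrightarrow> a \<in> carrier A \<Longrightarrow> b \<in> carrier B \<Longrightarrow>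
    k \<odot>\<^bsub>T\<^esub> pure a b = pure (k \<odot>\<^bsub>A\<^esub> a) b"
  by (simp add: pure_tensor_def tensor_smult_class)

lemma tensor_smult_add:
  assumes k: "k \<in> carrier K" and x: "x \<in> carrier T" and y: "y \<in> carrier T"
  shows "k \<odot>\<^bsub>T\<^esub> (x \<oplus>\<^bsub>T\<^esub> y) = k \<odot>\<^bsub>T\<^esub> x \<oplus>\<^bsub>T\<^esub> k \<odot>\<^bsub>T\<^esub> y"
proof -
  obtain xs where xs: "set xs \<subseteq> pairs" "x = cls xs" using x by (rule tensor_cases)
  obtain ys where ys: "set ys \<subseteq> pairs" "y = cls ys" using y by (rule tensor_cases)
  have "set (map (\<lambda>(a, b). (k \<odot>\<^bsub>A\<^esub> a, b)) xs) \<subseteq> pairs"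
    "set (map (\<lambda>(a, b). (k \<odot>\<^bsub>A\<^esub> a, b)) ys) \<subseteq> pairs"
    using xs ys k by auto
  then show ?thesis
    using tensor_smult_class[OF k, of "xs @ ys"] xs ys k
    by (simp add: tensor_class_append tensor_smult_class)
qed

lemma tensor_smult_zero: "k \<in> carrier K \<Longrightarrow> k \<odot>\<^bsub>T\<^esub> \<zero>\<^bsub>T\<^esub> = \<zero>\<^bsub>T\<^esub>"
  using tensor_smult_class[of k "[]"] by (simp add: tensor_zero)

lemma tensor_module: "module K T"
proof (rule moduleI)
  show "cring K" by (rule A.R.is_cring)
  show "abelian_group T" by (rule tensor_abelian_group)
  show "(k \<oplus>\<^bsub>K\<^esub> l) \<odot>\<^bsub>T\<^esub> x = k \<odot>\<^bsub>T\<^esub> x \<oplus>\<^bsub>T\<^esub> l \<odot>\<^bsub>T\<^esub> x"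
    if "k \<in> carrier K" "l \<in> carrier K" "x \<in> carrier T" for k l x
    using that(3,1,2)
  proof (induction rule: tensor_induct)
    case (add x y)
    then show ?case by (simp add: tensor_smult_add tensor_smult_closed T.a_ac)
  qed (simp_all add: tensor_smult_zero A.smult_l_distr pure_tensor_add_left)
  show "(k \<otimes>\<^bsub>K\<^esub> l) \<odot>\<^bsub>T\<^esub> x = k \<odot>\<^bsub>T\<^esub> (l \<odot>\<^bsub>T\<^esub> x)"
    if "k \<in> carrier K" "l \<in> carrier K" "x \<in> carrier T" for k l x
    using that(3,1,2)
  proof (induction rule: tensor_induct)
    case (add x y)
    then show ?case by (simp add: tensor_smult_add tensor_smult_closed)
  qed (simp_all add: tensor_smult_zero A.smult_assoc1)
  show "\<one>\<^bsub>K\<^esub> \<odot>\<^bsub>T\<^esub> x = x" if "x \<in> carrier T" for x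
    using that
  proof (induction rule: tensor_induct)
    case (add x y)
    then show ?case by (simp add: tensor_smult_add tensor_smult_closed)
  qed (simp_all add: tensor_smult_zero)
qed (simp_all add: tensor_smult_closed tensor_smult_add)

sublocale T: module K T by (rule tensor_module)

lemma pure_tensor_bilinear: "pure \<in> bilinear_maps K A B T"
  by (intro bilinear_mapsI linear_mapsI)
    (simp_all add: pure_tensor_add_left pure_tensor_add_right pure_tensor_balanced)

lemma tensor_sum_smult:
  assumes M: "module K M" and f: "f \<in> bilinear_maps K A B M"
    and k: "k \<in> carrier K" and x: "x \<in> carrier T"
  shows "tensor_sum M (k \<odot>\<^bsub>T\<^esub> x) f = k \<odot>\<^bsub>M\<^esub> tensor_sum M x f"
proof -
  interpret M: module K M by (rule M)
  note cl = tensor_sum_closed[OF M.abelian_group_axioms _ bilinear_closed[OF f]]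
  show ?thesis using x
  proof (induction rule: tensor_induct)
    case zero
    then show ?case using k by (simp add: tensor_smult_zero tensor_sum_zero[OF M f])
  next
    case (pure_tensor a b)
    have "f (k \<odot>\<^bsub>A\<^esub> a) b = k \<odot>\<^bsub>M\<^esub> f a b"
      using linear_mapsD(3)[OF bilinear_mapsD(2)[OF f]] pure_tensor k by simp
    with pure_tensor k show ?case by (simp add: tensor_sum_pure[OF M f])
  next
    case (add x y)
    then show ?case using k
      by (simp add: tensor_smult_add tensor_sum_add[OF M f] M.smult_r_distr cl)
  qed
qed

lemma tensor_sum_linear:
  assumes M: "module K M" and f: "f \<in> bilinear_maps K A B M"
  shows "(\<lambda>x. tensor_sum M x f) \<in> linear_maps K T M"
  using tensor_sum_closed[OF module.axioms(2)[OF M] _ bilinear_closed[OF f]]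
    tensor_sum_add[OF M f] tensor_sum_smult[OF M f]
  by (intro linear_mapsI) auto

text \<open>Only additivity of \<open>\<phi>\<close> matters here: \<open>f\<close> need not be bilinear, since \<^const>\<open>tensor_sum\<close>
  evaluates a fixed representative.\<close>

lemma linear_tensor_sum:
  assumes "module K M" "module K N" "x \<in> carrier T"
    and "\<And>a b. a \<in> carrier A \<Longrightarrow> b \<in> carrier B \<Longrightarrow> f a b \<in> carrier M"
    and \<phi>: "\<phi> \<in> linear_maps K M N"
  shows "\<phi> (tensor_sum M x f) = tensor_sum N x (\<lambda>a b. \<phi> (f a b))"
  using assms by (intro additive_tensor_sum) (auto dest: linear_mapsD intro: module.axioms)

text \<open>Pure tensors generate T additively, so a linear map is determined by its values on
  them.\<close>

lemma linear_eqI: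
  assumes M: "module K M" and f: "f \<in> linear_maps K T M" and g: "g \<in> linear_maps K T M"
    and "\<And>a b. a \<in> carrier A \<Longrightarrow> b \<in> carrier B \<Longrightarrow>
      f (pure a b) = g (pure a b)"
    and x: "x \<in> carrier T"
  shows "f x = g x"
proof -
  interpret M: module K M by (rule M)
  have z: "h \<zero>\<^bsub>T\<^esub> = \<zero>\<^bsub>M\<^esub>" if h: "h \<in> linear_maps K T M" for h
    using linear_mapsD(2)[OF h, of "\<zero>\<^bsub>T\<^esub>" "\<zero>\<^bsub>T\<^esub>"] linear_mapsD(1)[OF h, of "\<zero>\<^bsub>T\<^esub>"] by simp
  show ?thesis
    using x by (induction rule: tensor_induct)
      (simp_all add: z[OF f] z[OF g] assms(4) linear_mapsD(2)[OF f] linear_mapsD(2)[OF g])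
qed

end

section \<open>The tensor product of two algebras\<close>

locale kalgebra_pair = A: kalgebra K A + B: kalgebra K B
  for K :: "('k, 'c) ring_scheme"
    and A :: "('k, 'a, 'm) module_scheme" and B :: "('k, 'b, 'n) module_scheme"
begin

sublocale module_pair K A B ..

lemma tensor_mult:
  assumes x: "x \<in> carrier T" and y: "y \<in> carrier T"
  shows "x \<otimes>\<^bsub>T\<^esub> y = tensor_sum T x (\<lambda>a b. tensor_sum T y (\<lambda>a' b'.
    pure (a \<otimes>\<^bsub>A\<^esub> a') (b \<otimes>\<^bsub>B\<^esub> b')))"
proof -
  let ?g = "\<lambda>a b. map (\<lambda>(a', b'). (a \<otimes>\<^bsub>A\<^esub> a', b \<otimes>\<^bsub>B\<^esub> b')) (tensor_rep y)"
  have g: "set (?g a b) \<subseteq> pairs" if "a \<in> carrier A" "b \<in> carrier B" for a b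
    using tensor_rep_pairs[OF y] that by auto
  have 1: "tensor_sum T y (\<lambda>a' b'. pure (a \<otimes>\<^bsub>A\<^esub> a') (b \<otimes>\<^bsub>B\<^esub> b')) = cls (?g a b)"
    if "a \<in> carrier A" "b \<in> carrier B" for a b
    using foldr_tensor_class[of "tensor_rep y" pairs "\<lambda>(a', b'). [(a \<otimes>\<^bsub>A\<^esub> a', b \<otimes>\<^bsub>B\<^esub> b')]"]
      tensor_rep_pairs[OF y] that
    by (auto simp: tensor_sum_def pure_tensor_def split_def cong: foldr_cong)
  have "tensor_sum T x (\<lambda>a b. tensor_sum T y (\<lambda>a' b'.
      pure (a \<otimes>\<^bsub>A\<^esub> a') (b \<otimes>\<^bsub>B\<^esub> b'))) = tensor_sum T x (\<lambda>a b. cls (?g a b))"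
    by (rule tensor_sum_cong[OF x 1])
  also have "\<dots> = cls (concat (map (\<lambda>(a, b). ?g a b) (tensor_rep x)))"
    using foldr_tensor_class[of "tensor_rep x" pairs "\<lambda>(a, b). ?g a b"] g tensor_rep_pairs[OF x]
    by (auto simp: tensor_sum_def split_def cong: foldr_cong)
  also have "\<dots> = x \<otimes>\<^bsub>T\<^esub> y"
    by (simp add: tensor_algebra_def split_def)
  finally show ?thesis by simp
qed

lemma tensor_mult_bilinear_aux:
  assumes "a \<in> carrier A" "b \<in> carrier B"
  shows "(\<lambda>a' b'. pure (a \<otimes>\<^bsub>A\<^esub> a') (b \<otimes>\<^bsub>B\<^esub> b')) \<in> bilinear_maps K A B T"
    and "(\<lambda>a' b'. pure (a' \<otimes>\<^bsub>A\<^esub> a) (b' \<otimes>\<^bsub>B\<^esub> b)) \<in> bilinear_maps K A B T"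
  using assms
  by (intro bilinear_mapsI linear_mapsI; simp add: A.r_distr B.r_distr A.l_distr B.l_distr
      pure_tensor_add_left pure_tensor_add_right pure_tensor_balanced
      A.smult_mult_right B.smult_mult_right A.smult_mult_left B.smult_mult_left)+

lemma tensor_mult_pure [simp]:
  assumes "a \<in> carrier A" "b \<in> carrier B" "a' \<in> carrier A" "b' \<in> carrier B"
  shows "pure a b \<otimes>\<^bsub>T\<^esub> pure a' b'
    = pure (a \<otimes>\<^bsub>A\<^esub> a') (b \<otimes>\<^bsub>B\<^esub> b')"
proof -
  have "pure a b \<otimes>\<^bsub>T\<^esub> pure a' b' =
     tensor_sum T (pure a b) (\<lambda>x y. tensor_sum T (pure a' b')
       (\<lambda>x' y'. pure (x \<otimes>\<^bsub>A\<^esub> x') (y \<otimes>\<^bsub>B\<^esub> y')))"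
    using assms by (simp add: tensor_mult)
  also have "\<dots> = tensor_sum T (pure a b)
      (\<lambda>x y. pure (x \<otimes>\<^bsub>A\<^esub> a') (y \<otimes>\<^bsub>B\<^esub> b'))"
    using assms
    by (intro tensor_sum_cong tensor_sum_pure tensor_module tensor_mult_bilinear_aux) auto
  also have "\<dots> = pure (a \<otimes>\<^bsub>A\<^esub> a') (b \<otimes>\<^bsub>B\<^esub> b')"
    using assms by (intro tensor_sum_pure tensor_module tensor_mult_bilinear_aux) auto
  finally show ?thesis .
qed

lemma tensor_mult_closed: "x \<in> carrier T \<Longrightarrow> y \<in> carrier T \<Longrightarrow> x \<otimes>\<^bsub>T\<^esub> y \<in> carrier T"
  by (auto simp: tensor_mult intro!: tensor_sum_closed tensor_abelian_group)

lemma tensor_mult_linear_right: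
  assumes x: "x \<in> carrier T"
  shows "(\<lambda>y. x \<otimes>\<^bsub>T\<^esub> y) \<in> linear_maps K T T"
proof -
  have cl: "tensor_sum T y (\<lambda>a' b'. pure (a \<otimes>\<^bsub>A\<^esub> a') (b \<otimes>\<^bsub>B\<^esub> b')) \<in> carrier T"
    if "a \<in> carrier A" "b \<in> carrier B" "y \<in> carrier T" for a b y
    using that by (auto intro!: tensor_sum_closed tensor_abelian_group)
  show ?thesis
  proof (rule linear_mapsI)
    fix y z assume y: "y \<in> carrier T" and z: "z \<in> carrier T"
    have "x \<otimes>\<^bsub>T\<^esub> (y \<oplus>\<^bsub>T\<^esub> z) = tensor_sum T x (\<lambda>a b.
      tensor_sum T y (\<lambda>a' b'. pure (a \<otimes>\<^bsub>A\<^esub> a') (b \<otimes>\<^bsub>B\<^esub> b')) \<oplus>\<^bsub>T\<^esub>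
      tensor_sum T z (\<lambda>a' b'. pure (a \<otimes>\<^bsub>A\<^esub> a') (b \<otimes>\<^bsub>B\<^esub> b')))"
      using x y z by (subst tensor_mult; (intro tensor_sum_cong tensor_sum_add tensor_module
        tensor_mult_bilinear_aux)?) simp_all
    also have "\<dots> = x \<otimes>\<^bsub>T\<^esub> y \<oplus>\<^bsub>T\<^esub> x \<otimes>\<^bsub>T\<^esub> z"
      using x y z by (simp add: tensor_mult tensor_sum_add_fun cl tensor_abelian_group)
    finally show "x \<otimes>\<^bsub>T\<^esub> (y \<oplus>\<^bsub>T\<^esub> z) = x \<otimes>\<^bsub>T\<^esub> y \<oplus>\<^bsub>T\<^esub> x \<otimes>\<^bsub>T\<^esub> z" .
  next
    fix k y assume k: "k \<in> carrier K" and y: "y \<in> carrier T"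
    have "x \<otimes>\<^bsub>T\<^esub> (k \<odot>\<^bsub>T\<^esub> y) = tensor_sum T x (\<lambda>a b.
      k \<odot>\<^bsub>T\<^esub> tensor_sum T y (\<lambda>a' b'. pure (a \<otimes>\<^bsub>A\<^esub> a') (b \<otimes>\<^bsub>B\<^esub> b')))"
      using x k y by (subst tensor_mult; (intro tensor_sum_cong tensor_sum_smult tensor_module
        tensor_mult_bilinear_aux)?) simp_all
    also have "\<dots> = k \<odot>\<^bsub>T\<^esub> (x \<otimes>\<^bsub>T\<^esub> y)"
      unfolding tensor_mult[OF x y]
      by (rule linear_tensor_sum[symmetric, OF tensor_module tensor_module x cl[OF _ _ y]],
          assumption, assumption, rule linear_mapsI)
        (simp_all add: k T.smult_r_distr T.smult_assoc1[symmetric] A.K.m_comm)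
    finally show "x \<otimes>\<^bsub>T\<^esub> (k \<odot>\<^bsub>T\<^esub> y) = k \<odot>\<^bsub>T\<^esub> (x \<otimes>\<^bsub>T\<^esub> y)" .
  qed (use x tensor_mult_closed in auto)
qed

text \<open>Induction on \<open>y\<close>. For a pure \<open>y\<close> the product is the sum over
  \<open>x\<close> of a bilinear map, hence linear in \<open>x\<close>; sums in \<open>y\<close> are
  split by linearity in the right factor, which is already available.\<close>

lemma tensor_mult_linear_left:
  assumes y: "y \<in> carrier T"
  shows "(\<lambda>x. x \<otimes>\<^bsub>T\<^esub> y) \<in> linear_maps K T T"
proof -
  let ?g = "\<lambda>a b. tensor_sum T y (\<lambda>a' b'. pure (a \<otimes>\<^bsub>A\<^esub> a') (b \<otimes>\<^bsub>B\<^esub> b'))"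
  have lin: "(\<lambda>x. x \<otimes>\<^bsub>T\<^esub> pure a b) \<in> linear_maps K T T"
    if "a \<in> carrier A" "b \<in> carrier B" for a b
  proof -
    have "x \<otimes>\<^bsub>T\<^esub> pure a b =
        tensor_sum T x (\<lambda>a' b'. pure (a' \<otimes>\<^bsub>A\<^esub> a) (b' \<otimes>\<^bsub>B\<^esub> b))"
      if "x \<in> carrier T" for x
      using that \<open>a \<in> _\<close> \<open>b \<in> _\<close>
      by (simp add: tensor_mult tensor_sum_pure[OF tensor_module tensor_mult_bilinear_aux(1)]
          cong: tensor_sum_cong)
    then show ?thesis
      using tensor_sum_linear[OF tensor_module tensor_mult_bilinear_aux(2)[OF that]]
      unfolding linear_maps_def by (auto simp: tensor_smult_closed)
  qed
  have rz: "x \<otimes>\<^bsub>T\<^esub> \<zero>\<^bsub>T\<^esub> = \<zero>\<^bsub>T\<^esub>" if "x \<in> carrier T" for x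
    using linear_mapsD(2)[OF tensor_mult_linear_right[OF that], of "\<zero>\<^bsub>T\<^esub>" "\<zero>\<^bsub>T\<^esub>"]
      tensor_mult_closed[OF that, of "\<zero>\<^bsub>T\<^esub>"] by simp
  note rd = linear_mapsD(2)[OF tensor_mult_linear_right]
  show ?thesis using y
  proof (induction rule: tensor_induct)
    case zero
    then show ?case by (auto intro!: linear_mapsI simp: rz tensor_smult_closed)
  next
    case (pure_tensor a b)
    then show ?case by (rule lin)
  next
    case (add y z)
    then show ?case
      by (intro linear_mapsI) (simp_all add: rd tensor_mult_closed linear_mapsD(2)[OF add(3)]
        linear_mapsD(2)[OF add(4)] linear_mapsD(3)[OF add(3)] linear_mapsD(3)[OF add(4)]
        T.a_ac T.smult_r_distr tensor_smult_closed)
  qed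
qed

text \<open>Both sides are linear in each factor, so the equation is reduced to pure tensors one
  factor at a time: in fact \<open>1\<close> only \<open>x\<close> is arbitrary, in fact
  \<open>2\<close> also \<open>y\<close>.\<close>

lemma tensor_mult_assoc:
  assumes x: "x \<in> carrier T" and y: "y \<in> carrier T" and z: "z \<in> carrier T"
  shows "x \<otimes>\<^bsub>T\<^esub> y \<otimes>\<^bsub>T\<^esub> z = x \<otimes>\<^bsub>T\<^esub> (y \<otimes>\<^bsub>T\<^esub> z)"
proof -
  note lin = linear_mapsD[OF tensor_mult_linear_left] linear_mapsD[OF tensor_mult_linear_right]
  have 1: "x \<otimes>\<^bsub>T\<^esub> pure c d \<otimes>\<^bsub>T\<^esub> pure e f =
     x \<otimes>\<^bsub>T\<^esub> (pure c d \<otimes>\<^bsub>T\<^esub> pure e f)"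
    if "x \<in> carrier T" "c \<in> carrier A" "d \<in> carrier B" "e \<in> carrier A" "f \<in> carrier B" for x c d e f
  proof (rule linear_eqI[OF tensor_module _ _ _ that(1)])
    show "(\<lambda>x. x \<otimes>\<^bsub>T\<^esub> pure c d \<otimes>\<^bsub>T\<^esub> pure e f) \<in> linear_maps K T T"
      "(\<lambda>x. x \<otimes>\<^bsub>T\<^esub> (pure c d \<otimes>\<^bsub>T\<^esub> pure e f)) \<in> linear_maps K T T"
      using that(2-) by (auto intro!: linear_mapsI simp: lin simp del: tensor_mult_pure)
  qed (use that(2-) in \<open>simp add: A.m_assoc B.m_assoc\<close>)
  have 2: "x \<otimes>\<^bsub>T\<^esub> y \<otimes>\<^bsub>T\<^esub> pure e f = x \<otimes>\<^bsub>T\<^esub> (y \<otimes>\<^bsub>T\<^esub> pure e f)"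
    if "e \<in> carrier A" "f \<in> carrier B" for e f
    by (rule linear_eqI[OF tensor_module linear_mapsI linear_mapsI _ y])
      (use that x 1 in \<open>simp_all add: lin del: tensor_mult_pure\<close>)
  show ?thesis
    by (rule linear_eqI[OF tensor_module linear_mapsI linear_mapsI _ z])
      (use x y 2 in \<open>simp_all add: lin\<close>)
qed

lemma tensor_one: "\<one>\<^bsub>T\<^esub> = pure \<one>\<^bsub>A\<^esub> \<one>\<^bsub>B\<^esub>"
  by (simp add: tensor_algebra_def)

lemma tensor_kalgebra: "kalgebra K T"
proof -
  note lin = linear_mapsD[OF tensor_mult_linear_left] linear_mapsD[OF tensor_mult_linear_right]
  have one: "\<one>\<^bsub>T\<^esub> \<in> carrier T" by (simp add: tensor_one)
  have "\<one>\<^bsub>T\<^esub> \<otimes>\<^bsub>T\<^esub> x = x" "x \<otimes>\<^bsub>T\<^esub> \<one>\<^bsub>T\<^esub> = x" if "x \<in> carrier T" for x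
    subgoal by (rule linear_eqI[OF tensor_module linear_mapsI linear_mapsI _ that])
      (simp_all add: lin one, simp add: tensor_one)
    subgoal by (rule linear_eqI[OF tensor_module linear_mapsI linear_mapsI _ that])
      (simp_all add: lin one, simp add: tensor_one)
    done
  then have "ring T"
    using one by (intro ringI tensor_abelian_group monoidI) (simp_all add: tensor_mult_assoc lin)
  then show ?thesis
    by (intro kalgebra.intro kalgebra_axioms.intro A.K.field_axioms tensor_module)
      (simp_all add: lin)
qed

sublocale T: kalgebra K T by (rule tensor_kalgebra)

end

section \<open>Sums over tensors\<close>

lemma linear_maps_id: "(\<lambda>x. x) \<in> linear_maps K A A"
  by (simp add: linear_maps_def)

lemma linear_maps_compose:
  "g \<in> linear_maps K B M \<Longrightarrow> f \<in> linear_maps K A B \<Longrightarrow> (\<lambda>x. g (f x)) \<in> linear_maps K A M"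
  by (rule linear_mapsI) (simp_all add: linear_mapsD[of g K B M] linear_mapsD[of f K A B])

context kalgebra
begin

lemma linear_mult_left:
  "c \<in> carrier A \<Longrightarrow> f \<in> linear_maps K B A \<Longrightarrow> (\<lambda>x. c \<otimes>\<^bsub>A\<^esub> f x) \<in> linear_maps K B A"
  by (rule linear_mapsI) (simp_all add: linear_mapsD[of f K B A] A.r_distr smult_mult_right)

lemma linear_mult_right:
  "c \<in> carrier A \<Longrightarrow> f \<in> linear_maps K B A \<Longrightarrow> (\<lambda>x. f x \<otimes>\<^bsub>A\<^esub> c) \<in> linear_maps K B A"
  by (rule linear_mapsI) (simp_all add: linear_mapsD[of f K B A] A.l_distr smult_mult_left)

lemma linear_smult:
  "k \<in> carrier K \<Longrightarrow> f \<in> linear_maps K B A \<Longrightarrow> (\<lambda>x. k \<odot>\<^bsub>A\<^esub> f x) \<in> linear_maps K B A"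
  by (rule linear_mapsI)
    (simp_all add: linear_mapsD[of f K B A] A.smult_r_distr A.smult_assoc1[symmetric] K.m_comm)

end

context kalgebra_pair
begin

lemma linear_pure_left:
  "b \<in> carrier B \<Longrightarrow> f \<in> linear_maps K M A \<Longrightarrow> (\<lambda>x. pure (f x) b) \<in> linear_maps K M T"
  by (rule linear_maps_compose[OF bilinear_mapsD(2)[OF pure_tensor_bilinear]])

lemma linear_pure_right:
  "a \<in> carrier A \<Longrightarrow> f \<in> linear_maps K M B \<Longrightarrow> (\<lambda>x. pure a (f x)) \<in> linear_maps K M T"
  by (rule linear_maps_compose[OF bilinear_mapsD(1)[OF pure_tensor_bilinear]])

end

context module_pair
begin

context
  fixes M :: "('k, 'd, 'p) module_scheme" (structure)
  assumes M: "module K M"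
begin

interpretation M: module K M by (rule M)

lemma tensor_sum_in:
  "x \<in> carrier T \<Longrightarrow> (\<And>a b. a \<in> carrier A \<Longrightarrow> b \<in> carrier B \<Longrightarrow> f a b \<in> carrier M)
    \<Longrightarrow> tensor_sum M x f \<in> carrier M"
  by (rule tensor_sum_closed[OF M.abelian_group_axioms])

lemma linear_tensor_sum_fun:
  assumes x: "x \<in> carrier T"
    and F: "\<And>a b. a \<in> carrier A \<Longrightarrow> b \<in> carrier B \<Longrightarrow> (\<lambda>z. F z a b) \<in> linear_maps K N M"
  shows "(\<lambda>z. tensor_sum M x (F z)) \<in> linear_maps K N M"
proof (rule linear_mapsI)
  fix y z assume yz: "y \<in> carrier N" "z \<in> carrier N"
  have "tensor_sum M x (F (y \<oplus>\<^bsub>N\<^esub> z)) = tensor_sum M x (\<lambda>a b. F y a b \<oplus>\<^bsub>M\<^esub> F z a b)"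
    using yz linear_mapsD(2)[OF F] by (intro tensor_sum_cong[OF x]) simp
  then show "tensor_sum M x (F (y \<oplus>\<^bsub>N\<^esub> z)) = tensor_sum M x (F y) \<oplus>\<^bsub>M\<^esub> tensor_sum M x (F z)"
    using yz linear_mapsD(1)[OF F] by (simp add: tensor_sum_add_fun[OF M.abelian_group_axioms x])
next
  fix k z assume kz: "k \<in> carrier K" "z \<in> carrier N"
  have "tensor_sum M x (F (k \<odot>\<^bsub>N\<^esub> z)) = tensor_sum M x (\<lambda>a b. k \<odot>\<^bsub>M\<^esub> F z a b)"
    using kz linear_mapsD(3)[OF F] by (intro tensor_sum_cong[OF x]) simp
  then show "tensor_sum M x (F (k \<odot>\<^bsub>N\<^esub> z)) = k \<odot>\<^bsub>M\<^esub> tensor_sum M x (F z)"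
    using kz linear_mapsD(1)[OF F]
    by (subst linear_tensor_sum[OF M M x, where \<phi> = "\<lambda>y. k \<odot>\<^bsub>M\<^esub> y"])
      (auto intro!: linear_mapsI simp: M.smult_r_distr M.smult_assoc1[symmetric] A.R.m_comm)
qed (use x F in \<open>auto intro!: tensor_sum_in dest: linear_mapsD\<close>)

text \<open>Both sums run over fixed lists, so they can be interchanged for any \<open>F\<close>
  with values in an abelian group.\<close>

lemma tensor_sum_swap:
  assumes x: "x \<in> carrier T" and CD: "module_pair K C D" and y: "y \<in> carrier (tensor_algebra K C D)"
    and F: "\<And>a b c d. a \<in> carrier A \<Longrightarrow> b \<in> carrier B \<Longrightarrow> c \<in> carrier C \<Longrightarrow> d \<in> carrier D
      \<Longrightarrow> F a b c d \<in> carrier M"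
  shows "tensor_sum M x (\<lambda>a b. tensor_sum M y (\<lambda>c d. F a b c d)) =
    tensor_sum M y (\<lambda>c d. tensor_sum M x (\<lambda>a b. F a b c d))"
proof -
  interpret CD: module_pair K C D by fact
  have "foldr (\<lambda>(a, b) s. tensor_sum M y (F a b) \<oplus>\<^bsub>M\<^esub> s) xs \<zero>\<^bsub>M\<^esub> =
      tensor_sum M y (\<lambda>c d. foldr (\<lambda>(a, b) s. F a b c d \<oplus>\<^bsub>M\<^esub> s) xs \<zero>\<^bsub>M\<^esub>) \<and>
      (\<forall>c\<in>carrier C. \<forall>d\<in>carrier D. foldr (\<lambda>(a, b) s. F a b c d \<oplus>\<^bsub>M\<^esub> s) xs \<zero>\<^bsub>M\<^esub> \<in> carrier M)"
    if "set xs \<subseteq> pairs" for xs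
    using that
    by (induction xs)
      (auto simp: CD.tensor_sum_zero_fun[OF M.abelian_group_axioms] F
        CD.tensor_sum_add_fun[OF M.abelian_group_axioms y])
  from this[OF tensor_rep_pairs[OF x]] show ?thesis
    by (simp add: tensor_sum_def[of M x])
qed

text \<open>Summing the bilinear \<open>F\<close> is linear in the tensor and therefore passes
  through the sum over \<open>y\<close>. It serves to sum \<open>F\<close> over a tensor that is
  itself given by a sum.\<close>

lemma tensor_sum_bind:
  assumes F: "F \<in> bilinear_maps K A B M"
    and CD: "module_pair K C D" and y: "y \<in> carrier (tensor_algebra K C D)"
    and g: "\<And>c d. c \<in> carrier C \<Longrightarrow> d \<in> carrier D \<Longrightarrow> g c d \<in> carrier T"
  shows "tensor_sum M (tensor_sum T y g) F = tensor_sum M y (\<lambda>c d. tensor_sum M (g c d) F)"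
  by (rule module_pair.linear_tensor_sum[OF CD tensor_module M y g tensor_sum_linear[OF M F]])

end

end

context module_pair
begin

context
  fixes M :: "('k, 'd, 'p) module_scheme" (structure) and x f c
  assumes M: "kalgebra K M" and x: "x \<in> carrier T" and c: "c \<in> carrier M"
    and f: "\<And>a b. a \<in> carrier A \<Longrightarrow> b \<in> carrier B \<Longrightarrow> f a b \<in> carrier M"
begin

lemma mult_tensor_sum: "c \<otimes> tensor_sum M x f = tensor_sum M x (\<lambda>a b. c \<otimes> f a b)"
  using c f x
  by (intro linear_tensor_sum[OF kalgebra.axioms(2)[OF M] kalgebra.axioms(2)[OF M]]
      kalgebra.linear_mult_left[OF M] linear_maps_id)

lemma tensor_sum_mult_const: "tensor_sum M x f \<otimes> c = tensor_sum M x (\<lambda>a b. f a b \<otimes> c)"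
  using c f x
  by (intro linear_tensor_sum[OF kalgebra.axioms(2)[OF M] kalgebra.axioms(2)[OF M]]
      kalgebra.linear_mult_right[OF M] linear_maps_id)

end

end

lemma (in module_pair) mult_sums:
  assumes M: "kalgebra K M" and x: "x \<in> carrier T"
    and CD: "module_pair K C D" and y: "y \<in> carrier (tensor_algebra K C D)"
    and f: "\<And>a b. a \<in> carrier A \<Longrightarrow> b \<in> carrier B \<Longrightarrow> f a b \<in> carrier M"
    and g: "\<And>c d. c \<in> carrier C \<Longrightarrow> d \<in> carrier D \<Longrightarrow> g c d \<in> carrier M"
  shows "tensor_sum M x f \<otimes>\<^bsub>M\<^esub> tensor_sum M y g =
      tensor_sum M x (\<lambda>a b. tensor_sum M y (\<lambda>c d. f a b \<otimes>\<^bsub>M\<^esub> g c d))" (is "?l = ?r")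
    and "tensor_sum M x f \<otimes>\<^bsub>M\<^esub> tensor_sum M y g =
      tensor_sum M y (\<lambda>c d. tensor_sum M x (\<lambda>a b. f a b \<otimes>\<^bsub>M\<^esub> g c d))"
proof -
  interpret M: kalgebra K M by fact
  interpret CD: module_pair K C D by fact
  have s: "tensor_sum M x f \<in> carrier M" "tensor_sum M y g \<in> carrier M"
    using x y by (auto intro!: tensor_sum_in CD.tensor_sum_in M.module_axioms f g)
  show "?l = ?r"
    using f g x y s
    by (subst tensor_sum_mult_const[OF M x])
      (simp_all add: CD.mult_tensor_sum[OF M y] cong: tensor_sum_cong)
  show "?l = tensor_sum M y (\<lambda>c d. tensor_sum M x (\<lambda>a b. f a b \<otimes>\<^bsub>M\<^esub> g c d))"
    using f g x y s
    by (subst CD.mult_tensor_sum[OF M y])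
      (simp_all add: tensor_sum_mult_const[OF M x] cong: CD.tensor_sum_cong)
qed

lemma (in kalgebra_pair) tensor_sum_mult:
  assumes M: "module K M" and F: "F \<in> bilinear_maps K A B M"
    and x: "x \<in> carrier T" and y: "y \<in> carrier T"
  shows "tensor_sum M (x \<otimes>\<^bsub>T\<^esub> y) F =
    tensor_sum M x (\<lambda>a b. tensor_sum M y (\<lambda>a' b'. F (a \<otimes>\<^bsub>A\<^esub> a') (b \<otimes>\<^bsub>B\<^esub> b')))"
proof -
  have mp: "module_pair K A B" ..
  show ?thesis
    unfolding tensor_mult[OF x y]
    by (subst tensor_sum_bind[OF M F mp x]; (intro tensor_sum_in tensor_sum_cong)?)
      (use x y in \<open>simp_all add: tensor_sum_in tensor_sum_bind[OF M F mp y] tensor_sum_pure[OF M F]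
         tensor_module cong: tensor_sum_cong\<close>)
qed

lemma kalgebra_pairI: "kalgebra K A \<Longrightarrow> kalgebra K B \<Longrightarrow> kalgebra_pair K A B"
  by (rule kalgebra_pair.intro)

lemma kalgebra_module: "kalgebra K A \<Longrightarrow> module K A"
  by (rule kalgebra.axioms)

section \<open>Products of legs\<close>

lemma algebra_homsI:
  assumes "f \<in> linear_maps K A B"
    and "\<And>x y. x \<in> carrier A \<Longrightarrow> y \<in> carrier A \<Longrightarrow> f (x \<otimes>\<^bsub>A\<^esub> y) = f x \<otimes>\<^bsub>B\<^esub> f y"
    and "f \<one>\<^bsub>A\<^esub> = \<one>\<^bsub>B\<^esub>"
  shows "f \<in> algebra_homs K A B"
  using assms by (auto simp: algebra_homs_def linear_maps_def intro!: ring_hom_memI)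

lemma algebra_homsD:
  assumes "f \<in> algebra_homs K A B"
  shows "f \<in> linear_maps K A B"
    and "x \<in> carrier A \<Longrightarrow> f x \<in> carrier B"
    and "x \<in> carrier A \<Longrightarrow> y \<in> carrier A \<Longrightarrow> f (x \<otimes>\<^bsub>A\<^esub> y) = f x \<otimes>\<^bsub>B\<^esub> f y"
    and "f \<one>\<^bsub>A\<^esub> = \<one>\<^bsub>B\<^esub>"
  using assms by (auto simp: algebra_homs_def linear_maps_def ring_hom_mult ring_hom_one)

lemma algebra_homs_compose:
  "g \<in> algebra_homs K B M \<Longrightarrow> f \<in> algebra_homs K A B \<Longrightarrow> (\<lambda>x. g (f x)) \<in> algebra_homs K A M"
  by (rule algebra_homsI)
    (simp_all add: algebra_homsD[of g K B M] algebra_homsD[of f K A B]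
      linear_maps_compose[OF algebra_homsD(1) algebra_homsD(1)])

text \<open>Formulated for sets of elements, so that it covers the image of a leg as well as a
  singleton such as \<open>{legs M f g x}\<close>.\<close>

definition commuting :: "('d, 'p) ring_scheme \<Rightarrow> 'd set \<Rightarrow> 'd set \<Rightarrow> bool"
  where "commuting M X Y \<longleftrightarrow> (\<forall>x\<in>X. \<forall>y\<in>Y. x \<otimes>\<^bsub>M\<^esub> y = y \<otimes>\<^bsub>M\<^esub> x)"

lemma commuting_sym: "commuting M X Y \<Longrightarrow> commuting M Y X"
  by (simp add: commuting_def)

text \<open>For legs \<open>f\<close>, \<open>g\<close> given by the embeddings of two tensor factors this is the element \<open>x\<^sub>i\<^sub>j\<close> of a
  multiple tensor product.\<close>

definition legs ::
  "('d, 'p) ring_scheme \<Rightarrow> ('a \<Rightarrow> 'd) \<Rightarrow> ('b \<Rightarrow> 'd) \<Rightarrow> ('a, 'b) tensor \<Rightarrow> 'd"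
  where "legs M f g x = tensor_sum M x (\<lambda>a b. f a \<otimes>\<^bsub>M\<^esub> g b)"

context kalgebra_pair
begin

context
  fixes M :: "('k, 'd, 'p) module_scheme" (structure)
  assumes M: "kalgebra K M"
begin

interpretation M: kalgebra K M by (rule M)

lemma legs_bilinear:
  assumes "f \<in> linear_maps K A M" "g \<in> linear_maps K B M"
  shows "(\<lambda>a b. f a \<otimes> g b) \<in> bilinear_maps K A B M"
  using assms by (auto intro!: bilinear_mapsI M.linear_mult_left M.linear_mult_right dest: linear_mapsD)

lemma legs_linear:
  "f \<in> linear_maps K A M \<Longrightarrow> g \<in> linear_maps K B M \<Longrightarrow> legs M f g \<in> linear_maps K T M"
  using tensor_sum_linear[OF kalgebra_module[OF M] legs_bilinear, of f g]
    by (simp add: legs_def[abs_def])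

lemma legs_pure:
  "f \<in> linear_maps K A M \<Longrightarrow> g \<in> linear_maps K B M \<Longrightarrow> a \<in> carrier A \<Longrightarrow> b \<in> carrier B
    \<Longrightarrow> legs M f g (pure a b) = f a \<otimes> g b"
  using tensor_sum_pure[OF kalgebra_module[OF M] legs_bilinear, of f g] by (simp add: legs_def)

lemma legs_closed:
  "x \<in> carrier T \<Longrightarrow> f \<in> carrier A \<rightarrow> carrier M \<Longrightarrow> g \<in> carrier B \<rightarrow> carrier M
    \<Longrightarrow> legs M f g x \<in> carrier M"
  unfolding legs_def by (rule tensor_sum_in[OF kalgebra_module[OF M]]) auto

text \<open>The universal property of the tensor product of algebras. On pure tensors the claim is
  that g b' can be moved past f a in f a' g b' f a g b; linearity in each factor does the
  rest.\<close>

lemma legs_mult: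
  assumes f: "f \<in> algebra_homs K A M" and g: "g \<in> algebra_homs K B M"
    and c: "commuting M (f ` carrier A) (g ` carrier B)"
    and x: "x \<in> carrier T" and y: "y \<in> carrier T"
  shows "legs M f g (x \<otimes>\<^bsub>T\<^esub> y) = legs M f g x \<otimes> legs M f g y"
proof -
  note fg = algebra_homsD(1,2)[OF f] algebra_homsD(1,2)[OF g]
  have lin: "legs M f g \<in> linear_maps K T M" by (rule legs_linear) fact+
  note l = linear_mapsD[OF lin]
  have 1: "legs M f g (x \<otimes>\<^bsub>T\<^esub> pure a b) =
      legs M f g x \<otimes> legs M f g (pure a b)"
    if x: "x \<in> carrier T" and ab: "a \<in> carrier A" "b \<in> carrier B" for x a b
  proof (rule linear_eqI[OF kalgebra_module[OF M] _ _ _ x])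
    fix a' b' assume ab': "a' \<in> carrier A" "b' \<in> carrier B"
    have "g b' \<otimes> (f a \<otimes> g b) = f a \<otimes> (g b' \<otimes> g b)"
    proof -
      have "g b' \<otimes> f a = f a \<otimes> g b'"
        using ab ab' c by (simp add: commuting_def)
      then show ?thesis using ab ab' fg by (simp add: M.m_assoc[symmetric])
    qed
    then show "legs M f g (pure a' b' \<otimes>\<^bsub>T\<^esub> pure a b) =
        legs M f g (pure a' b') \<otimes> legs M f g (pure a b)"
      using ab ab' fg algebra_homsD(3)[OF f] algebra_homsD(3)[OF g]
      by (simp add: legs_pure M.m_assoc)
  qed (use ab l in \<open>auto intro!: linear_mapsI simp: T.l_distr T.smult_mult_left M.l_distr M.smult_mult_left\<close>)
  show ?thesis
    by (rule linear_eqI[OF kalgebra_module[OF M] _ _ _ y])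
      (use x l 1[OF x] in \<open>auto intro!: linear_mapsI simp: T.r_distr T.smult_mult_right M.r_distr M.smult_mult_right\<close>)
qed

lemma legs_hom:
  assumes "f \<in> algebra_homs K A M" "g \<in> algebra_homs K B M"
    and "commuting M (f ` carrier A) (g ` carrier B)"
  shows "legs M f g \<in> algebra_homs K T M"
  using assms algebra_homsD(4)[OF assms(1)] algebra_homsD(4)[OF assms(2)]
  by (intro algebra_homsI) (simp_all add: legs_mult legs_linear algebra_homsD(1) tensor_one legs_pure)

end

lemma commuting_legs:
  fixes M (structure)
  assumes M: "kalgebra K M" and x: "x \<in> carrier T" and C: "C \<subseteq> carrier M"
    and f: "f \<in> carrier A \<rightarrow> carrier M" and g: "g \<in> carrier B \<rightarrow> carrier M"
    and cf: "commuting M C (f ` carrier A)" and cg: "commuting M C (g ` carrier B)"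
  shows "commuting M C {legs M f g x}"
proof -
  interpret M: kalgebra K M by fact
  have "c \<otimes> legs M f g x = legs M f g x \<otimes> c" if c: "c \<in> C" for c
  proof -
    have c': "c \<in> carrier M" using c C by auto
    have fg: "f a \<in> carrier M" "g b \<in> carrier M" if "a \<in> carrier A" "b \<in> carrier B" for a b
      using that f g by auto
    have *: "c \<otimes> (f a \<otimes> g b) = f a \<otimes> g b \<otimes> c"
      if ab: "a \<in> carrier A" "b \<in> carrier B" for a b
    proof -
      have "c \<otimes> (f a \<otimes> g b) = f a \<otimes> (c \<otimes> g b)"
        using ab c c' fg cf by (simp add: M.m_assoc[symmetric] commuting_def)
      also have "\<dots> = f a \<otimes> g b \<otimes> c"
        using ab c c' fg cg by (simp add: M.m_assoc commuting_def)
      finally show ?thesis .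
    qed
    have "c \<otimes> legs M f g x = tensor_sum M x (\<lambda>a b. c \<otimes> (f a \<otimes> g b))"
      unfolding legs_def using c' fg by (intro mult_tensor_sum M x) auto
    also have "\<dots> = tensor_sum M x (\<lambda>a b. f a \<otimes> g b \<otimes> c)"
      using * by (intro tensor_sum_cong x) auto
    also have "\<dots> = legs M f g x \<otimes> c"
      unfolding legs_def using c' fg by (intro tensor_sum_mult_const[symmetric] M x) auto
    finally show ?thesis .
  qed
  then show ?thesis by (simp add: commuting_def)
qed

end

context kalgebra_pair
begin

abbreviation "inl \<equiv> \<lambda>a. pure a \<one>\<^bsub>B\<^esub>"
abbreviation "inr \<equiv> \<lambda>b. pure \<one>\<^bsub>A\<^esub> b"

lemma inl_hom: "inl \<in> algebra_homs K A T"
  by (rule algebra_homsI) (simp_all add: linear_pure_left linear_maps_id tensor_one)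

lemma inr_hom: "inr \<in> algebra_homs K B T"
  by (rule algebra_homsI) (simp_all add: linear_pure_right[where f = "\<lambda>x. x", simplified]
      linear_maps_id tensor_one)

lemma inl_inr_commuting: "commuting T (inl ` carrier A) (inr ` carrier B)"
  by (auto simp: commuting_def)

text \<open>With the two standard embeddings as legs a tensor is recovered, so identities about legs
  in a general algebra specialise to identities in the tensor product itself.\<close>

lemma legs_inl_inr: "x \<in> carrier T \<Longrightarrow> legs T inl inr x = x"
  unfolding legs_def by (simp add: tensor_sum_pure_tensor cong: tensor_sum_cong)

end

section \<open>Triple tensors\<close>

locale kalgebra_triple = A: kalgebra K A + B: kalgebra K B + C: kalgebra K C
  for K :: "('k, 'c) ring_scheme" and A :: "('k, 'a, 'm) module_scheme"
    and B :: "('k, 'b, 'n) module_scheme" and C :: "('k, 'd, 'p) module_scheme"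
begin

sublocale BC: kalgebra_pair K B C ..
sublocale kalgebra_pair K A "tensor_algebra K B C" ..

text \<open>A trilinear \<open>F\<close> induces the linear map \<open>\<phi>\<close> on the triple
  tensor product, and linear maps pass through both sums. Coassociativity and the two coproduct
  axioms of an R-matrix are equations between nested sums of this shape, so the lemma yields their
  Sweedler form for every trilinear \<open>F\<close>.\<close>

lemma tensor3_apply:
  assumes M: "kalgebra K M"
    and F: "\<And>b c. b \<in> carrier B \<Longrightarrow> c \<in> carrier C \<Longrightarrow> (\<lambda>a. F a b c) \<in> linear_maps K A M"
      "\<And>a c. a \<in> carrier A \<Longrightarrow> c \<in> carrier C \<Longrightarrow> (\<lambda>b. F a b c) \<in> linear_maps K B M"
      "\<And>a b. a \<in> carrier A \<Longrightarrow> b \<in> carrier B \<Longrightarrow> (\<lambda>c. F a b c) \<in> linear_maps K C M"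
  defines "\<phi> \<equiv> \<lambda>z. tensor_sum M z (\<lambda>a w. tensor_sum M w (F a))"
  assumes XY: "module_pair K X Y" and ZW: "module_pair K Z W"
    and x: "x \<in> carrier (tensor_algebra K X Y)"
    and u: "\<And>a b. a \<in> carrier X \<Longrightarrow> b \<in> carrier Y \<Longrightarrow> u a b \<in> carrier (tensor_algebra K Z W)"
    and \<alpha>: "\<And>a b c d. a \<in> carrier X \<Longrightarrow> b \<in> carrier Y \<Longrightarrow> c \<in> carrier Z \<Longrightarrow> d \<in> carrier W
      \<Longrightarrow> \<alpha> a b c d \<in> carrier A \<and> \<beta> a b c d \<in> carrier B \<and> \<gamma> a b c d \<in> carrier C"
  shows "\<phi> (tensor_sum T x (\<lambda>a b. tensor_sum T (u a b) (\<lambda>c d.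
      pure_tensor3 K A B C (\<alpha> a b c d) (\<beta> a b c d) (\<gamma> a b c d)))) =
    tensor_sum M x (\<lambda>a b. tensor_sum M (u a b) (\<lambda>c d. F (\<alpha> a b c d) (\<beta> a b c d) (\<gamma> a b c d)))"
proof -
  interpret M: kalgebra K M by fact
  interpret XY: module_pair K X Y by fact
  interpret ZW: module_pair K Z W by fact
  have Fb: "F a \<in> bilinear_maps K B C M" if "a \<in> carrier A" for a
    using that F by (intro bilinear_mapsI)
  have b: "(\<lambda>a w. tensor_sum M w (F a)) \<in> bilinear_maps K A BC.T M"
    using F Fb
    by (intro bilinear_mapsI BC.tensor_sum_linear BC.linear_tensor_sum_fun M.module_axioms) auto
  have lin: "\<phi> \<in> linear_maps K T M"
    unfolding \<phi>_def by (rule tensor_sum_linear[OF M.module_axioms b])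
  have p: "\<phi> (pure_tensor3 K A B C a b c) = F a b c"
    if "a \<in> carrier A" "b \<in> carrier B" "c \<in> carrier C" for a b c
    unfolding \<phi>_def using that
    by (simp add: tensor_sum_pure[OF M.module_axioms b] BC.tensor_sum_pure[OF M.module_axioms Fb])
  have \<alpha>': "\<alpha> a b c d \<in> carrier A" "\<beta> a b c d \<in> carrier B" "\<gamma> a b c d \<in> carrier C"
    if "a \<in> carrier X" "b \<in> carrier Y" "c \<in> carrier Z" "d \<in> carrier W" for a b c d
    using \<alpha> that by auto
  have cl: "pure_tensor3 K A B C (\<alpha> a b c d) (\<beta> a b c d) (\<gamma> a b c d) \<in> carrier T"
    if "a \<in> carrier X" "b \<in> carrier Y" "c \<in> carrier Z" "d \<in> carrier W" for a b c d
    using \<alpha>' that by auto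
  have "\<phi> (tensor_sum T x (\<lambda>a b. tensor_sum T (u a b) (\<lambda>c d.
      pure_tensor3 K A B C (\<alpha> a b c d) (\<beta> a b c d) (\<gamma> a b c d)))) =
    tensor_sum M x (\<lambda>a b. \<phi> (tensor_sum T (u a b) (\<lambda>c d.
      pure_tensor3 K A B C (\<alpha> a b c d) (\<beta> a b c d) (\<gamma> a b c d))))"
    by (rule XY.linear_tensor_sum[OF tensor_module M.module_axioms x _ lin])
      (intro ZW.tensor_sum_in tensor_module u cl)
  also have "\<dots> = tensor_sum M x (\<lambda>a b. tensor_sum M (u a b) (\<lambda>c d.
      \<phi> (pure_tensor3 K A B C (\<alpha> a b c d) (\<beta> a b c d) (\<gamma> a b c d))))"
    by (intro XY.tensor_sum_cong x ZW.linear_tensor_sum[OF tensor_module M.module_axioms _ _ lin] u cl)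
  also have "\<dots> = tensor_sum M x (\<lambda>a b. tensor_sum M (u a b) (\<lambda>c d.
      F (\<alpha> a b c d) (\<beta> a b c d) (\<gamma> a b c d)))"
    by (intro XY.tensor_sum_cong x ZW.tensor_sum_cong u p \<alpha>')
  finally show ?thesis .
qed

end

section \<open>Opposite algebras\<close>

definition opposite :: "('k, 'a, 'm) module_scheme \<Rightarrow> ('k, 'a, 'm) module_scheme"
  where "opposite A = A\<lparr>mult := \<lambda>x y. y \<otimes>\<^bsub>A\<^esub> x\<rparr>"

lemma opposite_simps [simp]:
  "carrier (opposite A) = carrier A" "x \<otimes>\<^bsub>opposite A\<^esub> y = y \<otimes>\<^bsub>A\<^esub> x"
  "\<one>\<^bsub>opposite A\<^esub> = \<one>\<^bsub>A\<^esub>" "\<zero>\<^bsub>opposite A\<^esub> = \<zero>\<^bsub>A\<^esub>"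
  "x \<oplus>\<^bsub>opposite A\<^esub> y = x \<oplus>\<^bsub>A\<^esub> y" "k \<odot>\<^bsub>opposite A\<^esub> x = k \<odot>\<^bsub>A\<^esub> x"
  by (simp_all add: opposite_def)

lemma linear_maps_opposite [simp]:
  "linear_maps K (opposite A) B = linear_maps K A B"
  "linear_maps K A (opposite B) = linear_maps K A B"
  by (simp_all add: linear_maps_def)

lemma tensor_sum_opposite [simp]: "tensor_sum (opposite M) x f = tensor_sum M x f"
  by (simp add: tensor_sum_def)

lemma (in kalgebra) kalgebra_opposite: "kalgebra K (opposite A)"
proof -
  have "abelian_group (opposite A)"
    using module.axioms(2)[OF A.module_axioms]
    by (simp add: abelian_group_def abelian_monoid_def abelian_group_axioms_def opposite_def
        del: opposite_simps)
  then show ?thesis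
    by (intro kalgebra.intro kalgebra_axioms.intro moduleI ringI monoidI K.field_axioms K.is_cring)
      (simp_all add: A.smult_l_distr A.smult_r_distr A.smult_assoc1 A.m_assoc A.l_distr A.r_distr
        smult_mult_left smult_mult_right)
qed

text \<open>The congruence refers only to the addition, zero and scalars of \<open>B\<close>, which
  the opposite algebra shares. Hence A \<otimes> B and A \<otimes> B^op have the same elements, and
  one element can be multiplied in either algebra.\<close>

lemma tensor_eq_opposite: "tensor_eq K A (opposite B) = tensor_eq K A B"
proof -
  note intros = tensor_eq.intros[where K = K and A = A and B = "opposite B", simplified]
  have "tensor_eq K A (opposite B) xs ys" if "tensor_eq K A B xs ys" for xs ys
    using that
  proof induction
    case (sym xs ys)
    from sym(2) show ?case by (rule tensor_eq.sym)
  next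
    case (trans xs ys zs)
    from trans(3,4) show ?case by (rule tensor_eq.trans)
  qed (auto intro: intros(1,4-))
  moreover have "tensor_eq K A B xs ys" if "tensor_eq K A (opposite B) xs ys" for xs ys
    using that
  proof induction
    case (sym xs ys)
    from sym(2) show ?case by (rule tensor_eq.sym)
  next
    case (trans xs ys zs)
    from trans(3,4) show ?case by (rule tensor_eq.trans)
  qed (auto intro: tensor_eq.intros(1,4-))
  ultimately show ?thesis by (intro ext) blast
qed

lemma tensor_opposite [simp]:
  "tensor_class K A (opposite B) = tensor_class K A B"
  "pure_tensor K A (opposite B) = pure_tensor K A B"
  "carrier (tensor_algebra K A (opposite B)) = carrier (tensor_algebra K A B)"
  "\<zero>\<^bsub>tensor_algebra K A (opposite B)\<^esub> = \<zero>\<^bsub>tensor_algebra K A B\<^esub>"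
  "\<one>\<^bsub>tensor_algebra K A (opposite B)\<^esub> = \<one>\<^bsub>tensor_algebra K A B\<^esub>"
  "x \<oplus>\<^bsub>tensor_algebra K A (opposite B)\<^esub> y = x \<oplus>\<^bsub>tensor_algebra K A B\<^esub> y"
  "k \<odot>\<^bsub>tensor_algebra K A (opposite B)\<^esub> x = k \<odot>\<^bsub>tensor_algebra K A B\<^esub> x"
  by (simp_all add: fun_eq_iff tensor_class_def tensor_eq_opposite pure_tensor_def tensor_algebra_def)

lemma tensor_sum_tensor_opposite [simp]:
  "tensor_sum (tensor_algebra K A (opposite B)) x f = tensor_sum (tensor_algebra K A B) x f"
  by (simp add: tensor_sum_def)

section \<open>The antipode\<close>

context bialgebra
begin

sublocale HH: kalgebra_pair K H H ..
sublocale HHH: kalgebra_triple K H H H ..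

lemma comult_closed [simp]: "h \<in> carrier H \<Longrightarrow> comult H h \<in> carrier HH.T"
  by (rule algebra_homsD(2)[OF comult_hom])

lemma counit_closed [simp]: "h \<in> carrier H \<Longrightarrow> counit H h \<in> carrier K"
  by (rule ring_hom_closed[OF counit_hom])

context
  fixes M :: "('k, 'd, 'p) module_scheme" (structure)
  assumes M: "kalgebra K M"
begin

interpretation M: kalgebra K M by (rule M)

lemma linear_counit_smult:
  assumes f: "f \<in> linear_maps K A H" and c: "c \<in> carrier M"
  shows "(\<lambda>x. counit H (f x) \<odot>\<^bsub>M\<^esub> c) \<in> linear_maps K A M"
  by (rule linear_mapsI)
    (simp_all add: linear_mapsD[of f K A H] f c ring_hom_add[OF counit_hom] counit_smult
      M.A.smult_l_distr M.A.smult_assoc1)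

lemma coassoc_apply:
  assumes h: "h \<in> carrier H"
    and F: "\<And>b c. b \<in> carrier H \<Longrightarrow> c \<in> carrier H \<Longrightarrow> (\<lambda>a. F a b c) \<in> linear_maps K H M"
      "\<And>a c. a \<in> carrier H \<Longrightarrow> c \<in> carrier H \<Longrightarrow> (\<lambda>b. F a b c) \<in> linear_maps K H M"
      "\<And>a b. a \<in> carrier H \<Longrightarrow> b \<in> carrier H \<Longrightarrow> (\<lambda>c. F a b c) \<in> linear_maps K H M"
  shows "tensor_sum M (comult H h) (\<lambda>h1 h2. tensor_sum M (comult H h1) (\<lambda>x y. F x y h2)) =
    tensor_sum M (comult H h) (\<lambda>h1 h2. tensor_sum M (comult H h2) (\<lambda>x y. F h1 x y))"
proof -
  have mp: "module_pair K H H" ..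
  show ?thesis
    using arg_cong[OF coassoc[OF h],
        of "\<lambda>z. tensor_sum M z (\<lambda>a w. tensor_sum M w (F a))"]
      HHH.tensor3_apply[OF M F mp mp comult_closed[OF h], of "\<lambda>a b. comult H a"
        "\<lambda>a b c d. c" "\<lambda>a b c d. d" "\<lambda>a b c d. b"]
      HHH.tensor3_apply[OF M F mp mp comult_closed[OF h], of "\<lambda>a b. comult H b"
        "\<lambda>a b c d. a" "\<lambda>a b c d. c" "\<lambda>a b c d. d"]
    by simp
qed

lemma counit_left_apply:
  assumes h: "h \<in> carrier H" and f: "f \<in> linear_maps K H M"
  shows "tensor_sum M (comult H h) (\<lambda>h1 h2. counit H h1 \<odot>\<^bsub>M\<^esub> f h2) = f h"
proof -
  have "f (tensor_sum H (comult H h) (\<lambda>h1 h2. counit H h1 \<odot>\<^bsub>H\<^esub> h2)) =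
      tensor_sum M (comult H h) (\<lambda>h1 h2. f (counit H h1 \<odot>\<^bsub>H\<^esub> h2))"
    using h by (intro HH.linear_tensor_sum[OF A.module_axioms M.module_axioms _ _ f]) auto
  also have "\<dots> = tensor_sum M (comult H h) (\<lambda>h1 h2. counit H h1 \<odot>\<^bsub>M\<^esub> f h2)"
    using h by (intro HH.tensor_sum_cong) (simp_all add: linear_mapsD[OF f])
  finally show ?thesis using counit_left[OF h] by simp
qed

lemma counit_right_apply:
  assumes h: "h \<in> carrier H" and f: "f \<in> linear_maps K H M"
  shows "tensor_sum M (comult H h) (\<lambda>h1 h2. counit H h2 \<odot>\<^bsub>M\<^esub> f h1) = f h"
proof -
  have "f (tensor_sum H (comult H h) (\<lambda>h1 h2. counit H h2 \<odot>\<^bsub>H\<^esub> h1)) =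
      tensor_sum M (comult H h) (\<lambda>h1 h2. f (counit H h2 \<odot>\<^bsub>H\<^esub> h1))"
    using h by (intro HH.linear_tensor_sum[OF A.module_axioms M.module_axioms _ _ f]) auto
  also have "\<dots> = tensor_sum M (comult H h) (\<lambda>h1 h2. counit H h2 \<odot>\<^bsub>M\<^esub> f h1)"
    using h by (intro HH.tensor_sum_cong) (simp_all add: linear_mapsD[OF f])
  finally show ?thesis using counit_right[OF h] by simp
qed

lemma comult_mult_apply:
  assumes "h \<in> carrier H" "k \<in> carrier H" "F \<in> bilinear_maps K H H M"
  shows "tensor_sum M (comult H (h \<otimes>\<^bsub>H\<^esub> k)) F = tensor_sum M (comult H h) (\<lambda>h1 h2.
    tensor_sum M (comult H k) (\<lambda>k1 k2. F (h1 \<otimes>\<^bsub>H\<^esub> k1) (h2 \<otimes>\<^bsub>H\<^esub> k2)))"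
  using assms by (simp add: algebra_homsD(3)[OF comult_hom] HH.tensor_sum_mult M.module_axioms)

end

end

context hopf_algebra
begin

abbreviation "S \<equiv> antipode H"
abbreviation "\<Delta> h \<equiv> tensor_sum H (comult H h)"

lemma antipode_closed [simp]: "x \<in> carrier H \<Longrightarrow> S x \<in> carrier H"
  by (rule linear_mapsD(1)[OF antipode_linear])

lemma linear_antipode: "f \<in> linear_maps K A H \<Longrightarrow> (\<lambda>x. S (f x)) \<in> linear_maps K A H"
  by (rule linear_maps_compose[OF antipode_linear])

lemmas linear_H = linear_mult_left linear_mult_right linear_smult linear_maps_id linear_antipode
  linear_counit_smult[OF kalgebra_axioms]

lemma sum_in: "x \<in> carrier HH.T \<Longrightarrow>
    (\<And>a b. a \<in> carrier H \<Longrightarrow> b \<in> carrier H \<Longrightarrow> f a b \<in> carrier H) \<Longrightarrow> tensor_sum H x f \<in> carrier H"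
  by (rule HH.tensor_sum_in[OF A.module_axioms])

lemmas sum_mult_left = HH.mult_tensor_sum[OF kalgebra_axioms]
  and sum_mult_right = HH.tensor_sum_mult_const[OF kalgebra_axioms]

lemma sum_smult:
  assumes "x \<in> carrier HH.T" "k \<in> carrier K"
    and "\<And>a b. a \<in> carrier H \<Longrightarrow> b \<in> carrier H \<Longrightarrow> f a b \<in> carrier H"
  shows "k \<odot>\<^bsub>H\<^esub> tensor_sum H x f = tensor_sum H x (\<lambda>a b. k \<odot>\<^bsub>H\<^esub> f a b)"
  using assms by (intro HH.linear_tensor_sum[OF A.module_axioms A.module_axioms] linear_H)

lemma sum_swap:
  assumes "x \<in> carrier HH.T" "y \<in> carrier HH.T"
    and "\<And>a b c d. a \<in> carrier H \<Longrightarrow> b \<in> carrier H \<Longrightarrow> c \<in> carrier H \<Longrightarrow> d \<in> carrier H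
      \<Longrightarrow> F a b c d \<in> carrier H"
  shows "tensor_sum H x (\<lambda>a b. tensor_sum H y (F a b)) =
    tensor_sum H y (\<lambda>c d. tensor_sum H x (\<lambda>a b. F a b c d))"
  by (rule HH.tensor_sum_swap[OF A.module_axioms assms(1) HH.module_pair_axioms assms(2,3)])

text \<open>Bilinear maps \<open>H \<times> H \<rightarrow> H\<close> form a monoid under convolution, in which multiplication has the
  left inverse \<open>(h, k) \<mapsto> S (h k)\<close> and the right inverse \<open>(h, k) \<mapsto> S k S h\<close>.\<close>

definition conv :: "('a \<Rightarrow> 'a \<Rightarrow> 'a) \<Rightarrow> ('a \<Rightarrow> 'a \<Rightarrow> 'a) \<Rightarrow> 'a \<Rightarrow> 'a \<Rightarrow> 'a"
  where "conv f g h k = \<Delta> h (\<lambda>h1 h2. \<Delta> k (\<lambda>k1 k2.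
    f h1 k1 \<otimes>\<^bsub>H\<^esub> g h2 k2))"

lemma conv_cong:
  assumes "\<And>h k. h \<in> carrier H \<Longrightarrow> k \<in> carrier H \<Longrightarrow> f h k = f' h k"
    and "\<And>h k. h \<in> carrier H \<Longrightarrow> k \<in> carrier H \<Longrightarrow> g h k = g' h k"
    and "h \<in> carrier H" "k \<in> carrier H"
  shows "conv f g h k = conv f' g' h k"
  unfolding conv_def using assms by (intro HH.tensor_sum_cong) auto

text \<open>Coassociativity is applied to \<open>h\<close> and to \<open>k\<close> separately. The
  sums over the two coproducts are nested alternately, so they are interchanged before, to bring the
  two sums for \<open>h\<close> together, and restored afterwards.\<close>

lemma conv_assoc:
  assumes f: "f \<in> bilinear_maps K H H H" and g: "g \<in> bilinear_maps K H H H"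
    and m: "m \<in> bilinear_maps K H H H" and h: "h \<in> carrier H" and k: "k \<in> carrier H"
  shows "conv (conv f g) m h k = conv f (conv g m) h k"
proof -
  note cl = HH.bilinear_closed[OF f] HH.bilinear_closed[OF g] HH.bilinear_closed[OF m]
  note lin = bilinear_mapsD[OF f] bilinear_mapsD[OF g] bilinear_mapsD[OF m]
  let ?F = "\<lambda>x a y b z c. f x a \<otimes>\<^bsub>H\<^esub> g y b \<otimes>\<^bsub>H\<^esub> m z c"
  have "conv (conv f g) m h k =
    \<Delta> h (\<lambda>h1 h2. \<Delta> k (\<lambda>k1 k2.
      \<Delta> h1 (\<lambda>x y. \<Delta> k1 (\<lambda>a b. ?F x a y b h2 k2))))"
    unfolding conv_def
    by (intro HH.tensor_sum_cong) (simp_all add: h k cl sum_in sum_mult_right cong: HH.tensor_sum_cong)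
  also have "\<dots> = \<Delta> h (\<lambda>h1 h2. \<Delta> h1 (\<lambda>x y.
      \<Delta> k (\<lambda>k1 k2. \<Delta> k1 (\<lambda>a b. ?F x a y b h2 k2))))"
    by (intro HH.tensor_sum_cong sum_swap) (simp_all add: h k cl sum_in)
  also have "\<dots> = \<Delta> h (\<lambda>h1 h2. \<Delta> h2 (\<lambda>y z.
      \<Delta> k (\<lambda>k1 k2. \<Delta> k1 (\<lambda>a b. ?F h1 a y b z k2))))"
    by (intro coassoc_apply[OF kalgebra_axioms h] HH.linear_tensor_sum_fun[OF A.module_axioms]
        linear_mult_right linear_mult_left lin) (simp_all add: k cl)
  also have "\<dots> = \<Delta> h (\<lambda>h1 h2. \<Delta> h2 (\<lambda>y z.
      \<Delta> k (\<lambda>k1 k2. \<Delta> k2 (\<lambda>b c. ?F h1 k1 y b z c))))"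
    by (intro HH.tensor_sum_cong coassoc_apply[OF kalgebra_axioms k]
        linear_mult_right linear_mult_left lin) (simp_all add: h k cl)
  also have "\<dots> = \<Delta> h (\<lambda>h1 h2. \<Delta> k (\<lambda>k1 k2.
      \<Delta> h2 (\<lambda>y z. \<Delta> k2 (\<lambda>b c. ?F h1 k1 y b z c))))"
    by (intro HH.tensor_sum_cong sum_swap[symmetric]) (simp_all add: h k cl sum_in)
  also have "\<dots> = conv f (conv g m) h k"
    unfolding conv_def
    by (intro HH.tensor_sum_cong)
      (simp_all add: h k cl sum_in sum_mult_left A.m_assoc cong: HH.tensor_sum_cong)
  finally show ?thesis .
qed

definition conv_unit :: "'a \<Rightarrow> 'a \<Rightarrow> 'a"
  where "conv_unit h k = counit H h \<odot>\<^bsub>H\<^esub> (counit H k \<odot>\<^bsub>H\<^esub> \<one>\<^bsub>H\<^esub>)"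

lemma conv_unit_left:
  assumes f: "f \<in> bilinear_maps K H H H" and h: "h \<in> carrier H" and k: "k \<in> carrier H"
  shows "conv conv_unit f h k = f h k"
proof -
  note cl = HH.bilinear_closed[OF f]
  have "conv conv_unit f h k = \<Delta> h (\<lambda>h1 h2.
      counit H h1 \<odot>\<^bsub>H\<^esub> \<Delta> k (\<lambda>k1 k2. counit H k1 \<odot>\<^bsub>H\<^esub> f h2 k2))"
    unfolding conv_def conv_unit_def
    by (intro HH.tensor_sum_cong) (simp_all add: h k cl sum_smult smult_mult_left cong: HH.tensor_sum_cong)
  also have "\<dots> = f h k"
    using h k
      by (simp add: counit_left_apply[OF kalgebra_axioms] bilinear_mapsD[OF f] cong: HH.tensor_sum_cong)
  finally show ?thesis .
qed

lemma conv_unit_right: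
  assumes f: "f \<in> bilinear_maps K H H H" and h: "h \<in> carrier H" and k: "k \<in> carrier H"
  shows "conv f conv_unit h k = f h k"
proof -
  note cl = HH.bilinear_closed[OF f]
  have "conv f conv_unit h k = \<Delta> h (\<lambda>h1 h2.
      counit H h2 \<odot>\<^bsub>H\<^esub> \<Delta> k (\<lambda>k1 k2. counit H k2 \<odot>\<^bsub>H\<^esub> f h1 k1))"
    unfolding conv_def conv_unit_def
    by (intro HH.tensor_sum_cong) (simp_all add: h k cl sum_smult smult_mult_right cong: HH.tensor_sum_cong)
  also have "\<dots> = f h k"
    using h k
      by (simp add: counit_right_apply[OF kalgebra_axioms] bilinear_mapsD[OF f] cong: HH.tensor_sum_cong)
  finally show ?thesis .
qed

lemma antipode_mult:
  assumes h: "h \<in> carrier H" and k: "k \<in> carrier H"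
  shows "S (h \<otimes>\<^bsub>H\<^esub> k) = S k \<otimes>\<^bsub>H\<^esub> S h"
proof -
  let ?f = "\<lambda>h k. S (h \<otimes>\<^bsub>H\<^esub> k)" and ?m = "\<lambda>h k. h \<otimes>\<^bsub>H\<^esub> k" and ?g = "\<lambda>h k. S k \<otimes>\<^bsub>H\<^esub> S h"
  have f: "?f \<in> bilinear_maps K H H H" and m: "?m \<in> bilinear_maps K H H H"
    and g: "?g \<in> bilinear_maps K H H H"
    by (intro bilinear_mapsI linear_H; simp)+
  have fm: "conv ?f ?m h k = conv_unit h k" if h: "h \<in> carrier H" and k: "k \<in> carrier H" for h k
  proof -
    have "conv ?f ?m h k = tensor_sum H (comult H (h \<otimes>\<^bsub>H\<^esub> k)) (\<lambda>x y. S x \<otimes>\<^bsub>H\<^esub> y)"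
      unfolding conv_def using h k
      by (subst comult_mult_apply[OF kalgebra_axioms]) (auto intro!: bilinear_mapsI linear_H)
    also have "\<dots> = conv_unit h k"
      using h k by (simp add: antipode_left conv_unit_def ring_hom_mult[OF counit_hom] A.smult_assoc1)
    finally show ?thesis .
  qed
  \<comment> \<open>The sum over \<open>k\<close> lies innermost in h1 k1 S(k2) S(h2) and collapses
    to the scalar \<epsilon>(k); this leaves h1 next to S(h2), and the sum over \<open>h\<close>
    collapses in turn.\<close>
  have mg: "conv ?m ?g h k = conv_unit h k" if h: "h \<in> carrier H" and k: "k \<in> carrier H" for h k
  proof -
    have "conv ?m ?g h k = \<Delta> h (\<lambda>h1 h2.
        h1 \<otimes>\<^bsub>H\<^esub> \<Delta> k (\<lambda>k1 k2. k1 \<otimes>\<^bsub>H\<^esub> S k2) \<otimes>\<^bsub>H\<^esub> S h2)"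
      unfolding conv_def using h k
      by (intro HH.tensor_sum_cong)
        (simp_all add: sum_in sum_mult_left sum_mult_right A.m_assoc cong: HH.tensor_sum_cong)
    also have "\<dots> = \<Delta> h (\<lambda>h1 h2. counit H k \<odot>\<^bsub>H\<^esub> (h1 \<otimes>\<^bsub>H\<^esub> S h2))"
      using h k by (intro HH.tensor_sum_cong)
        (simp_all add: antipode_right smult_mult_left smult_mult_right)
    also have "\<dots> = counit H k \<odot>\<^bsub>H\<^esub> (counit H h \<odot>\<^bsub>H\<^esub> \<one>\<^bsub>H\<^esub>)"
      using h k by (simp add: sum_smult[symmetric] antipode_right)
    also have "\<dots> = conv_unit h k"
      using h k by (simp add: conv_unit_def A.smult_assoc1[symmetric] K.m_comm)
    finally show ?thesis .
  qed
  have "?f h k = conv ?f conv_unit h k" by (rule conv_unit_right[OF f h k, symmetric])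
  also have "\<dots> = conv ?f (conv ?m ?g) h k" by (intro conv_cong mg[symmetric] h k HOL.refl)
  also have "\<dots> = conv (conv ?f ?m) ?g h k" by (rule conv_assoc[OF f m g h k, symmetric])
  also have "\<dots> = conv conv_unit ?g h k" by (intro conv_cong fm h k HOL.refl)
  also have "\<dots> = ?g h k" by (rule conv_unit_left[OF g h k])
  finally show ?thesis .
qed

text \<open>The antipode axiom at 1, where the coproduct is 1 \<otimes> 1 and the counit is
  1.\<close>

lemma antipode_one [simp]: "S \<one>\<^bsub>H\<^esub> = \<one>\<^bsub>H\<^esub>"
proof -
  have "(\<lambda>x y. S x \<otimes>\<^bsub>H\<^esub> y) \<in> bilinear_maps K H H H" by (intro bilinear_mapsI linear_H; simp)
  then have "tensor_sum H (comult H \<one>\<^bsub>H\<^esub>) (\<lambda>x y. S x \<otimes>\<^bsub>H\<^esub> y) = S \<one>\<^bsub>H\<^esub>"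
    by (simp add: algebra_homsD(4)[OF comult_hom] HH.tensor_one
        HH.tensor_sum_pure[OF A.module_axioms])
  then show ?thesis by (simp add: antipode_left ring_hom_one[OF counit_hom])
qed

lemma antipode_hom: "S \<in> algebra_homs K H (opposite H)"
  by (rule algebra_homsI) (simp_all add: antipode_linear antipode_mult)

end

section \<open>Copairings\<close>

text \<open>What quasitriangular structures (with H = H') and weak R-matrices have in common:
  (\<Delta> \<otimes> id)(r) = r_13 r_23 and (id \<otimes> \<Delta>)(r) = r_13 r_12. Results on
  \<open>r\<close>, \<open>p\<close> and \<open>p'\<close> are thus proved once.\<close>

locale bialgebra_copairing = H: bialgebra K H + H': bialgebra K H'
  for K :: "('k, 'c) ring_scheme"
    and H :: "('k, 'a, 'm) bialg_scheme" and H' :: "('k, 'b, 'n) bialg_scheme" +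
  fixes r :: "('a, 'b) tensor"
  assumes r_closed [simp]: "r \<in> carrier (tensor_algebra K H H')"
    and comult_left:
      "tensor_sum (tensor_algebra3 K H H H') r (\<lambda>a b.
        tensor_sum (tensor_algebra3 K H H H') (comult H a) (\<lambda>a1 a2.
          pure_tensor3 K H H H' a1 a2 b)) =
       tensor_sum (tensor_algebra3 K H H H') r (\<lambda>ri ri'.
        tensor_sum (tensor_algebra3 K H H H') r (\<lambda>rj rj'.
          pure_tensor3 K H H H' ri rj (ri' \<otimes>\<^bsub>H'\<^esub> rj')))"
    and comult_right:
      "tensor_sum (tensor_algebra3 K H H' H') r (\<lambda>a b.
        tensor_sum (tensor_algebra3 K H H' H') (comult H' b) (\<lambda>b1 b2.
          pure_tensor3 K H H' H' a b1 b2)) =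
       tensor_sum (tensor_algebra3 K H H' H') r (\<lambda>ri ri'.
        tensor_sum (tensor_algebra3 K H H' H') r (\<lambda>rj rj'.
          pure_tensor3 K H H' H' (ri \<otimes>\<^bsub>H\<^esub> rj) rj' ri'))"
begin

sublocale kalgebra_pair K H H' ..
sublocale HHH': kalgebra_triple K H H H' ..
sublocale HH'H': kalgebra_triple K H H' H' ..

lemma comult_left_apply:
  assumes M: "kalgebra K M"
    and F: "\<And>b c. b \<in> carrier H \<Longrightarrow> c \<in> carrier H' \<Longrightarrow> (\<lambda>a. F a b c) \<in> linear_maps K H M"
      "\<And>a c. a \<in> carrier H \<Longrightarrow> c \<in> carrier H' \<Longrightarrow> (\<lambda>b. F a b c) \<in> linear_maps K H M"
      "\<And>a b. a \<in> carrier H \<Longrightarrow> b \<in> carrier H \<Longrightarrow> (\<lambda>c. F a b c) \<in> linear_maps K H' M"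
  shows "tensor_sum M r (\<lambda>a b. tensor_sum M (comult H a) (\<lambda>a1 a2. F a1 a2 b)) =
    tensor_sum M r (\<lambda>ri ri'. tensor_sum M r (\<lambda>rj rj'. F ri rj (ri' \<otimes>\<^bsub>H'\<^esub> rj')))"
  using arg_cong[OF comult_left, of "\<lambda>z. tensor_sum M z (\<lambda>a w. tensor_sum M w (F a))"]
    HHH'.tensor3_apply[OF M F module_pair_axioms H.HH.module_pair_axioms r_closed,
      of "\<lambda>a b. comult H a" "\<lambda>a b c d. c" "\<lambda>a b c d. d" "\<lambda>a b c d. b"]
    HHH'.tensor3_apply[OF M F module_pair_axioms module_pair_axioms r_closed,
      of "\<lambda>a b. r" "\<lambda>a b c d. a" "\<lambda>a b c d. c" "\<lambda>a b c d. b \<otimes>\<^bsub>H'\<^esub> d"]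
  by simp

lemma comult_right_apply:
  assumes M: "kalgebra K M"
    and F: "\<And>b c. b \<in> carrier H' \<Longrightarrow> c \<in> carrier H' \<Longrightarrow> (\<lambda>a. F a b c) \<in> linear_maps K H M"
      "\<And>a c. a \<in> carrier H \<Longrightarrow> c \<in> carrier H' \<Longrightarrow> (\<lambda>b. F a b c) \<in> linear_maps K H' M"
      "\<And>a b. a \<in> carrier H \<Longrightarrow> b \<in> carrier H' \<Longrightarrow> (\<lambda>c. F a b c) \<in> linear_maps K H' M"
  shows "tensor_sum M r (\<lambda>a b. tensor_sum M (comult H' b) (\<lambda>b1 b2. F a b1 b2)) =
    tensor_sum M r (\<lambda>ri ri'. tensor_sum M r (\<lambda>rj rj'. F (ri \<otimes>\<^bsub>H\<^esub> rj) rj' ri'))"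
  using arg_cong[OF comult_right, of "\<lambda>z. tensor_sum M z (\<lambda>a w. tensor_sum M w (F a))"]
    HH'H'.tensor3_apply[OF M F module_pair_axioms H'.HH.module_pair_axioms r_closed,
      of "\<lambda>a b. comult H' b" "\<lambda>a b c d. a" "\<lambda>a b c d. c" "\<lambda>a b c d. d"]
    HH'H'.tensor3_apply[OF M F module_pair_axioms module_pair_axioms r_closed,
      of "\<lambda>a b. r" "\<lambda>a b c d. a \<otimes>\<^bsub>H\<^esub> c" "\<lambda>a b c d. d" "\<lambda>a b c d. b"]
  by simp

lemma sum_T_in:
  "(\<And>a b. a \<in> carrier H \<Longrightarrow> b \<in> carrier H' \<Longrightarrow> f a b \<in> carrier T) \<Longrightarrow> tensor_sum T r f \<in> carrier T"
  by (rule tensor_sum_in[OF tensor_module r_closed])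

lemma r_mult_left:
  assumes "a \<in> carrier H" "b \<in> carrier H'"
  shows "pure a b \<otimes>\<^bsub>T\<^esub> r =
    tensor_sum T r (\<lambda>a' b'. pure (a \<otimes>\<^bsub>H\<^esub> a') (b \<otimes>\<^bsub>H'\<^esub> b'))"
proof -
  have "pure a b \<otimes>\<^bsub>T\<^esub> tensor_sum T r (pure_tensor K H H') =
      tensor_sum T r (\<lambda>a' b'. pure a b \<otimes>\<^bsub>T\<^esub> pure a' b')"
    using assms
    by (intro linear_tensor_sum[OF tensor_module tensor_module r_closed]
        T.linear_mult_left linear_maps_id) auto
  also have "\<dots> = tensor_sum T r (\<lambda>a' b'. pure (a \<otimes>\<^bsub>H\<^esub> a') (b \<otimes>\<^bsub>H'\<^esub> b'))"
    using assms by (intro tensor_sum_cong r_closed) simp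
  finally show ?thesis by (simp add: tensor_sum_pure_tensor)
qed

lemmas sum_T_mult_right = tensor_sum_mult_const[OF tensor_kalgebra r_closed]

lemma pure_sum_left:
  assumes "x \<in> carrier H.HH.T" "b \<in> carrier H'"
    and "\<And>y z. y \<in> carrier H \<Longrightarrow> z \<in> carrier H \<Longrightarrow> f y z \<in> carrier H"
  shows "pure (tensor_sum H x f) b = tensor_sum T x (\<lambda>y z. pure (f y z) b)"
  using assms
  by (intro H.HH.linear_tensor_sum[OF H.A.module_axioms tensor_module] linear_pure_left linear_maps_id)

lemma pure_sum_right:
  assumes "x \<in> carrier H'.HH.T" "a \<in> carrier H"
    and "\<And>y z. y \<in> carrier H' \<Longrightarrow> z \<in> carrier H' \<Longrightarrow> f y z \<in> carrier H'"
  shows "pure a (tensor_sum H' x f) = tensor_sum T x (\<lambda>y z. pure a (f y z))"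
  using assms
  by (intro H'.HH.linear_tensor_sum[OF H'.A.module_axioms tensor_module] linear_pure_right linear_maps_id)

definition counit_r_left :: 'b where
  "counit_r_left = tensor_sum H' r (\<lambda>a b. counit H a \<odot>\<^bsub>H'\<^esub> b)"

definition counit_r_right :: 'a where
  "counit_r_right = tensor_sum H r (\<lambda>a b. counit H' b \<odot>\<^bsub>H\<^esub> a)"

lemma counit_r_closed [simp]:
  "counit_r_left \<in> carrier H'" "counit_r_right \<in> carrier H"
  unfolding counit_r_left_def counit_r_right_def
  by (intro tensor_sum_in H'.A.module_axioms H.A.module_axioms; simp)+

text \<open>Puts 1 \<otimes> (\<epsilon> \<otimes> id)(r) into the form in which it appears after
  the counit or antipode axiom has been applied inside the first factor.\<close>

lemma pure_counit_r_left:
  "pure \<one>\<^bsub>H\<^esub> counit_r_left =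
    tensor_sum T r (\<lambda>a b. pure (counit H a \<odot>\<^bsub>H\<^esub> \<one>\<^bsub>H\<^esub>) b)"
proof -
  have "pure \<one>\<^bsub>H\<^esub> counit_r_left =
      tensor_sum T r (\<lambda>a b. pure \<one>\<^bsub>H\<^esub> (counit H a \<odot>\<^bsub>H'\<^esub> b))"
    unfolding counit_r_left_def
    by (intro linear_tensor_sum[OF H'.A.module_axioms tensor_module r_closed]
        linear_pure_right linear_maps_id) auto
  also have "\<dots> = tensor_sum T r (\<lambda>a b. pure (counit H a \<odot>\<^bsub>H\<^esub> \<one>\<^bsub>H\<^esub>) b)"
    by (intro tensor_sum_cong r_closed) (simp add: pure_tensor_balanced)
  finally show ?thesis .
qed

lemma pure_counit_r_right:
  "pure counit_r_right \<one>\<^bsub>H'\<^esub> =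
    tensor_sum T r (\<lambda>a b. pure a (counit H' b \<odot>\<^bsub>H'\<^esub> \<one>\<^bsub>H'\<^esub>))"
proof -
  have "pure counit_r_right \<one>\<^bsub>H'\<^esub> =
      tensor_sum T r (\<lambda>a b. pure (counit H' b \<odot>\<^bsub>H\<^esub> a) \<one>\<^bsub>H'\<^esub>)"
    unfolding counit_r_right_def
    by (intro linear_tensor_sum[OF H.A.module_axioms tensor_module r_closed]
        linear_pure_left linear_maps_id) auto
  also have "\<dots> = tensor_sum T r (\<lambda>a b. pure a (counit H' b \<odot>\<^bsub>H'\<^esub> \<one>\<^bsub>H'\<^esub>))"
    by (intro tensor_sum_cong r_closed) (simp add: pure_tensor_balanced)
  finally show ?thesis .
qed

text \<open>Apply \<epsilon> to the first factor of (\<Delta> \<otimes> id)(r) = r_13 r_23: the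
  counit axiom turns the left side into r, and the right side becomes the product claimed.\<close>

lemma counit_r_left_mult: "pure \<one>\<^bsub>H\<^esub> counit_r_left \<otimes>\<^bsub>T\<^esub> r = r"
proof -
  have "pure \<one>\<^bsub>H\<^esub> counit_r_left \<otimes>\<^bsub>T\<^esub> r =
     tensor_sum T r (\<lambda>ri ri'. tensor_sum T r (\<lambda>rj rj'.
       pure (counit H ri \<odot>\<^bsub>H\<^esub> rj) (ri' \<otimes>\<^bsub>H'\<^esub> rj')))"
    unfolding pure_counit_r_left
    by (simp add: sum_T_mult_right r_mult_left H.smult_mult_left cong: tensor_sum_cong)
  also have "\<dots> = tensor_sum T r (\<lambda>a b. tensor_sum T (comult H a) (\<lambda>a1 a2.
      pure (counit H a1 \<odot>\<^bsub>H\<^esub> a2) b))"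
    by (intro comult_left_apply[symmetric, OF tensor_kalgebra] linear_pure_left linear_pure_right
        H.linear_counit_smult[OF H.kalgebra_axioms] H.linear_smult linear_maps_id) auto
  also have "\<dots> = tensor_sum T r (\<lambda>a b. tensor_sum T (comult H a) (\<lambda>a1 a2.
      counit H a1 \<odot>\<^bsub>T\<^esub> pure a2 b))"
    by (intro tensor_sum_cong H.HH.tensor_sum_cong) simp_all
  also have "\<dots> = tensor_sum T r (pure_tensor K H H')"
    by (intro tensor_sum_cong H.counit_left_apply[OF tensor_kalgebra] linear_pure_left linear_maps_id)
      simp_all
  finally show ?thesis by (simp add: tensor_sum_pure_tensor)
qed

text \<open>Here \<epsilon> is applied to the last factor of (id \<otimes> \<Delta>)(r) = r_13
  r_12.\<close>

lemma counit_r_right_mult: "pure counit_r_right \<one>\<^bsub>H'\<^esub> \<otimes>\<^bsub>T\<^esub> r = r"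
proof -
  have "pure counit_r_right \<one>\<^bsub>H'\<^esub> \<otimes>\<^bsub>T\<^esub> r =
     tensor_sum T r (\<lambda>ri ri'. tensor_sum T r (\<lambda>rj rj'.
       pure (ri \<otimes>\<^bsub>H\<^esub> rj) (counit H' ri' \<odot>\<^bsub>H'\<^esub> rj')))"
    unfolding pure_counit_r_right
    by (simp add: sum_T_mult_right r_mult_left H'.smult_mult_left cong: tensor_sum_cong)
  also have "\<dots> = tensor_sum T r (\<lambda>a b. tensor_sum T (comult H' b) (\<lambda>b1 b2.
      pure a (counit H' b2 \<odot>\<^bsub>H'\<^esub> b1)))"
    by (intro comult_right_apply[symmetric, OF tensor_kalgebra] linear_pure_left linear_pure_right
        H'.linear_counit_smult[OF H'.kalgebra_axioms] H'.linear_smult linear_maps_id) auto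
  also have "\<dots> = tensor_sum T r (\<lambda>a b. tensor_sum T (comult H' b) (\<lambda>b1 b2.
      counit H' b2 \<odot>\<^bsub>T\<^esub> pure a b1))"
    by (intro tensor_sum_cong H'.HH.tensor_sum_cong) (simp_all add: pure_tensor_balanced)
  also have "\<dots> = tensor_sum T r (pure_tensor K H H')"
    by (intro tensor_sum_cong H'.counit_right_apply[OF tensor_kalgebra] linear_pure_right linear_maps_id)
      simp_all
  finally show ?thesis by (simp add: tensor_sum_pure_tensor)
qed

end

text \<open>The normalisations are stated in H \<otimes> H' because cancelling an invertible r gives
  them there; descending to H' or H would in addition require injectivity of b \<mapsto> 1 \<otimes>
  b or a \<mapsto> a \<otimes> 1.\<close>

locale hopf_copairing = bialgebra_copairing K H H' r + H: hopf_algebra K H + H': hopf_algebra K H'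
  for K :: "('k, 'c) ring_scheme"
    and H :: "('k, 'a, 'm) hopf_scheme" and H' :: "('k, 'b, 'n) hopf_scheme"
    and r :: "('a, 'b) tensor" +
  assumes counital_left: "pure \<one>\<^bsub>H\<^esub> counit_r_left = \<one>\<^bsub>tensor_algebra K H H'\<^esub>"
    and counital_right: "pure counit_r_right \<one>\<^bsub>H'\<^esub> = \<one>\<^bsub>tensor_algebra K H H'\<^esub>"
begin

definition R :: "('a, 'b) tensor"
  where "R = tensor_sum T r (\<lambda>a b. pure (antipode H a) b)"

lemma R_closed [simp]: "R \<in> carrier T"
  unfolding R_def by (rule sum_T_in) simp

text \<open>By (\<Delta> \<otimes> id)(r) = r_13 r_23 the product is the sum of S(a_1) a_2 \<otimes>
  b over r = a \<otimes> b. The antipode axiom leaves \<epsilon>(a) 1 \<otimes> b, which is 1 by the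
  counit normalisation. The product in the other order uses a_1 S(a_2).\<close>

lemma R_mult_r: "R \<otimes>\<^bsub>T\<^esub> r = \<one>\<^bsub>T\<^esub>"
proof -
  have "R \<otimes>\<^bsub>T\<^esub> r = tensor_sum T r (\<lambda>ri ri'. tensor_sum T r (\<lambda>rj rj'.
       pure (antipode H ri \<otimes>\<^bsub>H\<^esub> rj) (ri' \<otimes>\<^bsub>H'\<^esub> rj')))"
    unfolding R_def by (simp add: sum_T_mult_right r_mult_left cong: tensor_sum_cong)
  also have "\<dots> = tensor_sum T r (\<lambda>a b. tensor_sum T (comult H a) (\<lambda>a1 a2.
      pure (antipode H a1 \<otimes>\<^bsub>H\<^esub> a2) b))"
    by (intro comult_left_apply[symmetric, OF tensor_kalgebra] linear_pure_left linear_pure_right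
        H.linear_H) auto
  also have "\<dots> = tensor_sum T r (\<lambda>a b. pure (counit H a \<odot>\<^bsub>H\<^esub> \<one>\<^bsub>H\<^esub>) b)"
    by (simp add: pure_sum_left[symmetric] H.antipode_left cong: tensor_sum_cong)
  finally show ?thesis by (simp add: pure_counit_r_left[symmetric] counital_left)
qed

lemma r_mult_R: "r \<otimes>\<^bsub>T\<^esub> R = \<one>\<^bsub>T\<^esub>"
proof -
  have "r \<otimes>\<^bsub>T\<^esub> R = tensor_sum T r (\<lambda>ri ri'. tensor_sum T r (\<lambda>rj rj'.
       pure (ri \<otimes>\<^bsub>H\<^esub> antipode H rj) (ri' \<otimes>\<^bsub>H'\<^esub> rj')))"
    using mult_sums(1)[OF tensor_kalgebra r_closed module_pair_axioms r_closed, of "pure_tensor K H H'"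
        "\<lambda>a b. pure (antipode H a) b"]
    by (simp add: R_def tensor_sum_pure_tensor cong: tensor_sum_cong)
  also have "\<dots> = tensor_sum T r (\<lambda>a b. tensor_sum T (comult H a) (\<lambda>a1 a2.
      pure (a1 \<otimes>\<^bsub>H\<^esub> antipode H a2) b))"
    by (intro comult_left_apply[symmetric, OF tensor_kalgebra] linear_pure_left linear_pure_right
        H.linear_H) auto
  also have "\<dots> = tensor_sum T r (\<lambda>a b. pure (counit H a \<odot>\<^bsub>H\<^esub> \<one>\<^bsub>H\<^esub>) b)"
    by (simp add: pure_sum_left[symmetric] H.antipode_right cong: tensor_sum_cong)
  finally show ?thesis by (simp add: pure_counit_r_left[symmetric] counital_left)
qed

lemma inv_r: "inv\<^bsub>T\<^esub> r = R"
  using T.inv_unique'[OF r_closed R_closed r_mult_R R_mult_r] by simp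

text \<open>\<open>(id \<otimes> S)(r\<^sup>-\<^sup>1) = r\<close>: in \<open>H \<otimes> H'\<^sup>o\<^sup>p\<close> both sides are inverse to \<open>(id \<otimes> S)(r)\<close>.\<close>

lemma antipode_right_R: "tensor_sum T R (\<lambda>a b. pure a (antipode H' b)) = r"
proof -
  let ?B = "opposite H'"
  interpret O: kalgebra_pair K H ?B
    by (rule kalgebra_pairI[OF H.kalgebra_axioms H'.kalgebra_opposite])
  \<comment> \<open>\<open>\<psi>\<close> is id \<otimes> S, an algebra map from H \<otimes> H' to H
    \<otimes> H'^op because S reverses products. It carries r R = 1 to an equation in the new
    algebra, where \<open>\<psi> R\<close> becomes a right inverse of
    \<open>\<psi> r\<close>.\<close>
  define \<psi> where "\<psi> = legs O.T O.inl (\<lambda>b. O.inr (antipode H' b))"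
  note g = algebra_homs_compose[OF O.inr_hom H'.antipode_hom]
  have "commuting O.T (O.inl ` carrier H) ((\<lambda>b. O.inr (antipode H' b)) ` carrier H')"
    using O.inl_inr_commuting by (auto simp: commuting_def)
  note \<psi>_hom = legs_hom[OF O.tensor_kalgebra O.inl_hom g this, folded \<psi>_def]
  note mult = O.tensor_mult_pure[simplified]
  have \<psi>: "\<psi> x = tensor_sum T x (\<lambda>a b. pure a (antipode H' b))"
    if "x \<in> carrier T" for x
    unfolding \<psi>_def legs_def using that
    by (auto simp: mult intro!: tensor_sum_cong)
  \<comment> \<open>The reversed product in the second factor is S(r_j') r_i', the order in which
    (id \<otimes> \<Delta>)(r) = r_13 r_12 produces S(b_1) b_2. So \<open>r\<close> is a left
    inverse of \<open>\<psi> r\<close>.\<close>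
  have "r \<otimes>\<^bsub>O.T\<^esub> \<psi> r = tensor_sum T r (\<lambda>ri ri'. tensor_sum T r (\<lambda>rj rj'.
      pure (ri \<otimes>\<^bsub>H\<^esub> rj) (antipode H' rj' \<otimes>\<^bsub>H'\<^esub> ri')))"
    using mult_sums(1)[OF O.tensor_kalgebra r_closed module_pair_axioms r_closed, of
      "pure_tensor K H H'"
        "\<lambda>a b. pure a (antipode H' b)"]
    by (simp add: \<psi> mult tensor_sum_pure_tensor cong: tensor_sum_cong)
  also have "\<dots> = tensor_sum T r (\<lambda>a b. tensor_sum T (comult H' b) (\<lambda>b1 b2.
      pure a (antipode H' b1 \<otimes>\<^bsub>H'\<^esub> b2)))"
    by (intro comult_right_apply[symmetric, OF tensor_kalgebra] linear_pure_left linear_pure_right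
        H'.linear_H linear_maps_id) auto
  also have "\<dots> = tensor_sum T r (\<lambda>a b. pure a (counit H' b \<odot>\<^bsub>H'\<^esub> \<one>\<^bsub>H'\<^esub>))"
    by (simp add: pure_sum_right[symmetric] H'.antipode_left cong: tensor_sum_cong)
  finally have rq: "r \<otimes>\<^bsub>O.T\<^esub> \<psi> r = \<one>\<^bsub>O.T\<^esub>"
    by (simp add: pure_counit_r_right[symmetric] counital_right)
  have qX: "\<psi> r \<otimes>\<^bsub>O.T\<^esub> \<psi> R = \<one>\<^bsub>O.T\<^esub>"
    using algebra_homsD(3)[OF \<psi>_hom r_closed R_closed] algebra_homsD(4)[OF \<psi>_hom]
    by (simp add: r_mult_R)
  have "\<psi> R = (r \<otimes>\<^bsub>O.T\<^esub> \<psi> r) \<otimes>\<^bsub>O.T\<^esub> \<psi> R"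
    using algebra_homsD(2)[OF \<psi>_hom] by (subst rq) (simp del: tensor_opposite(5))
  also have "\<dots> = r"
    using algebra_homsD(2)[OF \<psi>_hom]
    by (subst O.T.m_assoc) (simp_all add: qX del: tensor_opposite(5))
  finally show ?thesis by (simp add: \<psi>)
qed

context
  fixes M :: "('k, 'd, 'p) module_scheme" (structure) and F
  assumes M: "kalgebra K M" and F: "F \<in> bilinear_maps K H H' M"
begin

lemma sum_R: "tensor_sum M R F = tensor_sum M r (\<lambda>a b. F (antipode H a) b)"
proof -
  have "tensor_sum M R F = tensor_sum M r (\<lambda>a b. tensor_sum M (pure (antipode H a) b) F)"
    unfolding R_def
    by (rule tensor_sum_bind[OF kalgebra_module[OF M] F module_pair_axioms r_closed]) simp
  then show ?thesis
    by (simp add: tensor_sum_pure[OF kalgebra_module[OF M] F] cong: tensor_sum_cong)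
qed

lemma sum_R_antipode: "tensor_sum M R (\<lambda>a b. F a (antipode H' b)) = tensor_sum M r F"
proof -
  have "tensor_sum M r F =
      tensor_sum M R (\<lambda>a b. tensor_sum M (pure a (antipode H' b)) F)"
    by (subst tensor_sum_bind[OF kalgebra_module[OF M] F module_pair_axioms R_closed, symmetric])
      (simp_all add: antipode_right_R)
  then show ?thesis
    by (simp add: tensor_sum_pure[OF kalgebra_module[OF M] F] cong: tensor_sum_cong)
qed

end

lemma sum_r_antipode:
  assumes M: "kalgebra K M" and F: "F \<in> bilinear_maps K H H' M"
  shows "tensor_sum M r (\<lambda>a b. F (antipode H a) (antipode H' b)) = tensor_sum M r F"
proof -
  have "(\<lambda>a b. F a (antipode H' b)) \<in> bilinear_maps K H H' M"
    using bilinear_mapsD[OF F] linear_maps_compose[OF _ H'.antipode_linear]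
    by (intro bilinear_mapsI) auto
  from sum_R[OF M this] sum_R_antipode[OF M F] show ?thesis by simp
qed

end

section \<open>Quasitriangular Hopf algebras\<close>

context quasitriangular_hopf_algebra
begin

sublocale rr: bialgebra_copairing K H H r
  by (intro bialgebra_copairing.intro bialgebra_copairing_axioms.intro bialgebra_axioms
      r_closed comult_left comult_right)

sublocale rr: hopf_copairing K H H r
proof (intro hopf_copairing.intro hopf_copairing_axioms.intro rr.bialgebra_copairing_axioms
    hopf_algebra_axioms)
  show "pure_tensor K H H \<one>\<^bsub>H\<^esub> rr.counit_r_left = \<one>\<^bsub>HH.T\<^esub>"
    "pure_tensor K H H rr.counit_r_right \<one>\<^bsub>H\<^esub> = \<one>\<^bsub>HH.T\<^esub>"
    unfolding rr.counit_r_left_def rr.counit_r_right_def counit_r_left counit_r_right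
    by (simp_all add: HH.tensor_one)
qed

lemma almost_cocommutative_apply:
  assumes M: "kalgebra K M" and F: "F \<in> bilinear_maps K H H M" and h: "h \<in> carrier H"
  shows "tensor_sum M (comult H h) (\<lambda>h1 h2. tensor_sum M r (\<lambda>a b. F (h2 \<otimes>\<^bsub>H\<^esub> a) (h1 \<otimes>\<^bsub>H\<^esub> b))) =
    tensor_sum M r (\<lambda>a b. tensor_sum M (comult H h) (\<lambda>h1 h2. F (a \<otimes>\<^bsub>H\<^esub> h1) (b \<otimes>\<^bsub>H\<^esub> h2)))"
proof -
  interpret M: kalgebra K M by (rule M)
  note Fl = linear_maps_compose[OF bilinear_mapsD(1)[OF F]]
    linear_maps_compose[OF bilinear_mapsD(2)[OF F]]
  let ?D = "tensor_sum HH.T (comult H h) (\<lambda>h1 h2. pure_tensor K H H h2 h1)"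
  have D: "?D \<in> carrier HH.T"
    using h by (intro HH.tensor_sum_in HH.tensor_module) auto
  have G: "(\<lambda>x y. tensor_sum M r (\<lambda>a b. F (x \<otimes>\<^bsub>H\<^esub> a) (y \<otimes>\<^bsub>H\<^esub> b))) \<in> bilinear_maps K H H M"
    by (intro bilinear_mapsI HH.linear_tensor_sum_fun M.module_axioms r_closed Fl linear_H) auto
  have "tensor_sum M (?D \<otimes>\<^bsub>HH.T\<^esub> r) F =
      tensor_sum M ?D (\<lambda>x y. tensor_sum M r (\<lambda>a b. F (x \<otimes>\<^bsub>H\<^esub> a) (y \<otimes>\<^bsub>H\<^esub> b)))"
    by (rule HH.tensor_sum_mult[OF M.module_axioms F D r_closed])
  also have "\<dots> = tensor_sum M (comult H h) (\<lambda>h1 h2. tensor_sum M (pure_tensor K H H h2 h1)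
      (\<lambda>x y. tensor_sum M r (\<lambda>a b. F (x \<otimes>\<^bsub>H\<^esub> a) (y \<otimes>\<^bsub>H\<^esub> b))))"
    using h by (intro HH.tensor_sum_bind[OF M.module_axioms G HH.module_pair_axioms]) auto
  also have "\<dots> = tensor_sum M (comult H h) (\<lambda>h1 h2.
      tensor_sum M r (\<lambda>a b. F (h2 \<otimes>\<^bsub>H\<^esub> a) (h1 \<otimes>\<^bsub>H\<^esub> b)))"
    using h by (intro HH.tensor_sum_cong HH.tensor_sum_pure[OF M.module_axioms G]) auto
  finally show ?thesis
    using almost_cocommutative[OF h] h
    by (simp add: HH.tensor_sum_mult[OF M.module_axioms F r_closed])
qed

text \<open>The Drinfeld element \<open>u = S(r\<^sup>i) r\<^sub>i\<close> and its inverse \<open>v = r\<^sup>i S\<^sup>2(r\<^sub>i)\<close>; conjugation by \<open>u\<close> is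
  \<open>S\<^sup>2\<close>.\<close>

definition u :: 'a where "u = tensor_sum H r (\<lambda>a b. S b \<otimes>\<^bsub>H\<^esub> a)"

definition v :: 'a where "v = tensor_sum H r (\<lambda>a b. b \<otimes>\<^bsub>H\<^esub> S (S a))"

lemma u_closed [simp]: "u \<in> carrier H" and v_closed [simp]: "v \<in> carrier H"
  unfolding u_def v_def by (intro sum_in r_closed; simp)+

text \<open>Drinfeld's computation, with p = a \<otimes> b in place of \<open>r\<close>: insert
  \<epsilon>(h_2) as S(h_2 S(h_3)) to get u h = S^2(h_3) S(b h_2) a h_1. Almost cocommutativity
  turns this into S^2(h_3) S(h_1 b) h_2 a = S^2(h_3) S(b) S(h_1) h_2 a, and S(h_1) h_2
  collapses.\<close>

lemma u_mult:
  assumes h: "h \<in> carrier H"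
  shows "u \<otimes>\<^bsub>H\<^esub> h = S (S h) \<otimes>\<^bsub>H\<^esub> u"
proof -
  have F: "(\<lambda>a b. S (S c) \<otimes>\<^bsub>H\<^esub> S b \<otimes>\<^bsub>H\<^esub> a) \<in> bilinear_maps K H H H" if "c \<in> carrier H" for c
    using that by (intro bilinear_mapsI linear_H) auto
  have "u \<otimes>\<^bsub>H\<^esub> h = tensor_sum H r (\<lambda>a b. S b \<otimes>\<^bsub>H\<^esub> a \<otimes>\<^bsub>H\<^esub> h)"
    unfolding u_def using h by (simp add: sum_mult_right)
  also have "\<dots> = tensor_sum H r (\<lambda>a b. \<Delta> h (\<lambda>h1 h2.
      counit H h2 \<odot>\<^bsub>H\<^esub> (S b \<otimes>\<^bsub>H\<^esub> a \<otimes>\<^bsub>H\<^esub> h1)))"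
    using h by (intro HH.tensor_sum_cong counit_right_apply[OF kalgebra_axioms, symmetric] linear_H) auto
  also have "\<dots> = tensor_sum H r (\<lambda>a b. \<Delta> h (\<lambda>h1 h2.
      S (\<Delta> h2 (\<lambda>x y. x \<otimes>\<^bsub>H\<^esub> S y)) \<otimes>\<^bsub>H\<^esub> (S b \<otimes>\<^bsub>H\<^esub> a \<otimes>\<^bsub>H\<^esub> h1)))"
    using h by (intro HH.tensor_sum_cong)
      (simp_all add: antipode_right linear_mapsD(3)[OF antipode_linear] smult_mult_left)
  also have "\<dots> = tensor_sum H r (\<lambda>a b. \<Delta> h (\<lambda>h1 h2.
      \<Delta> h2 (\<lambda>x y. S (S y) \<otimes>\<^bsub>H\<^esub> S x \<otimes>\<^bsub>H\<^esub> (S b \<otimes>\<^bsub>H\<^esub> a \<otimes>\<^bsub>H\<^esub> h1))))"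
    using h by (intro HH.tensor_sum_cong)
      (simp_all add: HH.linear_tensor_sum[OF A.module_axioms A.module_axioms _ _ antipode_linear]
        antipode_mult sum_mult_right cong: HH.tensor_sum_cong)
  also have "\<dots> = tensor_sum H r (\<lambda>a b. \<Delta> h (\<lambda>h1 h2.
      \<Delta> h1 (\<lambda>x y. S (S h2) \<otimes>\<^bsub>H\<^esub> S y \<otimes>\<^bsub>H\<^esub> (S b \<otimes>\<^bsub>H\<^esub> a \<otimes>\<^bsub>H\<^esub> x))))"
    using h by (intro HH.tensor_sum_cong coassoc_apply[OF kalgebra_axioms, symmetric] linear_H) auto
  also have "\<dots> = \<Delta> h (\<lambda>h1 h2. tensor_sum H r (\<lambda>a b.
      \<Delta> h1 (\<lambda>x y. S (S h2) \<otimes>\<^bsub>H\<^esub> S y \<otimes>\<^bsub>H\<^esub> (S b \<otimes>\<^bsub>H\<^esub> a \<otimes>\<^bsub>H\<^esub> x))))"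
    using h by (intro sum_swap) (auto intro: sum_in)
  also have "\<dots> = \<Delta> h (\<lambda>h1 h2. tensor_sum H r (\<lambda>a b.
      \<Delta> h1 (\<lambda>x y. S (S h2) \<otimes>\<^bsub>H\<^esub> S (b \<otimes>\<^bsub>H\<^esub> y) \<otimes>\<^bsub>H\<^esub> (a \<otimes>\<^bsub>H\<^esub> x))))"
    using h by (intro HH.tensor_sum_cong) (simp_all add: antipode_mult A.m_assoc)
  also have "\<dots> = \<Delta> h (\<lambda>h1 h2. \<Delta> h1 (\<lambda>x y.
      tensor_sum H r (\<lambda>a b. S (S h2) \<otimes>\<^bsub>H\<^esub> S (x \<otimes>\<^bsub>H\<^esub> b) \<otimes>\<^bsub>H\<^esub> (y \<otimes>\<^bsub>H\<^esub> a))))"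
    using h by (intro HH.tensor_sum_cong almost_cocommutative_apply[OF kalgebra_axioms F, symmetric]) auto
  also have "\<dots> = \<Delta> h (\<lambda>h1 h2. tensor_sum H r (\<lambda>a b.
      \<Delta> h1 (\<lambda>x y. S (S h2) \<otimes>\<^bsub>H\<^esub> S (x \<otimes>\<^bsub>H\<^esub> b) \<otimes>\<^bsub>H\<^esub> (y \<otimes>\<^bsub>H\<^esub> a))))"
    using h by (intro HH.tensor_sum_cong sum_swap) auto
  also have "\<dots> = \<Delta> h (\<lambda>h1 h2. tensor_sum H r (\<lambda>a b.
      S (S h2) \<otimes>\<^bsub>H\<^esub> S b \<otimes>\<^bsub>H\<^esub> \<Delta> h1 (\<lambda>x y. S x \<otimes>\<^bsub>H\<^esub> y) \<otimes>\<^bsub>H\<^esub> a))"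
    using h by (intro HH.tensor_sum_cong)
      (simp_all add: sum_mult_left sum_mult_right sum_in antipode_mult A.m_assoc cong: HH.tensor_sum_cong)
  also have "\<dots> = \<Delta> h (\<lambda>h1 h2. tensor_sum H r (\<lambda>a b.
      counit H h1 \<odot>\<^bsub>H\<^esub> (S (S h2) \<otimes>\<^bsub>H\<^esub> S b \<otimes>\<^bsub>H\<^esub> a)))"
    using h by (intro HH.tensor_sum_cong) (simp_all add: antipode_left smult_mult_left smult_mult_right)
  also have "\<dots> = \<Delta> h (\<lambda>h1 h2. counit H h1 \<odot>\<^bsub>H\<^esub> (S (S h2) \<otimes>\<^bsub>H\<^esub> u))"
    unfolding u_def using h
    by (intro HH.tensor_sum_cong) (simp_all add: sum_mult_left sum_smult A.m_assoc cong: HH.tensor_sum_cong)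
  also have "\<dots> = S (S h) \<otimes>\<^bsub>H\<^esub> u"
    using h by (intro counit_left_apply[OF kalgebra_axioms] linear_H) auto
  finally show ?thesis .
qed

text \<open>Moving \<open>u\<close> to the right past b gives the sum of S^2(b) u S^2(a). Invariance
  of r under S \<otimes> S removes one antipode on either side; what remains is the map x \<otimes>
  y \<mapsto> S(y) x evaluated at r r^-1 = 1.\<close>

lemma u_mult_v: "u \<otimes>\<^bsub>H\<^esub> v = \<one>\<^bsub>H\<^esub>"
proof -
  let ?F = "\<lambda>a b. tensor_sum H r (\<lambda>c d. S b \<otimes>\<^bsub>H\<^esub> (S d \<otimes>\<^bsub>H\<^esub> c) \<otimes>\<^bsub>H\<^esub> S a)"
  have F: "?F \<in> bilinear_maps K H H H"
    by (intro bilinear_mapsI HH.linear_tensor_sum_fun A.module_axioms r_closed linear_H) auto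
  have G: "(\<lambda>x y. S y \<otimes>\<^bsub>H\<^esub> x) \<in> bilinear_maps K H H H"
    by (intro bilinear_mapsI linear_H) auto
  have GF: "(\<lambda>a b. tensor_sum H r (\<lambda>c d. S (d \<otimes>\<^bsub>H\<^esub> b) \<otimes>\<^bsub>H\<^esub> (c \<otimes>\<^bsub>H\<^esub> a))) \<in> bilinear_maps K H H H"
    by (intro bilinear_mapsI HH.linear_tensor_sum_fun A.module_axioms r_closed linear_H) auto
  have "u \<otimes>\<^bsub>H\<^esub> v = tensor_sum H r (\<lambda>a b. S (S b) \<otimes>\<^bsub>H\<^esub> u \<otimes>\<^bsub>H\<^esub> S (S a))"
    unfolding v_def
    by (simp add: sum_mult_left A.m_assoc[symmetric] u_mult r_closed cong: HH.tensor_sum_cong)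
  also have "\<dots> = tensor_sum H r (\<lambda>a b. ?F (S a) (S b))"
    unfolding u_def
    by (intro HH.tensor_sum_cong r_closed)
      (simp_all add: sum_mult_left sum_mult_right sum_in r_closed cong: HH.tensor_sum_cong)
  also have "\<dots> = tensor_sum H r ?F"
    by (rule rr.sum_r_antipode[OF kalgebra_axioms F])
  also have "\<dots> = tensor_sum H r (\<lambda>a b. tensor_sum H r (\<lambda>c d. S (d \<otimes>\<^bsub>H\<^esub> b) \<otimes>\<^bsub>H\<^esub> (c \<otimes>\<^bsub>H\<^esub> S a)))"
    by (intro HH.tensor_sum_cong r_closed) (simp_all add: antipode_mult A.m_assoc)
  also have "\<dots> = tensor_sum H rr.R (\<lambda>a b. tensor_sum H r (\<lambda>c d. S (d \<otimes>\<^bsub>H\<^esub> b) \<otimes>\<^bsub>H\<^esub> (c \<otimes>\<^bsub>H\<^esub> a)))"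
    by (rule rr.sum_R[OF kalgebra_axioms GF, symmetric])
  also have "\<dots> = tensor_sum H r (\<lambda>c d. tensor_sum H rr.R (\<lambda>a b. S (d \<otimes>\<^bsub>H\<^esub> b) \<otimes>\<^bsub>H\<^esub> (c \<otimes>\<^bsub>H\<^esub> a)))"
    by (intro sum_swap rr.R_closed r_closed) auto
  also have "\<dots> = tensor_sum H (r \<otimes>\<^bsub>HH.T\<^esub> rr.R) (\<lambda>x y. S y \<otimes>\<^bsub>H\<^esub> x)"
    by (rule HH.tensor_sum_mult[OF A.module_axioms G r_closed rr.R_closed, symmetric])
  also have "\<dots> = \<one>\<^bsub>H\<^esub>"
    by (simp add: rr.r_mult_R HH.tensor_one HH.tensor_sum_pure[OF A.module_axioms G])
  finally show ?thesis .
qed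

text \<open>Moving S^2(a) past \<open>u\<close> gives the sum of b u a, that is of b S(d) c a over
  two copies of r. By (id \<otimes> \<Delta>)(r) = r_13 r_12 this is the sum of b_1 S(b_2) a, hence
  of \<epsilon>(b) a.\<close>

lemma v_mult_u: "v \<otimes>\<^bsub>H\<^esub> u = \<one>\<^bsub>H\<^esub>"
proof -
  have "v \<otimes>\<^bsub>H\<^esub> u = tensor_sum H r (\<lambda>a b. b \<otimes>\<^bsub>H\<^esub> u \<otimes>\<^bsub>H\<^esub> a)"
    unfolding v_def
    by (simp add: sum_mult_right A.m_assoc u_mult[symmetric] r_closed cong: HH.tensor_sum_cong)
  also have "\<dots> = tensor_sum H r (\<lambda>a b. tensor_sum H r (\<lambda>c d. b \<otimes>\<^bsub>H\<^esub> S d \<otimes>\<^bsub>H\<^esub> (c \<otimes>\<^bsub>H\<^esub> a)))"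
    unfolding u_def
    by (intro HH.tensor_sum_cong r_closed)
      (simp_all add: sum_mult_left sum_mult_right sum_in r_closed A.m_assoc cong: HH.tensor_sum_cong)
  also have "\<dots> = tensor_sum H r (\<lambda>c d. tensor_sum H r (\<lambda>a b. b \<otimes>\<^bsub>H\<^esub> S d \<otimes>\<^bsub>H\<^esub> (c \<otimes>\<^bsub>H\<^esub> a)))"
    by (intro sum_swap r_closed) auto
  also have "\<dots> = tensor_sum H r (\<lambda>a b. \<Delta> b (\<lambda>b1 b2. b1 \<otimes>\<^bsub>H\<^esub> S b2 \<otimes>\<^bsub>H\<^esub> a))"
    by (intro rr.comult_right_apply[OF kalgebra_axioms, symmetric] linear_H) auto
  also have "\<dots> = tensor_sum H r (\<lambda>a b. counit H b \<odot>\<^bsub>H\<^esub> a)"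
    by (intro HH.tensor_sum_cong r_closed)
      (simp add: sum_mult_right[symmetric] antipode_right smult_mult_left)
  finally show ?thesis by (simp add: counit_r_right)
qed

lemma antipode_bij: "bij_betw S (carrier H) (carrier H)"
proof (rule bij_betw_imageI)
  show "inj_on S (carrier H)"
  proof (rule inj_onI)
    fix x y assume xy: "x \<in> carrier H" "y \<in> carrier H" "S x = S y"
    then have "v \<otimes>\<^bsub>H\<^esub> (u \<otimes>\<^bsub>H\<^esub> x) = v \<otimes>\<^bsub>H\<^esub> (u \<otimes>\<^bsub>H\<^esub> y)" by (simp add: u_mult)
    then show "x = y" using xy by (simp add: A.m_assoc[symmetric] v_mult_u)
  qed
  \<comment> \<open>Since S^2 is conjugation by u with inverse v, the element v x u is a preimage of
    x under S^2, and its antipode is one under S.\<close>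
  have "x = S (S (v \<otimes>\<^bsub>H\<^esub> x \<otimes>\<^bsub>H\<^esub> u))" if x: "x \<in> carrier H" for x
  proof -
    have "S (S (v \<otimes>\<^bsub>H\<^esub> x \<otimes>\<^bsub>H\<^esub> u)) = S (S (v \<otimes>\<^bsub>H\<^esub> x \<otimes>\<^bsub>H\<^esub> u)) \<otimes>\<^bsub>H\<^esub> (u \<otimes>\<^bsub>H\<^esub> v)"
      using x by (simp add: u_mult_v)
    also have "\<dots> = S (S (v \<otimes>\<^bsub>H\<^esub> x \<otimes>\<^bsub>H\<^esub> u)) \<otimes>\<^bsub>H\<^esub> u \<otimes>\<^bsub>H\<^esub> v"
      using x by (simp only: A.m_assoc u_closed v_closed antipode_closed A.m_closed)
    also have "\<dots> = u \<otimes>\<^bsub>H\<^esub> (v \<otimes>\<^bsub>H\<^esub> x \<otimes>\<^bsub>H\<^esub> u) \<otimes>\<^bsub>H\<^esub> v"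
      using x by (simp only: u_mult u_closed v_closed A.m_closed)
    also have "\<dots> = (u \<otimes>\<^bsub>H\<^esub> v) \<otimes>\<^bsub>H\<^esub> x \<otimes>\<^bsub>H\<^esub> (u \<otimes>\<^bsub>H\<^esub> v)"
      using x by (simp add: A.m_assoc)
    finally show ?thesis using x by (simp add: u_mult_v)
  qed
  then show "S ` carrier H = carrier H" by (auto intro!: image_eqI)
qed

section \<open>The inverse of the antipode\<close>

definition \<sigma> :: "'a \<Rightarrow> 'a" where "\<sigma> = inv_into (carrier H) S"

lemma
  assumes "x \<in> carrier H"
  shows \<sigma>_closed [simp]: "\<sigma> x \<in> carrier H"
    and antipode_\<sigma> [simp]: "S (\<sigma> x) = x" and \<sigma>_antipode [simp]: "\<sigma> (S x) = x"
  using assms antipode_bij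
  by (auto simp: \<sigma>_def bij_betw_def inv_into_into f_inv_into_f)

lemma \<sigma>_hom: "\<sigma> \<in> algebra_homs K H (opposite H)"
proof -
  have inj: "x = y" if "S x = S y" "x \<in> carrier H" "y \<in> carrier H" for x y
    using that \<sigma>_antipode by metis
  show ?thesis
    by (intro algebra_homsI linear_mapsI; (rule inj)?)
      (simp_all add: linear_mapsD[OF antipode_linear] antipode_mult)
qed

lemma \<sigma>_linear: "\<sigma> \<in> linear_maps K H H"
  using algebra_homsD(1)[OF \<sigma>_hom] by simp

lemma inverse_square_antipode: "x \<in> carrier H \<Longrightarrow> inverse_square H S x = \<sigma> (\<sigma> x)"
  by (simp add: inverse_square_def \<sigma>_def)

lemma inverse_square_hom: "inverse_square H S \<in> algebra_homs K H H"
  using algebra_homsD(2-)[OF \<sigma>_hom]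
  by (intro algebra_homsI linear_mapsI)
    (simp_all add: inverse_square_antipode linear_mapsD[OF \<sigma>_linear])

section \<open>Mixed Yang--Baxter equations from almost cocommutativity\<close>

lemma r_mult_comult:
  fixes M (structure)
  assumes M: "kalgebra K M" and h: "h \<in> carrier H"
    and f: "f \<in> algebra_homs K H M" and g: "g \<in> algebra_homs K H M"
    and fg: "commuting M (f ` carrier H) (g ` carrier H)"
  shows "legs M f g r \<otimes> legs M f g (comult H h) = legs M g f (comult H h) \<otimes> legs M f g r"
proof -
  interpret M: kalgebra K M by (rule M)
  note cl [simp] = algebra_homsD(2)[OF f] algebra_homsD(2)[OF g]
  have fgb: "(\<lambda>x y. f x \<otimes> g y) \<in> bilinear_maps K H H M"
    by (rule HH.legs_bilinear[OF M algebra_homsD(1)[OF f] algebra_homsD(1)[OF g]])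
  let ?D = "tensor_sum HH.T (comult H h) (\<lambda>h1 h2. pure_tensor K H H h2 h1)"
  have D: "?D \<in> carrier HH.T"
    using h by (intro HH.tensor_sum_in HH.tensor_module) auto
  \<comment> \<open>Flipping the tensor agrees with exchanging the legs, because the images of
    \<open>f\<close> and \<open>g\<close> commute.\<close>
  have "legs M f g ?D = tensor_sum M (comult H h) (\<lambda>x y. f y \<otimes> g x)"
    unfolding legs_def using h
    by (subst HH.tensor_sum_bind[OF M.module_axioms fgb HH.module_pair_axioms])
      (auto simp: HH.tensor_sum_pure[OF M.module_axioms fgb] intro!: HH.tensor_sum_cong)
  also have "\<dots> = legs M g f (comult H h)"
    unfolding legs_def using h fg by (intro HH.tensor_sum_cong) (auto simp: commuting_def)
  finally show ?thesis
    using HH.legs_mult[OF M f g fg D r_closed] HH.legs_mult[OF M f g fg r_closed comult_closed[OF h]]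
    by (simp add: almost_cocommutative[OF h])
qed

text \<open>The product s_13 s_23 is (\<Delta> \<otimes> id)(s), and s_23 s_13 is the same with the
  flipped coproduct. So r_12 s_13 s_23 = s_23 s_13 r_12 is almost cocommutativity in the first
  factor of s, given that k b commutes with r_12.\<close>

lemma yang_baxter_left:
  fixes M (structure)
  assumes s: "bialgebra_copairing K H H' s" and M: "kalgebra K M"
    and f: "f \<in> algebra_homs K H M" and g: "g \<in> algebra_homs K H M" and k: "k \<in> algebra_homs K H' M"
    and fg: "commuting M (f ` carrier H) (g ` carrier H)"
    and fk: "commuting M (f ` carrier H) (k ` carrier H')"
    and gk: "commuting M (g ` carrier H) (k ` carrier H')"
  shows "legs M f g r \<otimes> legs M f k s \<otimes> legs M g k s =
    legs M g k s \<otimes> legs M f k s \<otimes> legs M f g r"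
proof -
  interpret s: bialgebra_copairing K H H' s by (rule s)
  interpret M: kalgebra K M by (rule M)
  note cl [simp] = algebra_homsD(2)[OF f] algebra_homsD(2)[OF g] algebra_homsD(2)[OF k]
  have kM: "k ` carrier H' \<subseteq> carrier M" by auto
  let ?p = "legs M f g r"
  have p [simp]: "?p \<in> carrier M" by (rule HH.legs_closed[OF M r_closed]) auto
  note ml = s.mult_tensor_sum[OF M s.r_closed] and mr = s.tensor_sum_mult_const[OF M s.r_closed]
  \<comment> \<open>Stated for a general pair of legs, since it is used once with (f, g) and once
    with (g, f).\<close>
  have prod: "legs M f' k s \<otimes> legs M g' k s =
      tensor_sum M s (\<lambda>a b. legs M f' g' (comult H a) \<otimes> k b)"
    if f': "f' \<in> algebra_homs K H M" and g': "g' \<in> algebra_homs K H M"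
      and g'k: "commuting M (g' ` carrier H) (k ` carrier H')" for f' g'
  proof -
    note cl' [simp] = algebra_homsD(2)[OF f'] algebra_homsD(2)[OF g']
    have "legs M f' k s \<otimes> legs M g' k s =
        tensor_sum M s (\<lambda>a b. tensor_sum M s (\<lambda>c d.
        f' a \<otimes> k b \<otimes> (g' c \<otimes> k d)))"
      unfolding legs_def
      by (rule s.mult_sums(1)[OF M s.r_closed s.module_pair_axioms s.r_closed]) simp_all
    also have "\<dots> = tensor_sum M s (\<lambda>a b. tensor_sum M s (\<lambda>c d.
        f' a \<otimes> g' c \<otimes> k (b \<otimes>\<^bsub>H'\<^esub> d)))"
    proof (intro s.tensor_sum_cong s.r_closed)
      fix a b c d assume abcd: "a \<in> carrier H" "b \<in> carrier H'" "c \<in> carrier H" "d \<in> carrier H'"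
      have "k b \<otimes> g' c = g' c \<otimes> k b"
        using g'k abcd by (simp add: commuting_def)
      then have "k b \<otimes> (g' c \<otimes> k d) = g' c \<otimes> k b \<otimes> k d"
        using abcd by (simp add: M.m_assoc[symmetric])
      then show "f' a \<otimes> k b \<otimes> (g' c \<otimes> k d) = f' a \<otimes> g' c \<otimes> k (b \<otimes>\<^bsub>H'\<^esub> d)"
        using abcd by (simp add: M.m_assoc algebra_homsD(3)[OF k])
    qed
    also have "\<dots> = tensor_sum M s (\<lambda>a b. tensor_sum M (comult H a) (\<lambda>x y. f' x \<otimes> g' y \<otimes> k b))"
      by (intro s.comult_left_apply[OF M, symmetric] M.linear_mult_left M.linear_mult_right
          algebra_homsD(1)[OF f'] algebra_homsD(1)[OF g'] algebra_homsD(1)[OF k]) auto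
    also have "\<dots> = tensor_sum M s (\<lambda>a b. legs M f' g' (comult H a) \<otimes> k b)"
      unfolding legs_def
      by (intro s.tensor_sum_cong s.r_closed HH.tensor_sum_mult_const[symmetric, OF M]) auto
    finally show ?thesis .
  qed
  have key: "?p \<otimes> (legs M f g (comult H a) \<otimes> k b) =
      legs M g f (comult H a) \<otimes> k b \<otimes> ?p"
    and [simp]: "legs M f g (comult H a) \<in> carrier M" "legs M g f (comult H a) \<in> carrier M"
    if ab: "a \<in> carrier H" "b \<in> carrier H'" for a b
  proof -
    show c [simp]: "legs M f g (comult H a) \<in> carrier M" "legs M g f (comult H a) \<in> carrier M"
      using ab by (auto intro!: HH.legs_closed[OF M])
    have "k b \<otimes> ?p = ?p \<otimes> k b"
      using HH.commuting_legs[OF M r_closed kM, of f g] fk gk ab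
      by (auto simp: commuting_def)
    then show "?p \<otimes> (legs M f g (comult H a) \<otimes> k b) =
        legs M g f (comult H a) \<otimes> k b \<otimes> ?p"
      using ab r_mult_comult[OF M ab(1) f g fg]
      by (simp add: M.m_assoc[symmetric], (simp add: M.m_assoc)?)
  qed
  have "?p \<otimes> (legs M f k s \<otimes> legs M g k s) =
      tensor_sum M s (\<lambda>a b. ?p \<otimes> (legs M f g (comult H a) \<otimes> k b))"
    by (subst prod[OF f g gk]) (auto intro!: ml HH.legs_closed[OF M])
  also have "\<dots> = tensor_sum M s (\<lambda>a b. legs M g f (comult H a) \<otimes> k b \<otimes> ?p)"
    by (intro s.tensor_sum_cong s.r_closed key)
  also have "\<dots> = legs M g k s \<otimes> legs M f k s \<otimes> ?p"
    by (subst prod[OF g f fk]) (auto intro!: mr[symmetric] HH.legs_closed[OF M])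
  finally show ?thesis
    by (subst M.m_assoc) (auto intro!: s.legs_closed[OF M])
qed

text \<open>The mirror image, with the coproduct in the second factor of s. As (id \<otimes>
  \<Delta>)(s) = s_13 s_12 reverses the order, fact \<open>prod\<close> lists g' before f' on its
  left side and uses that these two legs commute.\<close>

lemma yang_baxter_right:
  fixes M (structure)
  assumes s: "bialgebra_copairing K H' H s" and M: "kalgebra K M"
    and k: "k \<in> algebra_homs K H' M" and f: "f \<in> algebra_homs K H M" and g: "g \<in> algebra_homs K H M"
    and fg: "commuting M (f ` carrier H) (g ` carrier H)"
    and fk: "commuting M (f ` carrier H) (k ` carrier H')"
    and gk: "commuting M (g ` carrier H) (k ` carrier H')"
  shows "legs M k f s \<otimes> legs M k g s \<otimes> legs M f g r =
    legs M f g r \<otimes> legs M k g s \<otimes> legs M k f s"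
proof -
  interpret s: bialgebra_copairing K H' H s by (rule s)
  interpret M: kalgebra K M by (rule M)
  note cl [simp] = algebra_homsD(2)[OF f] algebra_homsD(2)[OF g] algebra_homsD(2)[OF k]
  have kM: "k ` carrier H' \<subseteq> carrier M" by auto
  let ?p = "legs M f g r"
  have p [simp]: "?p \<in> carrier M" by (rule HH.legs_closed[OF M r_closed]) auto
  note ml = s.mult_tensor_sum[OF M s.r_closed] and mr = s.tensor_sum_mult_const[OF M s.r_closed]
  have prod: "legs M k g' s \<otimes> legs M k f' s =
      tensor_sum M s (\<lambda>a b. k a \<otimes> legs M f' g' (comult H b))"
    if f': "f' \<in> algebra_homs K H M" and g': "g' \<in> algebra_homs K H M"
      and f'g': "commuting M (f' ` carrier H) (g' ` carrier H)"
      and g'k: "commuting M (g' ` carrier H) (k ` carrier H')" for f' g'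
  proof -
    note cl' [simp] = algebra_homsD(2)[OF f'] algebra_homsD(2)[OF g']
    have "legs M k g' s \<otimes> legs M k f' s =
        tensor_sum M s (\<lambda>a b. tensor_sum M s (\<lambda>c d.
        k a \<otimes> g' b \<otimes> (k c \<otimes> f' d)))"
      unfolding legs_def
      by (rule s.mult_sums(1)[OF M s.r_closed s.module_pair_axioms s.r_closed]) simp_all
    also have "\<dots> = tensor_sum M s (\<lambda>a b. tensor_sum M s (\<lambda>c d.
        k (a \<otimes>\<^bsub>H'\<^esub> c) \<otimes> (f' d \<otimes> g' b)))"
    proof (intro s.tensor_sum_cong s.r_closed)
      fix a b c d assume abcd: "a \<in> carrier H'" "b \<in> carrier H" "c \<in> carrier H'" "d \<in> carrier H"
      have *: "g' b \<otimes> k c = k c \<otimes> g' b" "f' d \<otimes> g' b = g' b \<otimes> f' d"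
        using g'k f'g' abcd by (auto simp: commuting_def)
      have "g' b \<otimes> (k c \<otimes> f' d) = k c \<otimes> (f' d \<otimes> g' b)"
        using abcd * by (simp add: M.m_assoc[symmetric])
      then show "k a \<otimes> g' b \<otimes> (k c \<otimes> f' d) = k (a \<otimes>\<^bsub>H'\<^esub> c) \<otimes> (f' d \<otimes> g' b)"
        using abcd by (simp add: M.m_assoc algebra_homsD(3)[OF k])
    qed
    also have "\<dots> = tensor_sum M s (\<lambda>a b. tensor_sum M (comult H b) (\<lambda>x y. k a \<otimes> (f' x \<otimes> g' y)))"
      by (intro s.comult_right_apply[OF M, symmetric] M.linear_mult_left M.linear_mult_right
          algebra_homsD(1)[OF f'] algebra_homsD(1)[OF g'] algebra_homsD(1)[OF k]) auto
    also have "\<dots> = tensor_sum M s (\<lambda>a b. k a \<otimes> legs M f' g' (comult H b))"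
      unfolding legs_def
      by (intro s.tensor_sum_cong s.r_closed HH.mult_tensor_sum[symmetric, OF M]) auto
    finally show ?thesis .
  qed
  have key: "?p \<otimes> (k a \<otimes> legs M f g (comult H b)) =
      k a \<otimes> legs M g f (comult H b) \<otimes> ?p"
    if ab: "a \<in> carrier H'" "b \<in> carrier H" for a b
  proof -
    have c [simp]: "legs M f g (comult H b) \<in> carrier M" "legs M g f (comult H b) \<in> carrier M"
      using ab by (auto intro!: HH.legs_closed[OF M])
    have "?p \<otimes> k a = k a \<otimes> ?p"
      using HH.commuting_legs[OF M r_closed kM, of f g] fk gk ab
      by (auto simp: commuting_def)
    then show ?thesis
      using ab r_mult_comult[OF M ab(2) f g fg]
      by (simp add: M.m_assoc[symmetric], (simp add: M.m_assoc)?)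
  qed
  have "?p \<otimes> (legs M k g s \<otimes> legs M k f s) =
      tensor_sum M s (\<lambda>a b. ?p \<otimes> (k a \<otimes> legs M f g (comult H b)))"
    by (subst prod[OF f g fg gk]) (auto intro!: ml HH.legs_closed[OF M])
  also have "\<dots> = tensor_sum M s (\<lambda>a b. k a \<otimes> legs M g f (comult H b) \<otimes> ?p)"
    by (intro s.tensor_sum_cong s.r_closed key)
  also have "\<dots> = legs M k f s \<otimes> legs M k g s \<otimes> ?p"
    by (subst prod[OF g f commuting_sym[OF fg] fk]) (auto intro!: mr[symmetric] HH.legs_closed[OF M])
  finally show ?thesis
    by (subst (2) M.m_assoc) (auto intro!: s.legs_closed[OF M])
qed

end

section \<open>Tensor products of algebra maps, and calculus of legs\<close>

lemma (in kalgebra_pair) tensor_map_legs: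
  assumes CD: "kalgebra_pair K C D" and x: "x \<in> carrier T"
    and f: "\<And>a. a \<in> carrier A \<Longrightarrow> f a \<in> carrier C" and g: "\<And>b. b \<in> carrier B \<Longrightarrow> g b \<in> carrier D"
  shows "tensor_map K A B C D f g x =
    legs (tensor_algebra K C D) (\<lambda>a. pure_tensor K C D (f a) \<one>\<^bsub>D\<^esub>) (\<lambda>b. pure_tensor K C D \<one>\<^bsub>C\<^esub> (g b)) x"
proof -
  interpret CD: kalgebra_pair K C D by fact
  show ?thesis
    unfolding tensor_map_def legs_def using x
    by (auto intro!: tensor_sum_cong simp: f g)
qed

lemma (in kalgebra_pair) tensor_map_hom:
  assumes CD: "kalgebra_pair K C D"
    and f: "f \<in> algebra_homs K A C" and g: "g \<in> algebra_homs K B D"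
  shows "tensor_map K A B C D f g \<in> algebra_homs K T (tensor_algebra K C D)"
    and "a \<in> carrier A \<Longrightarrow> b \<in> carrier B
      \<Longrightarrow> tensor_map K A B C D f g (pure_tensor K A B a b) = pure_tensor K C D (f a) (g b)"
proof -
  interpret CD: kalgebra_pair K C D by fact
  note f' = algebra_homs_compose[OF CD.inl_hom f] and g' = algebra_homs_compose[OF CD.inr_hom g]
  note fg = tensor_map_legs[OF CD _ algebra_homsD(2)[OF f] algebra_homsD(2)[OF g]]
  have "legs CD.T (\<lambda>a. CD.inl (f a)) (\<lambda>b. CD.inr (g b)) \<in> algebra_homs K T CD.T"
    using algebra_homsD(2)[OF f] algebra_homsD(2)[OF g]
    by (intro legs_hom[OF CD.tensor_kalgebra f' g']) (auto simp: commuting_def)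
  then show "tensor_map K A B C D f g \<in> algebra_homs K T CD.T"
    by (intro algebra_homsI linear_mapsI)
      (simp_all add: fg algebra_homsD linear_mapsD[OF algebra_homsD(1)] tensor_smult_closed)
  show "tensor_map K A B C D f g (pure_tensor K A B a b) = pure_tensor K C D (f a) (g b)"
    if "a \<in> carrier A" "b \<in> carrier B"
    using that algebra_homsD(2)[OF f] algebra_homsD(2)[OF g]
    by (simp add: fg legs_pure[OF CD.tensor_kalgebra algebra_homsD(1)[OF f'] algebra_homsD(1)[OF g']])
qed

lemma (in kalgebra_pair) legs_inverse:
  fixes M (structure)
  assumes M: "kalgebra K M"
    and f: "f \<in> algebra_homs K A M" and g: "g \<in> algebra_homs K B M"
    and c: "commuting M (f ` carrier A) (g ` carrier B)"
    and x: "x \<in> carrier T" and y: "y \<in> carrier T" and xy: "x \<otimes>\<^bsub>T\<^esub> y = \<one>\<^bsub>T\<^esub>"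
  shows "legs M f g x \<otimes> legs M f g y = \<one>"
  using legs_mult[OF M f g c x y] algebra_homsD(4)[OF legs_hom[OF M f g c]] by (simp add: xy)

lemma legs_cong:
  assumes "module_pair K A B" "x \<in> carrier (tensor_algebra K A B)"
    and "\<And>a. a \<in> carrier A \<Longrightarrow> f a = f' a" "\<And>b. b \<in> carrier B \<Longrightarrow> g b = g' b"
  shows "legs M f g x = legs M f' g' x"
  unfolding legs_def using assms by (intro module_pair.tensor_sum_cong) auto

text \<open>Crossings without a common strand commute. Each leg of x commutes with both legs of y,
  hence with the second element as a whole; so that element commutes with both legs of x, hence with
  the first.\<close>

lemma legs_commute:
  fixes M (structure)
  assumes x: "x \<in> carrier (tensor_algebra K A B)" and y: "y \<in> carrier (tensor_algebra K C D)"
    and M: "kalgebra K M" and AB: "kalgebra_pair K A B" and CD: "kalgebra_pair K C D"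
    and cl: "f \<in> carrier A \<rightarrow> carrier M" "g \<in> carrier B \<rightarrow> carrier M"
      "f' \<in> carrier C \<rightarrow> carrier M" "g' \<in> carrier D \<rightarrow> carrier M"
    and c: "commuting M (f ` carrier A) (f' ` carrier C)" "commuting M (f ` carrier A) (g' ` carrier D)"
      "commuting M (g ` carrier B) (f' ` carrier C)" "commuting M (g ` carrier B) (g' ` carrier D)"
  shows "legs M f g x \<otimes> legs M f' g' y = legs M f' g' y \<otimes> legs M f g x"
proof -
  interpret AB: kalgebra_pair K A B by fact
  interpret CD: kalgebra_pair K C D by fact
  have y': "{legs M f' g' y} \<subseteq> carrier M"
    using CD.legs_closed[OF M y cl(3,4)] by simp
  have fy: "commuting M (f ` carrier A) {legs M f' g' y}"
    using cl c by (intro CD.commuting_legs[OF M y]) auto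
  have gy: "commuting M (g ` carrier B) {legs M f' g' y}"
    using cl c by (intro CD.commuting_legs[OF M y]) auto
  show ?thesis
    using AB.commuting_legs[OF M x y' cl(1,2) commuting_sym[OF fy] commuting_sym[OF gy]]
    by (simp add: commuting_def)
qed

section \<open>Antipodes and inverse legs\<close>

context hopf_copairing
begin

context
  fixes M :: "('k, 'd, 'p) module_scheme" (structure) and \<sigma> :: "'a \<Rightarrow> 'a" and \<sigma>' :: "'b \<Rightarrow> 'b"
  assumes M: "kalgebra K M"
    and \<sigma>: "\<sigma> \<in> algebra_homs K H (opposite H)" "\<And>x. x \<in> carrier H \<Longrightarrow> \<sigma> (antipode H x) = x"
      "\<And>x. x \<in> carrier H \<Longrightarrow> antipode H (\<sigma> x) = x"
    and \<sigma>': "\<sigma>' \<in> algebra_homs K H' (opposite H')" "\<And>x. x \<in> carrier H' \<Longrightarrow> \<sigma>' (antipode H' x) = x"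
begin

interpretation M: kalgebra K M by (rule M)

lemma \<sigma>_linear_maps: "\<sigma> \<in> linear_maps K H H" "\<sigma>' \<in> linear_maps K H' H'"
  using algebra_homsD(1)[OF \<sigma>(1)] algebra_homsD(1)[OF \<sigma>'(1)] by simp_all

lemma \<sigma>_in [simp]:
  "x \<in> carrier H \<Longrightarrow> \<sigma> x \<in> carrier H" "y \<in> carrier H' \<Longrightarrow> \<sigma>' y \<in> carrier H'"
  using \<sigma>_linear_maps by (auto dest: linear_mapsD)

text \<open>S \<otimes> S fixes r, hence so does its inverse. The inverse antipodes enter as maps
  \<open>\<sigma>\<close>, \<open>\<sigma>'\<close> with the inversion laws, because a copairing of
  Hopf algebras does not by itself make the antipodes bijective.\<close>

lemma sum_r_\<sigma>:
  assumes F: "F \<in> bilinear_maps K H H' M"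
  shows "tensor_sum M r (\<lambda>a b. F (\<sigma> a) (\<sigma>' b)) = tensor_sum M r F"
proof -
  have "(\<lambda>a b. F (\<sigma> a) (\<sigma>' b)) \<in> bilinear_maps K H H' M"
    by (intro bilinear_mapsI linear_maps_compose[OF bilinear_mapsD(1)[OF F]]
        linear_maps_compose[OF bilinear_mapsD(2)[OF F]] \<sigma>_linear_maps \<sigma>_in)
  from sum_r_antipode[OF M this] show ?thesis
    by (simp add: \<sigma> \<sigma>' cong: tensor_sum_cong)
qed

lemma sum_R_\<sigma>:
  assumes F: "F \<in> bilinear_maps K H H' M"
  shows "tensor_sum M R (\<lambda>a b. F (\<sigma> a) (\<sigma>' b)) = tensor_sum M R F"
proof -
  have F1: "(\<lambda>a b. F (\<sigma> a) (\<sigma>' b)) \<in> bilinear_maps K H H' M"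
    by (intro bilinear_mapsI linear_maps_compose[OF bilinear_mapsD(1)[OF F]]
        linear_maps_compose[OF bilinear_mapsD(2)[OF F]] \<sigma>_linear_maps \<sigma>_in)
  have F2: "(\<lambda>a b. F (antipode H a) b) \<in> bilinear_maps K H H' M"
    by (intro bilinear_mapsI bilinear_mapsD(1)[OF F]
        linear_maps_compose[OF bilinear_mapsD(2)[OF F]] H.antipode_linear H.antipode_closed)
  show ?thesis
    using sum_r_\<sigma>[OF F2] by (simp add: sum_R[OF M F1] sum_R[OF M F] \<sigma> cong: tensor_sum_cong)
qed

lemma legs_\<sigma>\<sigma>:
  assumes f: "f \<in> linear_maps K H M" and g: "g \<in> linear_maps K H' M"
  shows "legs M (\<lambda>a. f (\<sigma> (\<sigma> a))) (\<lambda>b. g (\<sigma>' (\<sigma>' b))) r = legs M f g r"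
    and "legs M (\<lambda>a. f (\<sigma> (\<sigma> a))) (\<lambda>b. g (\<sigma>' (\<sigma>' b))) R = legs M f g R"
  unfolding legs_def
  using sum_r_\<sigma>[OF legs_bilinear[OF M f g]] sum_R_\<sigma>[OF legs_bilinear[OF M f g]]
    sum_r_\<sigma>[OF legs_bilinear[OF M linear_maps_compose[OF f \<sigma>_linear_maps(1)]
        linear_maps_compose[OF g \<sigma>_linear_maps(2)]]]
    sum_R_\<sigma>[OF legs_bilinear[OF M linear_maps_compose[OF f \<sigma>_linear_maps(1)]
        linear_maps_compose[OF g \<sigma>_linear_maps(2)]]]
  by simp_all

text \<open>An antimultiplicative leg on the right (left) factor becomes multiplicative after composition with
  \<open>S\<^sup>-\<^sup>1\<close>, and the resulting algebra map on \<open>H \<otimes> H'\<close> takes \<open>r\<close> and \<open>r\<^sup>-\<^sup>1\<close> to the two elements.\<close>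

lemma legs_opposite_right:
  assumes f: "f \<in> algebra_homs K H M" and g: "g \<in> algebra_homs K (opposite H') M"
    and fg: "commuting M (f ` carrier H) (g ` carrier H')"
  shows "legs M f g R \<otimes> legs M f (\<lambda>b. g (\<sigma>' (\<sigma>' b))) r = \<one>"
    and "legs M f (\<lambda>b. g (\<sigma>' (\<sigma>' b))) r \<otimes> legs M f g R = \<one>"
proof -
  have gl: "g \<in> linear_maps K H' M" using algebra_homsD(1)[OF g] by simp
  have g': "(\<lambda>b. g (\<sigma>' b)) \<in> algebra_homs K H' M"
    by (rule algebra_homs_compose[OF g \<sigma>'(1)])
  have c: "commuting M (f ` carrier H) ((\<lambda>b. g (\<sigma>' b)) ` carrier H')"
    using fg by (auto simp: commuting_def)
  note \<theta> = legs_hom[OF M f g' c]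
  \<comment> \<open>Let \<theta> be the algebra map with legs f and g \<circ>
    \<open>\<sigma>'\<close>. By (id \<otimes> S)(R) = r, fact \<open>1\<close> says that the first
    element is \<theta>(r) and fact \<open>2\<close> that the second is \<theta>(R).\<close>
  have "tensor_sum M R (\<lambda>a b. f a \<otimes> g (\<sigma>' (antipode H' b))) =
      tensor_sum M r (\<lambda>a b. f a \<otimes> g (\<sigma>' b))"
    by (rule sum_R_antipode[OF M legs_bilinear[OF M algebra_homsD(1)[OF f] algebra_homsD(1)[OF g']]])
  then have 1: "legs M f g R = legs M f (\<lambda>b. g (\<sigma>' b)) r"
    unfolding legs_def by (simp add: \<sigma>' cong: tensor_sum_cong)
  have "tensor_sum M R (\<lambda>a b. f a \<otimes> g (\<sigma>' (\<sigma>' (antipode H' b)))) =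
      tensor_sum M r (\<lambda>a b. f a \<otimes> g (\<sigma>' (\<sigma>' b)))"
    by (rule sum_R_antipode[OF M legs_bilinear[OF M algebra_homsD(1)[OF f]]])
      (intro linear_maps_compose[OF gl] linear_maps_compose[OF \<sigma>_linear_maps(2)] \<sigma>_linear_maps)
  then have 2: "legs M f (\<lambda>b. g (\<sigma>' (\<sigma>' b))) r = legs M f (\<lambda>b. g (\<sigma>' b)) R"
    unfolding legs_def by (simp add: \<sigma>' cong: tensor_sum_cong)
  show "legs M f g R \<otimes> legs M f (\<lambda>b. g (\<sigma>' (\<sigma>' b))) r = \<one>"
    "legs M f (\<lambda>b. g (\<sigma>' (\<sigma>' b))) r \<otimes> legs M f g R = \<one>"
    unfolding 1 2 using algebra_homsD(3,4)[OF \<theta>]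
    by (simp_all flip: algebra_homsD(3)[OF \<theta>] add: r_mult_R R_mult_r)
qed

lemma legs_opposite_left:
  assumes f: "f \<in> algebra_homs K (opposite H) M" and g: "g \<in> algebra_homs K H' M"
    and fg: "commuting M (f ` carrier H) (g ` carrier H')"
  shows "legs M f g r \<otimes> legs M (\<lambda>a. f (\<sigma> (\<sigma> a))) g R = \<one>"
    and "legs M (\<lambda>a. f (\<sigma> (\<sigma> a))) g R \<otimes> legs M f g r = \<one>"
proof -
  have fl: "f \<in> linear_maps K H M" using algebra_homsD(1)[OF f] by simp
  have f': "(\<lambda>a. f (\<sigma> a)) \<in> algebra_homs K H M"
    by (rule algebra_homs_compose[OF f \<sigma>(1)])
  have c: "commuting M ((\<lambda>a. f (\<sigma> a)) ` carrier H) (g ` carrier H')"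
    using fg by (auto simp: commuting_def)
  note \<theta> = legs_hom[OF M f' g c]
  \<comment> \<open>On the left factor S \<otimes> id carries r to R, so \<open>r\<close> and
    \<open>R\<close> change places: the untwisted element is \<theta>(R) and the twisted one
    \<theta>(r).\<close>
  have "tensor_sum M R (\<lambda>a b. f (\<sigma> a) \<otimes> g b) =
      tensor_sum M r (\<lambda>a b. f (\<sigma> (antipode H a)) \<otimes> g b)"
    by (rule sum_R[OF M legs_bilinear[OF M algebra_homsD(1)[OF f'] algebra_homsD(1)[OF g]]])
  then have 1: "legs M f g r = legs M (\<lambda>a. f (\<sigma> a)) g R"
    unfolding legs_def by (simp add: \<sigma> cong: tensor_sum_cong)
  have "tensor_sum M R (\<lambda>a b. f (\<sigma> (\<sigma> a)) \<otimes> g b) =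
      tensor_sum M r (\<lambda>a b. f (\<sigma> (\<sigma> (antipode H a))) \<otimes> g b)"
    by (rule sum_R[OF M legs_bilinear[OF M _ algebra_homsD(1)[OF g]]])
      (intro linear_maps_compose[OF fl] linear_maps_compose[OF \<sigma>_linear_maps(1)] \<sigma>_linear_maps)
  then have 2: "legs M (\<lambda>a. f (\<sigma> (\<sigma> a))) g R = legs M (\<lambda>a. f (\<sigma> a)) g r"
    unfolding legs_def by (simp add: \<sigma> cong: tensor_sum_cong)
  show "legs M f g r \<otimes> legs M (\<lambda>a. f (\<sigma> (\<sigma> a))) g R = \<one>"
    "legs M (\<lambda>a. f (\<sigma> (\<sigma> a))) g R \<otimes> legs M f g r = \<one>"
    unfolding 1 2 using algebra_homsD(3,4)[OF \<theta>]
    by (simp_all flip: algebra_homsD(3)[OF \<theta>] add: r_mult_R R_mult_r)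
qed

end

end

section \<open>A word identity\<close>

context monoid
begin

lemma inverse_word4:
  assumes "a \<in> carrier G" "b \<in> carrier G" "c \<in> carrier G" "d \<in> carrier G"
    "a' \<in> carrier G" "b' \<in> carrier G" "c' \<in> carrier G" "d' \<in> carrier G"
    "a \<otimes> a' = \<one>" "b \<otimes> b' = \<one>" "c \<otimes> c' = \<one>" "d \<otimes> d' = \<one>"
  shows "a \<otimes> b \<otimes> c \<otimes> d \<otimes> (d' \<otimes> c' \<otimes> b' \<otimes> a') = \<one>"
proof -
  have *: "x \<otimes> (x' \<otimes> t) = t" if "x \<otimes> x' = \<one>" "x \<in> carrier G" "x' \<in> carrier G" "t \<in> carrier G" for x x' t
    using that by (simp add: m_assoc[symmetric])
  show ?thesis using assms by (simp add: m_assoc *)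
qed

lemma left_commute:
  "x \<otimes> y = y \<otimes> x \<Longrightarrow> x \<in> carrier G \<Longrightarrow> y \<in> carrier G \<Longrightarrow> z \<in> carrier G
    \<Longrightarrow> x \<otimes> (y \<otimes> z) = y \<otimes> (x \<otimes> z)"
  by (simp add: m_assoc[symmetric])

lemma braid_left:
  "x \<otimes> y \<otimes> z = z \<otimes> y \<otimes> x \<Longrightarrow> x \<in> carrier G \<Longrightarrow> y \<in> carrier G \<Longrightarrow> z \<in> carrier G \<Longrightarrow> t \<in> carrier G
    \<Longrightarrow> x \<otimes> (y \<otimes> (z \<otimes> t)) = z \<otimes> (y \<otimes> (x \<otimes> t))"
  by (simp add: m_assoc[symmetric])

text \<open>Multiply the braid relation by the inverse of \<open>z\<close> on both sides. Together
  with the next lemma this turns Yang--Baxter equations for r into those in which r^-1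
  occurs.\<close>

lemma braid_inverse_outer:
  assumes "x \<otimes> y \<otimes> z = z \<otimes> y \<otimes> x" "z \<otimes> z' = \<one>" "z' \<otimes> z = \<one>"
    "x \<in> carrier G" "y \<in> carrier G" "z \<in> carrier G" "z' \<in> carrier G"
  shows "z' \<otimes> x \<otimes> y = y \<otimes> x \<otimes> z'"
proof -
  have "z' \<otimes> x \<otimes> y = z' \<otimes> (x \<otimes> y \<otimes> z) \<otimes> z'"
    using assms(2-) by (simp add: m_assoc)
  also have "\<dots> = z' \<otimes> (z \<otimes> y \<otimes> x) \<otimes> z'" by (simp add: assms(1))
  also have "\<dots> = y \<otimes> x \<otimes> z'"
    using assms(2-) by (simp add: m_assoc[symmetric])
  finally show ?thesis .
qed

text \<open>Two successive conjugations: first the outer crossing \<open>z\<close> is inverted, then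
  \<open>y\<close>, which has become an outer crossing.\<close>

lemma braid_inverse_inner:
  assumes "x \<otimes> y \<otimes> z = z \<otimes> y \<otimes> x" "y \<otimes> y' = \<one>" "y' \<otimes> y = \<one>" "z \<otimes> z' = \<one>" "z' \<otimes> z = \<one>"
    "x \<in> carrier G" "y \<in> carrier G" "z \<in> carrier G" "y' \<in> carrier G" "z' \<in> carrier G"
  shows "y' \<otimes> z' \<otimes> x = x \<otimes> z' \<otimes> y'"
proof -
  have "y' \<otimes> z' \<otimes> x = y' \<otimes> (z' \<otimes> x \<otimes> y) \<otimes> y'"
    using assms(2-) by (simp add: m_assoc)
  also have "\<dots> = y' \<otimes> (y \<otimes> x \<otimes> z') \<otimes> y'"
    using braid_inverse_outer[of x y z z'] assms by simp
  also have "\<dots> = x \<otimes> z' \<otimes> y'"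
    using assms(2-) by (simp add: m_assoc[symmetric])
  finally show ?thesis .
qed

text \<open>The Yang--Baxter equation for a product of four crossings; the hypotheses are commutations of
  crossings without a common strand and Yang--Baxter equations for triples of strands.\<close>

lemma cabled_yang_baxter:
  assumes cl: "a1 \<in> carrier G" "a2 \<in> carrier G" "a3 \<in> carrier G" "a4 \<in> carrier G"
      "b1 \<in> carrier G" "b2 \<in> carrier G" "b3 \<in> carrier G" "b4 \<in> carrier G"
      "c1 \<in> carrier G" "c2 \<in> carrier G" "c3 \<in> carrier G" "c4 \<in> carrier G"
    and comm: "a1 \<otimes> b3 = b3 \<otimes> a1" "a1 \<otimes> b4 = b4 \<otimes> a1" "a1 \<otimes> c1 = c1 \<otimes> a1" "a1 \<otimes> c2 = c2 \<otimes> a1"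
      "a2 \<otimes> b3 = b3 \<otimes> a2" "a2 \<otimes> b4 = b4 \<otimes> a2" "a2 \<otimes> c3 = c3 \<otimes> a2" "a2 \<otimes> c4 = c4 \<otimes> a2"
      "a3 \<otimes> b1 = b1 \<otimes> a3" "a3 \<otimes> b2 = b2 \<otimes> a3" "a3 \<otimes> c1 = c1 \<otimes> a3" "a3 \<otimes> c2 = c2 \<otimes> a3"
      "a4 \<otimes> b1 = b1 \<otimes> a4" "a4 \<otimes> b2 = b2 \<otimes> a4" "a4 \<otimes> c3 = c3 \<otimes> a4" "a4 \<otimes> c4 = c4 \<otimes> a4"
      "b1 \<otimes> c2 = c2 \<otimes> b1" "b1 \<otimes> c4 = c4 \<otimes> b1" "b2 \<otimes> c1 = c1 \<otimes> b2" "b2 \<otimes> c3 = c3 \<otimes> b2"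
      "b3 \<otimes> c2 = c2 \<otimes> b3" "b3 \<otimes> c4 = c4 \<otimes> b3" "b4 \<otimes> c1 = c1 \<otimes> b4" "b4 \<otimes> c3 = c3 \<otimes> b4"
      "c2 \<otimes> c3 = c3 \<otimes> c2"
    and braid: "a4 \<otimes> b3 \<otimes> c1 = c1 \<otimes> b3 \<otimes> a4" "a4 \<otimes> b4 \<otimes> c2 = c2 \<otimes> b4 \<otimes> a4"
      "a2 \<otimes> b1 \<otimes> c1 = c1 \<otimes> b1 \<otimes> a2" "a2 \<otimes> b2 \<otimes> c2 = c2 \<otimes> b2 \<otimes> a2"
      "a3 \<otimes> b3 \<otimes> c3 = c3 \<otimes> b3 \<otimes> a3" "a3 \<otimes> b4 \<otimes> c4 = c4 \<otimes> b4 \<otimes> a3"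
      "a1 \<otimes> b1 \<otimes> c3 = c3 \<otimes> b1 \<otimes> a1" "a1 \<otimes> b2 \<otimes> c4 = c4 \<otimes> b2 \<otimes> a1"
  shows "a1 \<otimes> a2 \<otimes> a3 \<otimes> a4 \<otimes> (b1 \<otimes> b2 \<otimes> b3 \<otimes> b4) \<otimes> (c1 \<otimes> c2 \<otimes> c3 \<otimes> c4) =
    c1 \<otimes> c2 \<otimes> c3 \<otimes> c4 \<otimes> (b1 \<otimes> b2 \<otimes> b3 \<otimes> b4) \<otimes> (a1 \<otimes> a2 \<otimes> a3 \<otimes> a4)"
proof -
  note cl' = cl m_closed
  have "a1 \<otimes> a2 \<otimes> a3 \<otimes> a4 \<otimes> (b1 \<otimes> b2 \<otimes> b3 \<otimes> b4) \<otimes> (c1 \<otimes> c2 \<otimes> c3 \<otimes> c4) =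
      a1 \<otimes> (a2 \<otimes> (a3 \<otimes> (a4 \<otimes> (b1 \<otimes> (b2 \<otimes> (b3 \<otimes> (b4 \<otimes> (c1 \<otimes> (c2 \<otimes> (c3 \<otimes> c4))))))))))"
    by (simp only: m_assoc cl')
  \<comment> \<open>The letters a, b, c are the crossings of cables 1-2, 1-3 and 2-3, each cable
    having two strands. A braid relation belongs to a choice of one strand from each cable, which
    makes eight. In this and the next seven displays commutations make one such triple adjacent and
    its braid relation reverses it.\<close>
  also have "\<dots> = a1 \<otimes> (a2 \<otimes> (a3 \<otimes> (b1 \<otimes> (b2 \<otimes> (c1 \<otimes> (b3 \<otimes> (a4 \<otimes> (b4 \<otimes> (c2 \<otimes> (c3 \<otimes> c4))))))))))"
    by (simp only: comm(13) comm(13)[THEN left_commute] comm(14) comm(14)[THEN left_commute]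
        comm(23) comm(23)[THEN left_commute] braid_left[OF braid(1)] cl')
  also have "\<dots> = a1 \<otimes> (a2 \<otimes> (a3 \<otimes> (b1 \<otimes> (b2 \<otimes> (c1 \<otimes> (b3 \<otimes> (c2 \<otimes> (b4 \<otimes> (a4 \<otimes> (c3 \<otimes> c4))))))))))"
    by (simp only: braid_left[OF braid(2)] cl')
  also have "\<dots> = a1 \<otimes> (c1 \<otimes> (b1 \<otimes> (a2 \<otimes> (b2 \<otimes> (a3 \<otimes> (b3 \<otimes> (c2 \<otimes> (b4 \<otimes> (a4 \<otimes> (c3 \<otimes> c4))))))))))"
    by (simp only: comm(9) comm(9)[THEN left_commute] comm(10) comm(10)[THEN left_commute]
        comm(11) comm(11)[THEN left_commute] comm(19) comm(19)[THEN left_commute]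
        braid_left[OF braid(3)] cl')
  also have "\<dots> = a1 \<otimes> (c1 \<otimes> (b1 \<otimes> (c2 \<otimes> (b2 \<otimes> (a2 \<otimes> (a3 \<otimes> (b3 \<otimes> (b4 \<otimes> (a4 \<otimes> (c3 \<otimes> c4))))))))))"
    by (simp only: comm(21) comm(21)[THEN left_commute] comm(12) comm(12)[THEN left_commute]
        braid_left[OF braid(4)] cl')
  also have "\<dots> = a1 \<otimes> (c1 \<otimes> (b1 \<otimes> (c2 \<otimes> (b2 \<otimes> (a2 \<otimes> (c3 \<otimes> (b3 \<otimes> (a3 \<otimes> (b4 \<otimes> (a4 \<otimes> c4))))))))))"
    by (simp only: comm(15) comm(15)[THEN left_commute] comm(24) comm(24)[THEN left_commute]
        braid_left[OF braid(5)] cl')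
  also have "\<dots> = a1 \<otimes> (c1 \<otimes> (b1 \<otimes> (c2 \<otimes> (b2 \<otimes> (a2 \<otimes> (c3 \<otimes> (b3 \<otimes> (c4 \<otimes> (b4 \<otimes> (a3 \<otimes> a4))))))))))"
    by (simp only: comm(16) left_commute[OF comm(16)] braid_left[OF braid(6)] cl')
  also have "\<dots> = c1 \<otimes> (c3 \<otimes> (b1 \<otimes> (a1 \<otimes> (c2 \<otimes> (b2 \<otimes> (a2 \<otimes> (b3 \<otimes> (c4 \<otimes> (b4 \<otimes> (a3 \<otimes> a4))))))))))"
    by (simp only: comm(3) comm(3)[THEN left_commute] comm(7) comm(7)[THEN left_commute] comm(20)
        comm(20)[THEN left_commute] comm(25) comm(25)[THEN left_commute] braid_left[OF braid(7)]
        cl')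
  also have "\<dots> = c1 \<otimes> (c3 \<otimes> (b1 \<otimes> (c2 \<otimes> (c4 \<otimes> (b2 \<otimes> (a1 \<otimes> (a2 \<otimes> (b3 \<otimes> (b4 \<otimes> (a3 \<otimes> a4))))))))))"
    by (simp only: comm(4) comm(4)[THEN left_commute] comm(22) comm(22)[THEN left_commute] comm(8)
        comm(8)[THEN left_commute] braid_left[OF braid(8)] cl')
  \<comment> \<open>All eight triples are reversed; only commutations remain, among them the one
    putting \<open>c2\<close> and \<open>c3\<close> back in order.\<close>
  also have "\<dots> = c1 \<otimes> (c2 \<otimes> (c3 \<otimes> (c4 \<otimes> (b1 \<otimes> (b2 \<otimes> (b3 \<otimes> (b4 \<otimes> (a1 \<otimes> (a2 \<otimes> (a3 \<otimes> a4))))))))))"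
    by (simp only: comm(17) comm(17)[THEN left_commute] comm(18) comm(18)[THEN left_commute]
        comm(25)[symmetric] comm(25)[symmetric, THEN left_commute] comm(5) comm(5)[THEN left_commute]
        comm(1) comm(1)[THEN left_commute] comm(6) comm(6)[THEN left_commute] comm(2) comm(2)[THEN left_commute] cl')
  finally show ?thesis by (simp only: m_assoc cl')
qed

end

section \<open>The bicrossed coproduct\<close>

locale bicrossed_quasitriangular = H: quasitriangular_hopf_algebra K H p +
  H': quasitriangular_hopf_algebra K H' p' + W: weak_R_matrix K H H' r
  for K :: "('k, 'c) ring_scheme"
    and H :: "('k, 'a, 'm) hopf_scheme" and H' :: "('k, 'b, 'n) hopf_scheme"
    and p :: "('a, 'a) tensor" and p' :: "('b, 'b) tensor" and r :: "('a, 'b) tensor"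
begin

sublocale bialgebra_copairing K H H' r
  using W.r_unit
  by (intro bialgebra_copairing.intro bialgebra_copairing_axioms.intro H.bialgebra_axioms
      H'.bialgebra_axioms W.comult_left W.comult_right) (auto simp: Units_def)

text \<open>Turns the counit identities x r = r into x = 1, which supplies the normalisations
  required of a copairing of Hopf algebras.\<close>

lemma cancel_r:
  assumes x: "x \<in> carrier T" and "x \<otimes>\<^bsub>T\<^esub> r = r"
  shows "x = \<one>\<^bsub>T\<^esub>"
  using assms T.m_assoc[OF x r_closed T.Units_inv_closed[OF W.r_unit]] W.r_unit by simp

sublocale hopf_copairing K H H' r
  by (intro hopf_copairing.intro hopf_copairing_axioms.intro bialgebra_copairing_axioms
      H.hopf_algebra_axioms H'.hopf_algebra_axioms cancel_r counit_r_left_mult counit_r_right_mult) auto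

sublocale TT: kalgebra_pair K T T ..

section \<open>The maps S^-2 \<otimes> S^-2 and S \<otimes> S on H \<otimes> H'\<close>

abbreviation "\<tau> \<equiv> inverse_square H (antipode H)"
abbreviation "\<tau>' \<equiv> inverse_square H' (antipode H')"

definition U where "U = tensor_map K H H' H H' \<tau> \<tau>'"

lemma U_hom: "U \<in> algebra_homs K T T"
  and U_pure [simp]: "a \<in> carrier H \<Longrightarrow> b \<in> carrier H'
    \<Longrightarrow> U (pure a b) = pure (\<tau> a) (\<tau>' b)"
  unfolding U_def
  by (rule tensor_map_hom[OF kalgebra_pair_axioms H.inverse_square_hom H'.inverse_square_hom]; simp)+

lemma U_closed [simp]: "x \<in> carrier T \<Longrightarrow> U x \<in> carrier T"
  by (rule algebra_homsD(2)[OF U_hom])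

definition SS where "SS = tensor_map K H H' H H' (antipode H) (antipode H')"

lemma SS_eq:
  "x \<in> carrier T \<Longrightarrow> SS x = tensor_sum T x (\<lambda>a b. pure (antipode H a) (antipode H' b))"
  by (simp add: SS_def tensor_map_def)

lemma SS_hom: "SS \<in> algebra_homs K T (opposite T)"
proof -
  let ?f = "\<lambda>a. inl (antipode H a)" and ?g = "\<lambda>b. inr (antipode H' b)"
  have f: "?f \<in> algebra_homs K H (opposite T)" and g: "?g \<in> algebra_homs K H' (opposite T)"
    using algebra_homsD[OF inl_hom] algebra_homsD[OF inr_hom]
    by (auto intro!: algebra_homsI linear_pure_left linear_pure_right H.antipode_linear H'.antipode_linear
        simp: H.antipode_mult H'.antipode_mult)
  have h: "legs (opposite T) ?f ?g \<in> algebra_homs K T (opposite T)"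
    by (intro legs_hom[OF T.kalgebra_opposite f g]) (auto simp: commuting_def)
  have "SS x = legs (opposite T) ?f ?g x" if "x \<in> carrier T" for x
    using that by (auto simp: SS_eq legs_def intro!: tensor_sum_cong)
  then show ?thesis
    by (intro algebra_homsI linear_mapsI)
      (simp_all add: algebra_homsD(2-4)[OF h, simplified] tensor_smult_closed
        linear_mapsD(2,3)[OF algebra_homsD(1)[OF h], simplified])
qed

lemma SS_closed [simp]: "x \<in> carrier T \<Longrightarrow> SS x \<in> carrier T"
  using algebra_homsD(2)[OF SS_hom] by simp

lemma SS_pure: "a \<in> carrier H \<Longrightarrow> b \<in> carrier H'
    \<Longrightarrow> SS (pure a b) = pure (antipode H a) (antipode H' b)"
proof -
  have "(\<lambda>a b. pure (antipode H a) (antipode H' b)) \<in> bilinear_maps K H H' T"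
    by (intro bilinear_mapsI linear_pure_left linear_pure_right H.antipode_linear H'.antipode_linear) auto
  then show "a \<in> carrier H \<Longrightarrow> b \<in> carrier H' \<Longrightarrow> ?thesis"
    by (simp add: SS_eq tensor_sum_pure[OF tensor_module])
qed

lemma SS_mult: "x \<in> carrier T \<Longrightarrow> y \<in> carrier T \<Longrightarrow> SS (x \<otimes>\<^bsub>T\<^esub> y) = SS y \<otimes>\<^bsub>T\<^esub> SS x"
  using algebra_homsD(3)[OF SS_hom] by simp

lemma SS_r: "SS r = r"
  using sum_r_antipode[OF tensor_kalgebra pure_tensor_bilinear]
  by (simp add: SS_eq tensor_sum_pure_tensor)

lemma SS_R: "SS R = R"
proof -
  have 1: "SS R \<otimes>\<^bsub>T\<^esub> r = \<one>\<^bsub>T\<^esub>"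
    using SS_mult[OF r_closed R_closed] algebra_homsD(4)[OF SS_hom] by (simp add: SS_r r_mult_R)
  have "SS R = SS R \<otimes>\<^bsub>T\<^esub> (r \<otimes>\<^bsub>T\<^esub> R)" by (simp add: r_mult_R)
  also have "\<dots> = SS R \<otimes>\<^bsub>T\<^esub> r \<otimes>\<^bsub>T\<^esub> R" by (rule T.m_assoc[symmetric]) simp_all
  also have "\<dots> = R" by (simp add: 1)
  finally show ?thesis .
qed

section \<open>The antipode of the bicrossed coproduct and its inverse square\<close>

abbreviation "B \<equiv> bicrossed_coproduct K H H' r"

lemma carrier_B [simp]: "carrier B = carrier T"
  by (simp add: bicrossed_coproduct_def Let_def)

lemma antipode_B: "antipode B x = R \<otimes>\<^bsub>T\<^esub> SS x \<otimes>\<^bsub>T\<^esub> r"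
  by (simp add: bicrossed_coproduct_def Let_def inv_r SS_def)

text \<open>\<open>SS\<close> reverses products and fixes r and R, so it carries R SS(x) r to r
  SS(SS x) R. Conjugating once more by r cancels both outer factors.\<close>

lemma antipode_B_twice:
  assumes x: "x \<in> carrier T"
  shows "antipode B (antipode B x) = SS (SS x)"
proof -
  have "antipode B (antipode B x) = R \<otimes>\<^bsub>T\<^esub> (r \<otimes>\<^bsub>T\<^esub> (SS (SS x) \<otimes>\<^bsub>T\<^esub> R)) \<otimes>\<^bsub>T\<^esub> r"
    using x by (simp add: antipode_B SS_mult SS_r SS_R)
  also have "\<dots> = (R \<otimes>\<^bsub>T\<^esub> r) \<otimes>\<^bsub>T\<^esub> SS (SS x) \<otimes>\<^bsub>T\<^esub> (R \<otimes>\<^bsub>T\<^esub> r)"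
    using x by (simp add: T.m_assoc)
  also have "\<dots> = SS (SS x)"
    using x by (simp add: R_mult_r)
  finally show ?thesis .
qed

lemma SS_SS_linear: "(\<lambda>x. SS (SS x)) \<in> linear_maps K T T"
  using linear_maps_compose[of SS K T T SS T] algebra_homsD(1)[OF SS_hom] by simp

lemma SS_SS_U: "x \<in> carrier T \<Longrightarrow> SS (SS (U x)) = x"
  by (rule linear_eqI[OF tensor_module linear_maps_compose[OF SS_SS_linear algebra_homsD(1)[OF U_hom]]
        linear_maps_id])
    (simp_all add: SS_pure H.inverse_square_antipode H'.inverse_square_antipode)

lemma U_SS_SS: "x \<in> carrier T \<Longrightarrow> U (SS (SS x)) = x"
  by (rule linear_eqI[OF tensor_module linear_maps_compose[OF algebra_homsD(1)[OF U_hom] SS_SS_linear]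
        linear_maps_id])
    (simp_all add: SS_pure H.inverse_square_antipode H'.inverse_square_antipode)

lemma U_aut: "U \<in> algebra_auts K T"
proof -
  have "bij_betw U (carrier T) (carrier T)"
    by (rule bij_betw_byWitness[where f' = "\<lambda>x. SS (SS x)"]) (auto simp: SS_SS_U U_SS_SS)
  then show ?thesis using U_hom by (simp add: algebra_auts_def)
qed

lemma inverse_square_B: "inverse_square B (antipode B) = U"
proof -
  have cl: "antipode B x \<in> carrier T" if "x \<in> carrier T" for x
    using that by (simp add: antipode_B)
  have inj: "inj_on (antipode B) (carrier T)"
  proof (rule inj_onI)
    fix x y assume "x \<in> carrier T" "y \<in> carrier T" "antipode B x = antipode B y"
    then show "x = y" using antipode_B_twice U_SS_SS by metis
  qed
  have "inv_into (carrier T) (antipode B) (inv_into (carrier T) (antipode B) x) = U x"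
    if x: "x \<in> carrier T" for x
  proof -
    have "x = antipode B (antipode B (U x))"
      using x by (simp add: antipode_B_twice SS_SS_U)
    then show ?thesis
      using x cl inv_into_f_f[OF inj] U_closed by metis
  qed
  \<comment> \<open>Both \<open>inverse_square\<close> and \<open>tensor_map\<close> are restricted
    to the carrier, so the two maps agree as functions and the two quadruples of the theorem are
    literally equal.\<close>
  moreover have "U x = undefined" if "x \<notin> carrier T" for x
    using that by (simp add: U_def tensor_map_def)
  ultimately show ?thesis
    by (auto simp: inverse_square_def[of B] restrict_def fun_eq_iff)
qed

abbreviation "pinv \<equiv> H.rr.R"
abbreviation "pinv' \<equiv> H'.rr.R"

section \<open>Fourfold sums over tensors of the types of r, p, p' and R\<close>

definition quad_sum ::
  "('e, 'q) ring_scheme \<Rightarrow> ('a, 'b) tensor \<Rightarrow> ('a, 'a) tensor \<Rightarrow> ('b, 'b) tensor \<Rightarrow> ('a, 'b) tensor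
    \<Rightarrow> ('a \<Rightarrow> 'b \<Rightarrow> 'a \<Rightarrow> 'a \<Rightarrow> 'b \<Rightarrow> 'b \<Rightarrow> 'a \<Rightarrow> 'b \<Rightarrow> 'e) \<Rightarrow> 'e"
  where "quad_sum M x y z w G = tensor_sum M x (\<lambda>a b. tensor_sum M y (\<lambda>c d.
    tensor_sum M z (\<lambda>i j. tensor_sum M w (\<lambda>m n. G a b c d i j m n))))"

context
  fixes x w :: "('a, 'b) tensor" and y :: "('a, 'a) tensor" and z :: "('b, 'b) tensor"
  assumes xyzw [simp]: "x \<in> carrier T" "y \<in> carrier H.HH.T" "z \<in> carrier H'.HH.T" "w \<in> carrier T"
begin

lemma quad_sum_cong:
  assumes "\<And>a b c d i j m n. a \<in> carrier H \<Longrightarrow> b \<in> carrier H' \<Longrightarrow> c \<in> carrier H \<Longrightarrow> d \<in> carrier H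
    \<Longrightarrow> i \<in> carrier H' \<Longrightarrow> j \<in> carrier H' \<Longrightarrow> m \<in> carrier H \<Longrightarrow> n \<in> carrier H'
    \<Longrightarrow> G a b c d i j m n = G' a b c d i j m n"
  shows "quad_sum M x y z w G = quad_sum M x y z w G'"
  unfolding quad_sum_def
  by (intro tensor_sum_cong H.HH.tensor_sum_cong H'.HH.tensor_sum_cong assms xyzw)

lemma quad_sum_in:
  assumes "module K M"
    and "\<And>a b c d i j m n. a \<in> carrier H \<Longrightarrow> b \<in> carrier H' \<Longrightarrow> c \<in> carrier H \<Longrightarrow> d \<in> carrier H
    \<Longrightarrow> i \<in> carrier H' \<Longrightarrow> j \<in> carrier H' \<Longrightarrow> m \<in> carrier H \<Longrightarrow> n \<in> carrier H'
    \<Longrightarrow> G a b c d i j m n \<in> carrier M"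
  shows "quad_sum M x y z w G \<in> carrier M"
  unfolding quad_sum_def
  by (intro tensor_sum_in H.HH.tensor_sum_in H'.HH.tensor_sum_in assms xyzw)

lemma linear_quad_sum:
  assumes N: "module K N" and M: "module K M" and \<phi>: "\<phi> \<in> linear_maps K N M"
    and G: "\<And>a b c d i j m n. a \<in> carrier H \<Longrightarrow> b \<in> carrier H' \<Longrightarrow> c \<in> carrier H \<Longrightarrow> d \<in> carrier H
    \<Longrightarrow> i \<in> carrier H' \<Longrightarrow> j \<in> carrier H' \<Longrightarrow> m \<in> carrier H \<Longrightarrow> n \<in> carrier H'
    \<Longrightarrow> G a b c d i j m n \<in> carrier N"
  shows "\<phi> (quad_sum N x y z w G) = quad_sum M x y z w (\<lambda>a b c d i j m n. \<phi> (G a b c d i j m n))"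
proof -
  note i = tensor_sum_in[OF N] H.HH.tensor_sum_in[OF N] H'.HH.tensor_sum_in[OF N]
  have "\<phi> (quad_sum N x y z w G) = tensor_sum M x (\<lambda>a b. \<phi> (tensor_sum N y (\<lambda>c d.
      tensor_sum N z (\<lambda>i j. tensor_sum N w (\<lambda>m n. G a b c d i j m n)))))"
    unfolding quad_sum_def by (intro linear_tensor_sum[OF N M _ _ \<phi>] i G xyzw)
  also have "\<dots> = tensor_sum M x (\<lambda>a b. tensor_sum M y (\<lambda>c d. \<phi> (
      tensor_sum N z (\<lambda>i j. tensor_sum N w (\<lambda>m n. G a b c d i j m n)))))"
    by (intro tensor_sum_cong H.HH.linear_tensor_sum[OF N M _ _ \<phi>] i G xyzw)
  also have "\<dots> = tensor_sum M x (\<lambda>a b. tensor_sum M y (\<lambda>c d. tensor_sum M z (\<lambda>i j. \<phi> (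
      tensor_sum N w (\<lambda>m n. G a b c d i j m n)))))"
    by (intro tensor_sum_cong H.HH.tensor_sum_cong H'.HH.linear_tensor_sum[OF N M _ _ \<phi>] i G xyzw)
  also have "\<dots> = quad_sum M x y z w (\<lambda>a b c d i j m n. \<phi> (G a b c d i j m n))"
    unfolding quad_sum_def
    by (intro tensor_sum_cong H.HH.tensor_sum_cong H'.HH.tensor_sum_cong
        linear_tensor_sum[OF N M _ _ \<phi>] G xyzw)
  finally show ?thesis .
qed

text \<open>Expands a product of four sums, taken in whatever order \<open>\<Phi>\<close>
  prescribes, into one fourfold sum with a fixed nesting. Factorisations with differently ordered
  factors thereby become comparable term by term.\<close>

lemma quadrilinear_sums:
  assumes M: "module K M"
    and \<Phi>: "\<And>b c d. b \<in> carrier M \<Longrightarrow> c \<in> carrier M \<Longrightarrow> d \<in> carrier M \<Longrightarrow> (\<lambda>a. \<Phi> a b c d) \<in> linear_maps K M M"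
      "\<And>a c d. a \<in> carrier M \<Longrightarrow> c \<in> carrier M \<Longrightarrow> d \<in> carrier M \<Longrightarrow> (\<lambda>b. \<Phi> a b c d) \<in> linear_maps K M M"
      "\<And>a b d. a \<in> carrier M \<Longrightarrow> b \<in> carrier M \<Longrightarrow> d \<in> carrier M \<Longrightarrow> (\<lambda>c. \<Phi> a b c d) \<in> linear_maps K M M"
      "\<And>a b c. a \<in> carrier M \<Longrightarrow> b \<in> carrier M \<Longrightarrow> c \<in> carrier M \<Longrightarrow> (\<lambda>d. \<Phi> a b c d) \<in> linear_maps K M M"
    and F: "\<And>a b. a \<in> carrier H \<Longrightarrow> b \<in> carrier H' \<Longrightarrow> F1 a b \<in> carrier M"
      "\<And>a b. a \<in> carrier H \<Longrightarrow> b \<in> carrier H \<Longrightarrow> F2 a b \<in> carrier M"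
      "\<And>a b. a \<in> carrier H' \<Longrightarrow> b \<in> carrier H' \<Longrightarrow> F3 a b \<in> carrier M"
      "\<And>a b. a \<in> carrier H \<Longrightarrow> b \<in> carrier H' \<Longrightarrow> F4 a b \<in> carrier M"
  shows "\<Phi> (tensor_sum M x F1) (tensor_sum M y F2) (tensor_sum M z F3) (tensor_sum M w F4) =
    quad_sum M x y z w (\<lambda>a b c d i j m n. \<Phi> (F1 a b) (F2 c d) (F3 i j) (F4 m n))"
proof -
  note s = tensor_sum_in[OF M xyzw(1), of F1] H.HH.tensor_sum_in[OF M xyzw(2), of F2]
    H'.HH.tensor_sum_in[OF M xyzw(3), of F3] tensor_sum_in[OF M xyzw(4), of F4]
  have "\<Phi> (tensor_sum M x F1) (tensor_sum M y F2) (tensor_sum M z F3) (tensor_sum M w F4) =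
      tensor_sum M x (\<lambda>a b. \<Phi> (F1 a b) (tensor_sum M y F2) (tensor_sum M z F3) (tensor_sum M w F4))"
    by (intro linear_tensor_sum[OF M M xyzw(1), where \<phi> = "\<lambda>t. \<Phi> t _ _ _"] F \<Phi> s)
  also have "\<dots> = tensor_sum M x (\<lambda>a b. tensor_sum M y (\<lambda>c d.
      \<Phi> (F1 a b) (F2 c d) (tensor_sum M z F3) (tensor_sum M w F4)))"
    by (intro tensor_sum_cong xyzw H.HH.linear_tensor_sum[OF M M xyzw(2), where \<phi> =
      "\<lambda>t. \<Phi> _ t _ _"] F \<Phi> s)
  also have "\<dots> = tensor_sum M x (\<lambda>a b. tensor_sum M y (\<lambda>c d. tensor_sum M z (\<lambda>i j.
      \<Phi> (F1 a b) (F2 c d) (F3 i j) (tensor_sum M w F4))))"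
    by (intro tensor_sum_cong H.HH.tensor_sum_cong xyzw
        H'.HH.linear_tensor_sum[OF M M xyzw(3), where \<phi> = "\<lambda>t. \<Phi> _ _ t _"] F \<Phi> s)
  also have "\<dots> = tensor_sum M x (\<lambda>a b. tensor_sum M y (\<lambda>c d. tensor_sum M z (\<lambda>i j. tensor_sum M w (\<lambda>m n.
      \<Phi> (F1 a b) (F2 c d) (F3 i j) (F4 m n)))))"
    by (intro tensor_sum_cong H.HH.tensor_sum_cong H'.HH.tensor_sum_cong xyzw
        linear_tensor_sum[OF M M xyzw(4), where \<phi> = "\<lambda>t. \<Phi> _ _ _ t"] F \<Phi>)
  finally show ?thesis by (simp add: quad_sum_def)
qed

end

section \<open>The element [p, p'] and the candidate for its inverse\<close>

definition P where "P = bicrossed_R_matrix K H H' r p p'"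

lemma P_eq: "P = quad_sum TT.T r p p' R (\<lambda>a b c d i j m n. pure_tensor K T T
    (pure (a \<otimes>\<^bsub>H\<^esub> c) (i \<otimes>\<^bsub>H'\<^esub> n)) (pure (d \<otimes>\<^bsub>H\<^esub> m) (b \<otimes>\<^bsub>H'\<^esub> j)))"
  by (simp add: P_def bicrossed_R_matrix_def Let_def inv_r quad_sum_def)

text \<open>The inverse of \<open>P = r\<^sub>1\<^sub>4 p\<^sub>1\<^sub>3 p'\<^sub>2\<^sub>4 r\<^sub>3\<^sub>2\<^sup>-\<^sup>1\<close> in \<open>H \<otimes> H' \<otimes> H \<otimes> H'\<close>.\<close>

definition Q where "Q = quad_sum TT.T R pinv pinv' r (\<lambda>a b c d i j m n. pure_tensor K T T
    (pure (c \<otimes>\<^bsub>H\<^esub> a) (n \<otimes>\<^bsub>H'\<^esub> i)) (pure (m \<otimes>\<^bsub>H\<^esub> d) (j \<otimes>\<^bsub>H'\<^esub> b)))"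

lemma p_pinv_closed [simp]: "p \<in> carrier H.HH.T" "p' \<in> carrier H'.HH.T"
    "pinv \<in> carrier H.HH.T" "pinv' \<in> carrier H'.HH.T"
  by (simp_all add: H.r_closed H'.r_closed)

lemma P_closed [simp]: "P \<in> carrier TT.T"
  unfolding P_eq by (rule quad_sum_in) (auto intro: TT.tensor_module)

lemma Q_closed [simp]: "Q \<in> carrier TT.T"
  unfolding Q_def by (rule quad_sum_in) (auto intro: TT.tensor_module)

section \<open>The Yang--Baxter equation for cabled strands\<close>

context
  fixes M :: "('k, 'd, 'q) module_scheme" (structure) and a1 a2 a3 :: "'a \<Rightarrow> 'd" and b1 b2 b3 ::
    "'b \<Rightarrow> 'd"
  assumes M: "kalgebra K M"
    and a: "a1 \<in> algebra_homs K H M" "a2 \<in> algebra_homs K H M" "a3 \<in> algebra_homs K H M"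
    and b: "b1 \<in> algebra_homs K H' M" "b2 \<in> algebra_homs K H' M" "b3 \<in> algebra_homs K H' M"
    and cm: "commuting M (a1 ` carrier H) (a2 ` carrier H)"
      "commuting M (a1 ` carrier H) (a3 ` carrier H)"
      "commuting M (a1 ` carrier H) (b1 ` carrier H')" "commuting M (a1 ` carrier H) (b2 ` carrier H')"
      "commuting M (a1 ` carrier H) (b3 ` carrier H')" "commuting M (a2 ` carrier H) (a3 ` carrier H)"
      "commuting M (a2 ` carrier H) (b1 ` carrier H')" "commuting M (a2 ` carrier H) (b2 ` carrier H')"
      "commuting M (a2 ` carrier H) (b3 ` carrier H')" "commuting M (a3 ` carrier H) (b1 ` carrier H')"
      "commuting M (a3 ` carrier H) (b2 ` carrier H')" "commuting M (a3 ` carrier H) (b3 ` carrier H')"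
      "commuting M (b1 ` carrier H') (b2 ` carrier H')"
        "commuting M (b1 ` carrier H') (b3 ` carrier H')"
      "commuting M (b2 ` carrier H') (b3 ` carrier H')"
begin

interpretation M: kalgebra K M by (rule M)

text \<open>Cable i consists of the strand \<open>ai\<close> from H and the strand \<open>bi\<close>
  from H'. Each parenthesis contains the four crossings between the strands of two cables, so the
  claim is an instance of the word identity for cables.\<close>

lemma legs_yang_baxter:
  "(legs M a1 b2 r \<otimes> legs M a1 a2 p \<otimes> legs M b1 b2 p' \<otimes> legs M a2 b1 R)
    \<otimes> (legs M a1 b3 r \<otimes> legs M a1 a3 p \<otimes> legs M b1 b3 p' \<otimes> legs M a3 b1 R)
    \<otimes> (legs M a2 b3 r \<otimes> legs M a2 a3 p \<otimes> legs M b2 b3 p' \<otimes> legs M a3 b2 R) =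
   (legs M a2 b3 r \<otimes> legs M a2 a3 p \<otimes> legs M b2 b3 p' \<otimes> legs M a3 b2 R)
    \<otimes> (legs M a1 b3 r \<otimes> legs M a1 a3 p \<otimes> legs M b1 b3 p' \<otimes> legs M a3 b1 R)
    \<otimes> (legs M a1 b2 r \<otimes> legs M a1 a2 p \<otimes> legs M b1 b2 p' \<otimes> legs M a2 b1 R)"
proof -
  have fn: "a1 \<in> carrier H \<rightarrow> carrier M" "a2 \<in> carrier H \<rightarrow> carrier M" "a3 \<in> carrier H \<rightarrow> carrier M"
    "b1 \<in> carrier H' \<rightarrow> carrier M" "b2 \<in> carrier H' \<rightarrow> carrier M" "b3 \<in> carrier H' \<rightarrow> carrier M"
    using algebra_homsD(2)[OF a(1)] algebra_homsD(2)[OF a(2)] algebra_homsD(2)[OF a(3)]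
      algebra_homsD(2)[OF b(1)] algebra_homsD(2)[OF b(2)] algebra_homsD(2)[OF b(3)] by auto
  note cm' = cm cm[THEN commuting_sym]
  note in_M = legs_closed[OF M r_closed] legs_closed[OF M R_closed]
    H.HH.legs_closed[OF M p_pinv_closed(1)] H'.HH.legs_closed[OF M p_pinv_closed(2)]
  note pairs = kalgebra_pair_axioms H.HH.kalgebra_pair_axioms H'.HH.kalgebra_pair_axioms
  have inv: "legs M f g r \<otimes> legs M f g R = \<one>" "legs M f g R \<otimes> legs M f g r = \<one>"
    if "f \<in> algebra_homs K H M" "g \<in> algebra_homs K H' M"
      "commuting M (f ` carrier H) (g ` carrier H')" for f g
    using legs_inverse[OF M that r_closed R_closed r_mult_R]
      legs_inverse[OF M that R_closed r_closed R_mult_r] by simp_all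
  note ybl = H.yang_baxter_left[OF bialgebra_copairing_axioms M]
  note ybr = H'.yang_baxter_right[OF bialgebra_copairing_axioms M]
  note outer = M.braid_inverse_outer[OF _ inv] and inner = M.braid_inverse_inner[OF _ inv inv]
  note yb = ybl ybr H.yang_baxter_left[OF H.rr.bialgebra_copairing_axioms M]
    H'.yang_baxter_left[OF H'.rr.bialgebra_copairing_axioms M]
  \<comment> \<open>Of the eight braid relations four contain no R and are among \<open>yb\<close>.
    The other four contain one or two factors R and arise by inverting one or two crossings in a
    mixed equation for r.\<close>
  note inverse_yb = outer[OF ybr[symmetric]] outer[OF ybl, symmetric]
    inner[OF ybl] inner[OF ybr[symmetric], symmetric]
  show ?thesis
    by (rule M.cabled_yang_baxter;
        ((intro in_M fn; fail) |
          (rule legs_commute, (rule r_closed R_closed p_pinv_closed(1,2))+,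
            (rule M pairs fn cm')+; fail) |
          (intro yb a b cm'; fail) |
          (rule inverse_yb; intro in_M fn a b cm'; fail)))
qed

end

section \<open>Legs of the R-matrix\<close>

text \<open>For \<open>e\<close> an embedding of T into a larger algebra, \<open>left_leg\<close>
  and \<open>right_leg\<close> are its two strands.\<close>

definition left_leg :: "(('a, 'b) tensor \<Rightarrow> 'd) \<Rightarrow> 'a \<Rightarrow> 'd"
  where "left_leg e = (\<lambda>a. e (inl a))"

definition right_leg :: "(('a, 'b) tensor \<Rightarrow> 'd) \<Rightarrow> 'b \<Rightarrow> 'd"
  where "right_leg e = (\<lambda>b. e (inr b))"

lemmas leg_defs = left_leg_def right_leg_def

lemma leg_split:
  fixes M (structure)
  assumes e: "e \<in> algebra_homs K T M" and ab: "a \<in> carrier H" "b \<in> carrier H'"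
  shows "e (pure a b) = left_leg e a \<otimes> right_leg e b"
    and "right_leg e b \<otimes> left_leg e a = left_leg e a \<otimes> right_leg e b"
proof -
  have in_T: "inl a \<in> carrier T" "inr b \<in> carrier T" using ab by auto
  have "inl a \<otimes>\<^bsub>T\<^esub> inr b = pure a b" "inr b \<otimes>\<^bsub>T\<^esub> inl a = pure a b"
    using ab by simp_all
  then show "e (pure a b) = left_leg e a \<otimes> right_leg e b"
    "right_leg e b \<otimes> left_leg e a = left_leg e a \<otimes> right_leg e b"
    unfolding leg_defs algebra_homsD(3)[OF e in_T, symmetric] algebra_homsD(3)[OF e in_T(2,1), symmetric]
    by simp_all
qed

lemma leg_mult:
  fixes M (structure)
  assumes e: "e \<in> algebra_homs K T M"
  shows "a \<in> carrier H \<Longrightarrow> a' \<in> carrier H \<Longrightarrow>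
      left_leg e (a \<otimes>\<^bsub>H\<^esub> a') = left_leg e a \<otimes> left_leg e a'"
    and "b \<in> carrier H' \<Longrightarrow> b' \<in> carrier H' \<Longrightarrow>
      right_leg e (b \<otimes>\<^bsub>H'\<^esub> b') = right_leg e b \<otimes> right_leg e b'"
  using algebra_homsD(3)[OF algebra_homs_compose[OF e inl_hom]]
    algebra_homsD(3)[OF algebra_homs_compose[OF e inr_hom]] by (simp_all add: leg_defs)

text \<open>The embedded copies of H and H' commute in T, so reversing the product does not affect
  how a pure tensor splits; it shows only in products within one strand.\<close>

lemma leg_opposite_split:
  fixes M (structure)
  assumes e: "e \<in> algebra_homs K (opposite T) M" and ab: "a \<in> carrier H" "b \<in> carrier H'"
  shows "e (pure a b) = left_leg e a \<otimes> right_leg e b"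
    and "right_leg e b \<otimes> left_leg e a = left_leg e a \<otimes> right_leg e b"
proof -
  have in_T: "inl a \<in> carrier (opposite T)" "inr b \<in> carrier (opposite T)" using ab by auto
  have "inl a \<otimes>\<^bsub>opposite T\<^esub> inr b = pure a b"
    "inr b \<otimes>\<^bsub>opposite T\<^esub> inl a = pure a b"
    using ab by simp_all
  then show "e (pure a b) = left_leg e a \<otimes> right_leg e b"
    "right_leg e b \<otimes> left_leg e a = left_leg e a \<otimes> right_leg e b"
    unfolding leg_defs algebra_homsD(3)[OF e in_T, symmetric] algebra_homsD(3)[OF e in_T(2,1), symmetric]
    by simp_all
qed

lemma leg_opposite_mult:
  fixes M (structure)
  assumes e: "e \<in> algebra_homs K (opposite T) M"
  shows "a \<in> carrier H \<Longrightarrow> a' \<in> carrier H \<Longrightarrow>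
      left_leg e (a \<otimes>\<^bsub>H\<^esub> a') = left_leg e a' \<otimes> left_leg e a"
    and "b \<in> carrier H' \<Longrightarrow> b' \<in> carrier H' \<Longrightarrow>
      right_leg e (b \<otimes>\<^bsub>H'\<^esub> b') = right_leg e b' \<otimes> right_leg e b"
  using algebra_homsD(3)[OF e, of "inl a'" "inl a"] algebra_homsD(3)[OF e, of "inr b'" "inr b"]
  by (simp_all add: leg_defs)

context
  fixes M :: "('k, 'd, 'q) module_scheme" (structure) and e e' :: "('a, 'b) tensor \<Rightarrow> 'd"
  assumes M: "kalgebra K M" and e: "e \<in> algebra_homs K T M"
    and ee': "commuting M (e ` carrier T) (e' ` carrier T)"
begin

interpretation M: kalgebra K M by (rule M)

lemma e_closed: "x \<in> carrier T \<Longrightarrow> e x \<in> carrier M"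
  by (rule algebra_homsD(2)[OF e])

lemma legs_quad_sum:
  assumes e': "e' \<in> linear_maps K T M"
    and "x \<in> carrier T" "y \<in> carrier H.HH.T" "z \<in> carrier H'.HH.T" "w \<in> carrier T"
    and "\<And>a b c d i j m n. a \<in> carrier H \<Longrightarrow> b \<in> carrier H' \<Longrightarrow> c \<in> carrier H \<Longrightarrow> d \<in> carrier H
    \<Longrightarrow> i \<in> carrier H' \<Longrightarrow> j \<in> carrier H' \<Longrightarrow> m \<in> carrier H \<Longrightarrow> n \<in> carrier H'
    \<Longrightarrow> G a b c d i j m n \<in> carrier T \<and> G' a b c d i j m n \<in> carrier T"
  shows "legs M e e' (quad_sum TT.T x y z w (\<lambda>a b c d i j m n.
      TT.pure (G a b c d i j m n) (G' a b c d i j m n))) =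
    quad_sum M x y z w (\<lambda>a b c d i j m n. e (G a b c d i j m n) \<otimes> e' (G' a b c d i j m n))"
proof -
  have "legs M e e' (quad_sum TT.T x y z w (\<lambda>a b c d i j m n.
      TT.pure (G a b c d i j m n) (G' a b c d i j m n))) =
    quad_sum M x y z w (\<lambda>a b c d i j m n. legs M e e'
      (TT.pure (G a b c d i j m n) (G' a b c d i j m n)))"
    using assms
    by (intro linear_quad_sum TT.tensor_module M.module_axioms
        TT.legs_linear[OF M algebra_homsD(1)[OF e] e']) auto
  also have "\<dots> = quad_sum M x y z w (\<lambda>a b c d i j m n.
      e (G a b c d i j m n) \<otimes> e' (G' a b c d i j m n))"
    using assms
    by (intro quad_sum_cong TT.legs_pure[OF M algebra_homsD(1)[OF e] e']) auto
  finally show ?thesis .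
qed

lemma cross_commute:
  assumes e': "e' \<in> linear_maps K T M" and "x \<in> carrier T" "y \<in> carrier T"
  shows "e' y \<otimes> e x = e x \<otimes> e' y"
  using assms ee' by (simp add: commuting_def)

lemma leg_closed:
  assumes "e' \<in> linear_maps K T M"
  shows "a \<in> carrier H \<Longrightarrow> left_leg e a \<in> carrier M" "b \<in> carrier H' \<Longrightarrow> right_leg e b \<in> carrier M"
    "a \<in> carrier H \<Longrightarrow> left_leg e' a \<in> carrier M" "b \<in> carrier H' \<Longrightarrow> right_leg e' b \<in> carrier M"
  using e_closed linear_mapsD(1)[OF assms] by (simp_all add: leg_defs)

lemma leg_commute:
  assumes e': "e' \<in> linear_maps K T M" and "a \<in> carrier H" "b \<in> carrier H'"
  shows "a' \<in> carrier H \<Longrightarrow> left_leg e' a' \<otimes> left_leg e a = left_leg e a \<otimes> left_leg e' a'"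
    "b' \<in> carrier H' \<Longrightarrow> right_leg e' b' \<otimes> left_leg e a = left_leg e a \<otimes> right_leg e' b'"
    "a' \<in> carrier H \<Longrightarrow> left_leg e' a' \<otimes> right_leg e b = right_leg e b \<otimes> left_leg e' a'"
    "b' \<in> carrier H' \<Longrightarrow> right_leg e' b' \<otimes> right_leg e b = right_leg e b \<otimes> right_leg e' b'"
  using assms cross_commute[OF e'] by (simp_all add: leg_defs)

lemmas quadrilinear_sums_P_Q
  = quadrilinear_sums[OF r_closed p_pinv_closed(1,2) R_closed M.module_axioms]
  quadrilinear_sums[OF R_closed p_pinv_closed(3,4) r_closed M.module_axioms]

text \<open>Every strand meets exactly two of the four factors, and in the same order on both sides,
  while elements on different strands commute.\<close>

lemma legs_P_Q:
  assumes e': "e' \<in> algebra_homs K T M"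
  shows "legs M e e' P =
      legs M (left_leg e) (right_leg e') r \<otimes> legs M (left_leg e) (left_leg e') p
        \<otimes> legs M (right_leg e) (right_leg e') p' \<otimes> legs M (left_leg e') (right_leg e) R" (is "?l1
          = ?r1")
    and "legs M e e' Q =
      legs M (left_leg e') (right_leg e) r \<otimes> legs M (right_leg e) (right_leg e') pinv'
        \<otimes> legs M (left_leg e) (left_leg e') pinv \<otimes> legs M (left_leg e) (right_leg e') R" (is "?l2
          = ?r2")
proof -
  note el = algebra_homsD(1)[OF e'] and cl = leg_closed[OF algebra_homsD(1)[OF e']]
  \<comment> \<open>Rewriting with these facts brings every word into the strand order left of
    \<open>e\<close>, right of \<open>e\<close>, left of \<open>e'\<close>, right of
    \<open>e'\<close>; only the order within one strand is kept.\<close>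
  note sort = leg_split[OF e] leg_split[OF e'] leg_mult[OF e] leg_mult[OF e']
    cl leg_commute[OF el] M.m_assoc
    M.left_commute[OF leg_split(2)[OF e]] M.left_commute[OF leg_split(2)[OF e']]
    leg_commute[OF el, THEN M.left_commute]
  have "?r1 =
    quad_sum M r p p' R (\<lambda>a b c d i j m n.
      (left_leg e a \<otimes> right_leg e' b) \<otimes> (left_leg e c \<otimes> left_leg e' d) \<otimes> (right_leg e i
        \<otimes> right_leg e' j) \<otimes> (left_leg e' m \<otimes> right_leg e n))"
    unfolding legs_def
    by (rule quadrilinear_sums_P_Q(1)[where \<Phi> = "\<lambda>A B C D. A \<otimes> B \<otimes> C \<otimes> D"];
        intro M.linear_mult_left M.linear_mult_right linear_maps_id M.m_closed; simp add: cl)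
  then show "?l1 = ?r1"
    unfolding P_eq
    by (subst legs_quad_sum[OF el]) (auto simp: sort intro!: quad_sum_cong)
  have "?r2 =
    quad_sum M R pinv pinv' r (\<lambda>a b c d i j m n.
      (left_leg e' m \<otimes> right_leg e n) \<otimes> (right_leg e i \<otimes> right_leg e' j) \<otimes> (left_leg e c
        \<otimes> left_leg e' d) \<otimes> (left_leg e a \<otimes> right_leg e' b))"
    unfolding legs_def
    by (rule quadrilinear_sums_P_Q(2)[where \<Phi> = "\<lambda>A B C D. D \<otimes> C \<otimes> B \<otimes> A"];
        intro M.linear_mult_left M.linear_mult_right linear_maps_id M.m_closed; simp add: cl)
  then show "?l2 = ?r2"
    unfolding Q_def
    by (subst legs_quad_sum[OF el]) (auto simp: sort intro!: quad_sum_cong)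
qed

text \<open>Now \<open>e'\<close> reverses products, so the two factors meeting on a strand of the
  second copy must be exchanged, while those on the first copy keep their order. For P this requires
  p' before r and R, and both before p; r and R have no common strand.\<close>

lemma legs_P_Q_opposite:
  assumes e': "e' \<in> algebra_homs K (opposite T) M"
  shows "legs M e e' P =
      legs M (right_leg e) (right_leg e') p' \<otimes> legs M (left_leg e) (right_leg e') r
        \<otimes> legs M (left_leg e') (right_leg e) R \<otimes> legs M (left_leg e) (left_leg e') p" (is "?l1 = ?r1")
    and "legs M e e' Q =
      legs M (left_leg e) (left_leg e') pinv \<otimes> legs M (left_leg e') (right_leg e) r
        \<otimes> legs M (left_leg e) (right_leg e') R \<otimes> legs M (right_leg e) (right_leg e') pinv'" (is "?l2
          = ?r2")
proof -
  have el: "e' \<in> linear_maps K T M" using algebra_homsD(1)[OF e'] by simp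
  note cl = leg_closed[OF el]
  note sort = leg_split[OF e] leg_opposite_split[OF e'] leg_mult[OF e] leg_opposite_mult[OF e']
    cl leg_commute[OF el] M.m_assoc
    M.left_commute[OF leg_split(2)[OF e]] M.left_commute[OF leg_opposite_split(2)[OF e']]
    leg_commute[OF el, THEN M.left_commute]
  have "?r1 =
    quad_sum M r p p' R (\<lambda>a b c d i j m n.
      (right_leg e i \<otimes> right_leg e' j) \<otimes> (left_leg e a \<otimes> right_leg e' b) \<otimes> (left_leg e' m
        \<otimes> right_leg e n) \<otimes> (left_leg e c \<otimes> left_leg e' d))"
    unfolding legs_def
    by (rule quadrilinear_sums_P_Q(1)[where \<Phi> = "\<lambda>A B C D. C \<otimes> A \<otimes> D \<otimes> B"];
        intro M.linear_mult_left M.linear_mult_right linear_maps_id M.m_closed; simp add: cl)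
  then show "?l1 = ?r1"
    unfolding P_eq
    by (subst legs_quad_sum[OF el]) (auto simp: sort intro!: quad_sum_cong)
  have "?r2 =
    quad_sum M R pinv pinv' r (\<lambda>a b c d i j m n.
      (left_leg e c \<otimes> left_leg e' d) \<otimes> (left_leg e' m \<otimes> right_leg e n) \<otimes> (left_leg e a
        \<otimes> right_leg e' b) \<otimes> (right_leg e i \<otimes> right_leg e' j))"
    unfolding legs_def
    by (rule quadrilinear_sums_P_Q(2)[where \<Phi> = "\<lambda>A B C D. B \<otimes> D \<otimes> A \<otimes> C"];
        intro M.linear_mult_left M.linear_mult_right linear_maps_id M.m_closed; simp add: cl)
  then show "?l2 = ?r2"
    unfolding Q_def
    by (subst legs_quad_sum[OF el]) (auto simp: sort intro!: quad_sum_cong)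
qed

end

section \<open>The oriented quantum algebra\<close>

lemma leg_hom:
  "e \<in> algebra_homs K T M \<Longrightarrow> left_leg e \<in> algebra_homs K H M"
  "e \<in> algebra_homs K T M \<Longrightarrow> right_leg e \<in> algebra_homs K H' M"
  unfolding leg_defs
  by (erule algebra_homs_compose[OF _ inl_hom], erule algebra_homs_compose[OF _ inr_hom])

lemma leg_opposite_hom:
  assumes "e \<in> algebra_homs K (opposite T) M"
  shows "left_leg e \<in> algebra_homs K (opposite H) M" "right_leg e \<in> algebra_homs K (opposite H') M"
proof -
  have "inl \<in> algebra_homs K (opposite H) (opposite T)"
    "inr \<in> algebra_homs K (opposite H') (opposite T)"
    using algebra_homsD[OF inl_hom] algebra_homsD[OF inr_hom] by (auto intro!: algebra_homsI)
  then show "left_leg e \<in> algebra_homs K (opposite H) M" "right_leg e \<in> algebra_homs K (opposite H') M"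
    unfolding leg_defs by (auto intro: algebra_homs_compose[OF assms])
qed

lemma leg_commuting:
  "e \<in> algebra_homs K T M \<Longrightarrow> commuting M (left_leg e ` carrier H) (right_leg e ` carrier H')"
  using leg_split(2)[of e M] by (auto simp: commuting_def)

lemma legs_commuting:
  assumes "commuting M (e ` carrier T) (e' ` carrier T)"
  shows "commuting M (left_leg e ` carrier H) (left_leg e' ` carrier H)"
    "commuting M (left_leg e ` carrier H) (right_leg e' ` carrier H')"
    "commuting M (right_leg e ` carrier H') (left_leg e' ` carrier H)"
    "commuting M (right_leg e ` carrier H') (right_leg e' ` carrier H')"
  using assms by (auto simp: commuting_def leg_defs)

lemma leg_U:
  "a \<in> carrier H \<Longrightarrow> left_leg (\<lambda>x. e (U x)) a = left_leg e (H.\<sigma> (H.\<sigma> a))"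
  "b \<in> carrier H' \<Longrightarrow> right_leg (\<lambda>x. e (U x)) b = right_leg e (H'.\<sigma> (H'.\<sigma> b))"
  using algebra_homsD(4)[OF H.inverse_square_hom] algebra_homsD(4)[OF H'.inverse_square_hom]
  by (simp_all add: leg_defs H.inverse_square_antipode H'.inverse_square_antipode)

lemma P_mult_Q: "P \<otimes>\<^bsub>TT.T\<^esub> Q = \<one>\<^bsub>TT.T\<^esub>" and Q_mult_P: "Q \<otimes>\<^bsub>TT.T\<^esub> P = \<one>\<^bsub>TT.T\<^esub>"
proof -
  let ?e = "TT.inl" and ?e' = "TT.inr"
  note M = TT.tensor_kalgebra and hom = TT.inl_hom TT.inr_hom
  note c = legs_commuting[OF TT.inl_inr_commuting]
  note l = leg_hom[OF hom(1)] leg_hom[OF hom(2)]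
  note 1 = legs_inverse[OF M l(1,4) c(2) r_closed R_closed r_mult_R]
    legs_inverse[OF M l(1,4) c(2) R_closed r_closed R_mult_r]
  note 2 = H.HH.legs_inverse[OF M l(1,3) c(1) p_pinv_closed(1,3) H.rr.r_mult_R]
    H.HH.legs_inverse[OF M l(1,3) c(1) p_pinv_closed(3,1) H.rr.R_mult_r]
  note 3 = H'.HH.legs_inverse[OF M l(2,4) c(4) p_pinv_closed(2,4) H'.rr.r_mult_R]
    H'.HH.legs_inverse[OF M l(2,4) c(4) p_pinv_closed(4,2) H'.rr.R_mult_r]
  note 4 = legs_inverse[OF M l(3,2) commuting_sym[OF c(3)] R_closed r_closed R_mult_r]
    legs_inverse[OF M l(3,2) commuting_sym[OF c(3)] r_closed R_closed r_mult_R]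
  have fn: "left_leg ?e \<in> carrier H \<rightarrow> carrier TT.T" "right_leg ?e \<in> carrier H' \<rightarrow> carrier TT.T"
    "left_leg ?e' \<in> carrier H \<rightarrow> carrier TT.T" "right_leg ?e' \<in> carrier H' \<rightarrow> carrier TT.T"
    using algebra_homsD(2)[OF l(1)] algebra_homsD(2)[OF l(2)] algebra_homsD(2)[OF l(3)]
      algebra_homsD(2)[OF l(4)] by auto
  note in_M = legs_closed[OF M r_closed] legs_closed[OF M R_closed]
    H.HH.legs_closed[OF M p_pinv_closed(1)] H'.HH.legs_closed[OF M p_pinv_closed(2)]
    H.HH.legs_closed[OF M p_pinv_closed(3)] H'.HH.legs_closed[OF M p_pinv_closed(4)]
  note PQ = legs_P_Q[OF M hom(1) TT.inl_inr_commuting hom(2), unfolded TT.legs_inl_inr[OF P_closed]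
      TT.legs_inl_inr[OF Q_closed]]
  show "P \<otimes>\<^bsub>TT.T\<^esub> Q = \<one>\<^bsub>TT.T\<^esub>"
    unfolding PQ by (rule TT.T.inverse_word4[OF _ _ _ _ _ _ _ _ 1(1) 2(1) 3(1) 4(1)]) (intro in_M fn)+
  show "Q \<otimes>\<^bsub>TT.T\<^esub> P = \<one>\<^bsub>TT.T\<^esub>"
    unfolding PQ by (rule TT.T.inverse_word4[OF _ _ _ _ _ _ _ _ 4(2) 3(2) 2(2) 1(2)]) (intro in_M fn)+
qed

lemma P_Units: "P \<in> Units TT.T"
  using P_mult_Q Q_mult_P by (auto simp: Units_def)

lemma inv_P: "inv\<^bsub>TT.T\<^esub> P = Q"
  using TT.T.inv_unique'[OF P_closed Q_closed P_mult_Q Q_mult_P] by simp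

text \<open>In \<open>T \<otimes> T\<^sup>o\<^sup>p\<close> the factors of \<open>P\<^sup>-\<^sup>1\<close> and of \<open>(id \<otimes> U)(P)\<close> occur in opposite orders and are
  inverse to each other one by one.\<close>

lemma twisted_inverse:
  defines "N \<equiv> tensor_algebra K T (opposite T)"
  defines "Y \<equiv> tensor_sum TT.T P (\<lambda>x y. TT.pure x (U y))"
  shows "Q \<otimes>\<^bsub>N\<^esub> Y = \<one>\<^bsub>TT.T\<^esub>" "Y \<otimes>\<^bsub>N\<^esub> Q = \<one>\<^bsub>TT.T\<^esub>"
proof -
  interpret O: kalgebra_pair K T "opposite T"
    by (rule kalgebra_pairI[OF T.kalgebra_axioms T.kalgebra_opposite])
  define e e' where "e = O.inl" and "e' = O.inr"
  define d where "d = (\<lambda>x. e' (U x))"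
  have e: "e \<in> algebra_homs K T O.T" and e': "e' \<in> algebra_homs K (opposite T) O.T"
    and ee': "commuting O.T (e ` carrier T) (e' ` carrier T)"
    using O.inl_hom O.inr_hom O.inl_inr_commuting unfolding e_def e'_def by auto
  have "U \<in> algebra_homs K (opposite T) (opposite T)"
    using algebra_homsD[OF U_hom] by (auto intro!: algebra_homsI)
  then have d: "d \<in> algebra_homs K (opposite T) O.T"
    unfolding d_def by (rule algebra_homs_compose[OF e'])
  have ed: "commuting O.T (e ` carrier T) (d ` carrier T)"
    using ee' by (auto simp: commuting_def d_def)
  have Q: "legs O.T e e' Q = Q"
    unfolding e_def e'_def by (rule O.legs_inl_inr) simp
  have Y: "legs O.T e d P = Y"
    unfolding legs_def Y_def e_def d_def e'_def
    by (auto intro!: TT.tensor_sum_cong simp: O.tensor_mult_pure[simplified])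
  note M = O.tensor_kalgebra
  note E = leg_hom[OF e] and E' = leg_opposite_hom[OF e'] and c = legs_commuting[OF ee']
  note \<tau> = leg_U[of _ e', folded d_def]
  have dl: "legs O.T (right_leg e) (right_leg d) p'
    = legs O.T (right_leg e) (\<lambda>b. right_leg e' (H'.\<sigma> (H'.\<sigma> b))) p'"
    "legs O.T (left_leg e) (right_leg d) r = legs O.T (left_leg e) (\<lambda>b. right_leg e' (H'.\<sigma> (H'.\<sigma> b))) r"
    "legs O.T (left_leg d) (right_leg e) R = legs O.T (\<lambda>a. left_leg e' (H.\<sigma> (H.\<sigma> a))) (right_leg e) R"
    "legs O.T (left_leg e) (left_leg d) p = legs O.T (left_leg e) (\<lambda>a. left_leg e' (H.\<sigma> (H.\<sigma> a))) p"
    by (rule legs_cong[OF H'.HH.module_pair_axioms] legs_cong[OF module_pair_axioms]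
        legs_cong[OF H.HH.module_pair_axioms]; simp add: \<tau>)+
  note h = H.\<sigma>_hom H.\<sigma>_antipode H.antipode_\<sigma> and h' = H'.\<sigma>_hom H'.\<sigma>_antipode H'.antipode_\<sigma>
  note 1 = H.rr.legs_opposite_right[OF M h H.\<sigma>_hom H.\<sigma>_antipode E(1) E'(1) c(1)]
  \<comment> \<open>In \<open>R\<close> the H-factor lies in the second copy of T, so the
    antimultiplicative leg is the left one. For p, r and p' it is the right one.\<close>
  note 2 = legs_opposite_left[OF M h H'.\<sigma>_hom H'.\<sigma>_antipode E'(1) E(2) commuting_sym[OF c(3)]]
  note 3 = legs_opposite_right[OF M h H'.\<sigma>_hom H'.\<sigma>_antipode E(1) E'(2) c(2)]
  note 4 = H'.rr.legs_opposite_right[OF M h' H'.\<sigma>_hom H'.\<sigma>_antipode E(2) E'(2) c(4)]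
  have fn: "left_leg e \<in> carrier H \<rightarrow> carrier O.T" "right_leg e \<in> carrier H' \<rightarrow> carrier O.T"
    "left_leg e' \<in> carrier H \<rightarrow> carrier O.T" "right_leg e' \<in> carrier H' \<rightarrow> carrier O.T"
    "(\<lambda>a. left_leg e' (H.\<sigma> (H.\<sigma> a))) \<in> carrier H \<rightarrow> carrier O.T"
    "(\<lambda>b. right_leg e' (H'.\<sigma> (H'.\<sigma> b))) \<in> carrier H' \<rightarrow> carrier O.T"
    using algebra_homsD(2)[OF E(1)] algebra_homsD(2)[OF E(2)] algebra_homsD(2)[OF E'(1)]
      algebra_homsD(2)[OF E'(2)] by auto
  note in_M = legs_closed[OF M r_closed] legs_closed[OF M R_closed]
    H.HH.legs_closed[OF M p_pinv_closed(1)] H'.HH.legs_closed[OF M p_pinv_closed(2)]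
    H.HH.legs_closed[OF M p_pinv_closed(3)] H'.HH.legs_closed[OF M p_pinv_closed(4)]
  note Q' = legs_P_Q_opposite(2)[OF M e ee' e', unfolded Q]
    and Y' = legs_P_Q_opposite(1)[OF M e ed d, unfolded Y dl]
  have "Q \<otimes>\<^bsub>O.T\<^esub> Y = \<one>\<^bsub>O.T\<^esub>"
    unfolding Q' Y'
    by (rule O.T.inverse_word4[OF _ _ _ _ _ _ _ _ 1(1) 2(1) 3(1) 4(1)]) (intro in_M fn)+
  moreover have "Y \<otimes>\<^bsub>O.T\<^esub> Q = \<one>\<^bsub>O.T\<^esub>"
    unfolding Q' Y'
    by (rule O.T.inverse_word4[OF _ _ _ _ _ _ _ _ 4(2) 3(2) 2(2) 1(2)]) (intro in_M fn)+
  ultimately show "Q \<otimes>\<^bsub>N\<^esub> Y = \<one>\<^bsub>TT.T\<^esub>" "Y \<otimes>\<^bsub>N\<^esub> Q = \<one>\<^bsub>TT.T\<^esub>"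
    by (simp_all add: N_def)
qed

text \<open>Multiplication in T \<otimes> T^op sends x \<otimes> y and a \<otimes> U(b) to x a
  \<otimes> U(b) y, so the two sums are the products of Q with (id \<otimes> U)(P) in the two
  orders.\<close>

lemma twisted_sums:
  shows "tensor_sum TT.T Q (\<lambda>x y. tensor_sum TT.T P (\<lambda>a b.
      TT.pure (x \<otimes>\<^bsub>T\<^esub> a) (U b \<otimes>\<^bsub>T\<^esub> y))) = \<one>\<^bsub>TT.T\<^esub>" (is "?l1 = _")
    and "tensor_sum TT.T Q (\<lambda>x y. tensor_sum TT.T P (\<lambda>a b.
      TT.pure (a \<otimes>\<^bsub>T\<^esub> x) (y \<otimes>\<^bsub>T\<^esub> U b))) = \<one>\<^bsub>TT.T\<^esub>" (is "?l2 = _")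
proof -
  interpret O: kalgebra_pair K T "opposite T"
    by (rule kalgebra_pairI[OF T.kalgebra_axioms T.kalgebra_opposite])
  let ?Y = "tensor_sum TT.T P (\<lambda>x y. TT.pure x (U y))"
  note mult = O.tensor_mult_pure[simplified]
  have "?l1 = Q \<otimes>\<^bsub>O.T\<^esub> ?Y"
    using TT.mult_sums(1)[OF O.tensor_kalgebra Q_closed TT.module_pair_axioms P_closed,
        of "pure_tensor K T T" "\<lambda>x y. TT.pure x (U y)"]
    by (simp add: mult TT.tensor_sum_pure_tensor cong: TT.tensor_sum_cong)
  then show "?l1 = \<one>\<^bsub>TT.T\<^esub>" by (simp add: twisted_inverse(1))
  \<comment> \<open>Here \<open>Q\<close> is the right factor but its sum stands outside, hence the
    second form of \<open>mult_sums\<close>.\<close>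
  have "?l2 = ?Y \<otimes>\<^bsub>O.T\<^esub> Q"
    using TT.mult_sums(2)[OF O.tensor_kalgebra P_closed TT.module_pair_axioms Q_closed,
        of "\<lambda>x y. TT.pure x (U y)" "pure_tensor K T T"]
    by (simp add: mult TT.tensor_sum_pure_tensor cong: TT.tensor_sum_cong)
  then show "?l2 = \<one>\<^bsub>TT.T\<^esub>" by (simp add: twisted_inverse(2))
qed

text \<open>U \<otimes> U acts on each of the four factors of P as S^-2 \<otimes> S^-2 on its two
  legs, and this fixes r, R, p and p'.\<close>

lemma U_invariant: "tensor_map K T T T T U U P = P"
proof -
  define e e' where "e = TT.inl" and "e' = TT.inr"
  define d d' where "d = (\<lambda>x. e (U x))" and "d' = (\<lambda>x. e' (U x))"
  note M = TT.tensor_kalgebra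
  have e: "e \<in> algebra_homs K T TT.T" "e' \<in> algebra_homs K T TT.T"
    and c: "commuting TT.T (e ` carrier T) (e' ` carrier T)"
    using TT.inl_hom TT.inr_hom TT.inl_inr_commuting unfolding e_def e'_def by auto
  have d: "d \<in> algebra_homs K T TT.T" "d' \<in> algebra_homs K T TT.T"
    unfolding d_def d'_def using e U_hom by (auto intro: algebra_homs_compose)
  have dd': "commuting TT.T (d ` carrier T) (d' ` carrier T)"
    using c by (auto simp: commuting_def d_def d'_def)
  note \<tau> = leg_U[of _ e, folded d_def] leg_U[of _ e', folded d'_def]
  note lin = leg_hom[OF e(1), THEN algebra_homsD(1)] leg_hom[OF e(2), THEN algebra_homsD(1)]
  note h = H.\<sigma>_hom H.\<sigma>_antipode H.antipode_\<sigma> and h' = H'.\<sigma>_hom H'.\<sigma>_antipode H'.antipode_\<sigma>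
  have "legs TT.T (left_leg d) (right_leg d') r = legs TT.T (left_leg e) (right_leg e') r"
    "legs TT.T (left_leg d') (right_leg d) R = legs TT.T (left_leg e') (right_leg e) R"
    using legs_\<sigma>\<sigma>[OF M h h'(1,2) lin(1,4)] legs_\<sigma>\<sigma>[OF M h h'(1,2) lin(3,2)]
    by (simp_all add: \<tau> cong: legs_cong[OF module_pair_axioms])
  moreover have "legs TT.T (left_leg d) (left_leg d') p = legs TT.T (left_leg e) (left_leg e') p"
    using H.rr.legs_\<sigma>\<sigma>[OF M h h(1,2) lin(1,3)]
    by (simp add: \<tau> cong: legs_cong[OF H.HH.module_pair_axioms])
  moreover have "legs TT.T (right_leg d) (right_leg d') p' = legs TT.T (right_leg e) (right_leg e') p'"
    using H'.rr.legs_\<sigma>\<sigma>[OF M h' h'(1,2) lin(2,4)]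
    by (simp add: \<tau> cong: legs_cong[OF H'.HH.module_pair_axioms])
  ultimately have "legs TT.T d d' P = legs TT.T e e' P"
    by (simp add: legs_P_Q(1)[OF M d(1) dd' d(2)] legs_P_Q(1)[OF M e(1) c e(2)])
  also have "\<dots> = P"
    unfolding e_def e'_def by (rule TT.legs_inl_inr[OF P_closed])
  finally show ?thesis
    using TT.tensor_map_legs[OF TT.kalgebra_pair_axioms P_closed, of U U]
    by (simp add: d_def d'_def e_def e'_def)
qed

text \<open>Splitting each \<open>e1\<close>, \<open>e2\<close>, \<open>e3\<close> into its two
  strands turns the equation into the one for three cables.\<close>

lemma yang_baxter_P:
  fixes M (structure)
  assumes M: "kalgebra K M"
    and e: "e1 \<in> algebra_homs K T M" "e2 \<in> algebra_homs K T M" "e3 \<in> algebra_homs K T M"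
    and c: "commuting M (e1 ` carrier T) (e2 ` carrier T)"
      "commuting M (e1 ` carrier T) (e3 ` carrier T)" "commuting M (e2 ` carrier T) (e3 ` carrier T)"
  shows "legs M e1 e2 P \<otimes> legs M e1 e3 P \<otimes> legs M e2 e3 P =
    legs M e2 e3 P \<otimes> legs M e1 e3 P \<otimes> legs M e1 e2 P"
  unfolding legs_P_Q(1)[OF M e(1) c(1) e(2)] legs_P_Q(1)[OF M e(1) c(2) e(3)]
    legs_P_Q(1)[OF M e(2) c(3) e(3)]
  using legs_commuting[OF c(1)] legs_commuting[OF c(2)] legs_commuting[OF c(3)]
    leg_commuting[OF e(1)] leg_commuting[OF e(2)] leg_commuting[OF e(3)]
  by (intro legs_yang_baxter M leg_hom e) (auto intro: commuting_sym)

lemma oriented: "oriented_quantum_algebra K T P (\<lambda>x\<in>carrier T. x) U"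
proof (intro oriented_quantum_algebra.intro oriented_quantum_algebra_axioms.intro T.kalgebra_axioms
    P_Units U_aut U_invariant)
  let ?D = "\<lambda>x\<in>carrier T. x"
  show "?D \<in> algebra_auts K T"
    by (auto simp: algebra_auts_def bij_betw_def inj_on_def tensor_smult_closed
        intro!: algebra_homsI linear_mapsI)
  show "?D (U x) = U (?D x)" if "x \<in> carrier T" for x using that by simp
  show "tensor_sum TT.T (inv\<^bsub>TT.T\<^esub> P) (\<lambda>Rl Rl'. tensor_sum TT.T P (\<lambda>ri ri'.
      TT.pure (?D Rl \<otimes>\<^bsub>T\<^esub> ri) (U ri' \<otimes>\<^bsub>T\<^esub> Rl'))) = TT.pure \<one>\<^bsub>T\<^esub> \<one>\<^bsub>T\<^esub>"
    "tensor_sum TT.T (inv\<^bsub>TT.T\<^esub> P) (\<lambda>Rl Rl'. tensor_sum TT.T P (\<lambda>ri ri'.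
      TT.pure (ri \<otimes>\<^bsub>T\<^esub> ?D Rl) (Rl' \<otimes>\<^bsub>T\<^esub> U ri'))) = TT.pure \<one>\<^bsub>T\<^esub> \<one>\<^bsub>T\<^esub>"
    using twisted_sums unfolding inv_P by (simp_all add: TT.tensor_one cong: TT.tensor_sum_cong)
  show "tensor_map K T T T T ?D ?D P = P"
    by (simp add: tensor_map_def TT.tensor_sum_pure_tensor cong: TT.tensor_sum_cong)
  interpret X: kalgebra_pair K T TT.T ..
  \<comment> \<open>The three embeddings of T into the right-bracketed T \<otimes> (T \<otimes> T);
    with them r_12, r_13 and r_23 of the axiom become \<open>legs\<close> of P.\<close>
  let ?e1 = "X.inl" and ?e2 = "\<lambda>x. X.inr (TT.inl x)" and ?e3 = "\<lambda>x. X.inr (TT.inr x)"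
  have hom: "?e1 \<in> algebra_homs K T X.T" "?e2 \<in> algebra_homs K T X.T" "?e3 \<in> algebra_homs K T X.T"
    by (rule X.inl_hom algebra_homs_compose[OF X.inr_hom] TT.inl_hom TT.inr_hom)+
  have c: "commuting X.T (?e1 ` carrier T) (?e2 ` carrier T)"
    "commuting X.T (?e1 ` carrier T) (?e3 ` carrier T)"
      "commuting X.T (?e2 ` carrier T) (?e3 ` carrier T)"
    by (auto simp: commuting_def)
  have "tensor_sum X.T P (\<lambda>x y. pure_tensor3 K T T T x y \<one>\<^bsub>T\<^esub>) = legs X.T ?e1 ?e2 P"
    "tensor_sum X.T P (\<lambda>x y. pure_tensor3 K T T T x \<one>\<^bsub>T\<^esub> y) = legs X.T ?e1 ?e3 P"
    "tensor_sum X.T P (\<lambda>x y. pure_tensor3 K T T T \<one>\<^bsub>T\<^esub> x y) = legs X.T ?e2 ?e3 P"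
    unfolding legs_def by (auto intro!: TT.tensor_sum_cong)
  then show "let T3 = X.T;
      r12 = tensor_sum T3 P (\<lambda>ri ri'. pure_tensor3 K T T T ri ri' \<one>\<^bsub>T\<^esub>);
      r13 = tensor_sum T3 P (\<lambda>ri ri'. pure_tensor3 K T T T ri \<one>\<^bsub>T\<^esub> ri');
      r23 = tensor_sum T3 P (\<lambda>ri ri'. pure_tensor3 K T T T \<one>\<^bsub>T\<^esub> ri ri')
    in r12 \<otimes>\<^bsub>T3\<^esub> r13 \<otimes>\<^bsub>T3\<^esub> r23 = r23 \<otimes>\<^bsub>T3\<^esub> r13 \<otimes>\<^bsub>T3\<^esub> r12"
    using yang_baxter_P[OF X.tensor_kalgebra hom c] by (simp add: Let_def)
qed

end

theorem theorem3p10: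
  fixes K :: "('k, 'c) ring_scheme"
    and H :: "('k, 'a, 'm) hopf_scheme" and H' :: "('k, 'b, 'n) hopf_scheme"
    and p :: "('a, 'a) tensor" and p' :: "('b, 'b) tensor" and r :: "('a, 'b) tensor"
  assumes "field K"
    and "quasitriangular_hopf_algebra K H p"
    and "quasitriangular_hopf_algebra K H' p'"
    and "weak_R_matrix K H H' r"
  shows "oriented_quantum_algebra K (tensor_algebra K H H')
      (bicrossed_R_matrix K H H' r p p')
      (\<lambda>x\<in>carrier (tensor_algebra K H H'). x)
      (inverse_square (bicrossed_coproduct K H H' r) (antipode (bicrossed_coproduct K H H' r)))
    \<and> (tensor_algebra K H H',
        bicrossed_R_matrix K H H' r p p',
        (\<lambda>x\<in>carrier (tensor_algebra K H H'). x),
        inverse_square (bicrossed_coproduct K H H' r) (antipode (bicrossed_coproduct K H H' r)))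
      = (tensor_algebra K H H',
        bicrossed_R_matrix K H H' r p p',
        (\<lambda>x\<in>carrier (tensor_algebra K H H'). x),
        tensor_map K H H' H H' (inverse_square H (antipode H)) (inverse_square H' (antipode H')))"
proof -
  interpret bicrossed_quasitriangular K H H' p p' r
    using assms(2-4) by (rule bicrossed_quasitriangular.intro)
  show ?thesis
    using oriented unfolding P_def[symmetric] inverse_square_B U_def[symmetric] by simp
qed

end
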